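(* Let $G$ be a finite trivalent graph with perfect matching $M$, let $n$ be a positive integer, and choose any immersion of $G$ in the plane. Let $PK(G,M)[n]$ be the generalized Penrose evaluation computed from this immersion, and let $\{G,M\}$ be the matching polynomial of $(G,M)$ for $n$ colors. Then $$PK(G,M)[n] = \{G,M\}.$$
   Context: A trivalent (cubic) graph is a graph in which every node is locally incident to three edge-ends (loops and multiple edges allowed). A perfect matching $M$ of $G$ is a collection of pairwise disjoint edges of $G$ such that every node of $G$ lies on one of them (each matching edge has two end nodes). The other edges are called non-matching edges. An immersion of $G$ in the plane is a drawing of $G$ in which the only singularities are finitely many transverse double points (crossings) of interiors of edges. These original immersion crossings, on whichever edges they occur, are called boxed crossings. *Replacement at a matching edge.* View the matching edge as drawn vertically, with two further edge-ends at its top node, $a$ (left) and $b$ (right), and two at its bottom node, $c$ (left) and $d$ (right). The parallel replacement replaces the matching edge and its two nodes by two arcs running along the edge, joining $a$ to $c$ and $b$ to $d$. The crossed replacement replaces them by two arcs running along the edge, joining $a$ to $d$ and $b$ to $c$, which cross each other once; this new crossing is an ordinary (round, "circled") virtual crossing and is not boxed. If the matching edge passes through an immersion crossing, the crossings of the two replacing arcs that arise from that immersion crossing are again boxed. *The evaluation $PK(G,M)[n]$* is computed by the rules: (1) $PK(\text{matching edge}) = PK(\text{parallel replacement}) - PK(\text{crossed replacement})$ at each matching edge; (2) $PK(\text{boxed crossing}) = 2\,PK(\text{dotted crossing}) - PK(\text{round crossing})$ at each boxed crossing, where a dotted (fused) crossing fuses the two strands at that point and a round crossing is an ordinary crossing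 imposing no relation between the two strands; (3) a complex of loops connected to one another by dotted crossings contributes a single factor $n$ (in particular a single loop, possibly with round crossings, contributes $n$), and contributions of distinct complexes multiply. The evaluation is thus the sum, over all choices of replacement at the matching edges and all subsequent choices of dotted or round at the boxed crossings, of the product of the coefficients ($+1$ for parallel, $-1$ for crossed, $2$ for dotted, $-1$ for round) with $n^{k}$, where $k$ is the number of connected complexes of loops, two loops being connected if they meet at a dotted crossing. *The matching polynomial $\{G,M\}$.* For each choice $S$ of parallel or crossed replacement at every matching edge, one obtains a collection of closed loops, and at each replaced matching edge one records a "wiggly" marker joining the two arcs of the replacement. Let $\{S\}$ be the number of ways to color the loops of $S$ with colors from $\{1,\dots,n\}$ (one color per loop) so that the two arcs joined by each marker have different colors (so $\{S\}=0$ if some marker joins a loop to itself); crossings impose no condition on colors. Then $\{G,M\}=\sum_S\{S\}$, with no signs. *)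

theory Defs
  imports "HOL-Analysis.Analysis" "Graph_Theory.Digraph"
begin

section \<open>Trivalent graphs and perfect matchings\<close>

text \<open>
  A finite undirected multigraph (loops and multiple edges allowed) is given by a finite digraph
  with exactly one arc for each edge.  The direction of an arc carries no meaning: it only tells
  the two ends of the edge apart and says how the edge is parametrised in a drawing.
\<close>

datatype side = Tail | Head

type_synonym 'e edge_end = "'e \<times> side"

fun end_node :: "('v, 'e) pre_digraph \<Rightarrow> 'e edge_end \<Rightarrow> 'v" where
  "end_node G (e, Tail) = tail G e"
| "end_node G (e, Head) = head G e"

definition edge_ends :: "('v, 'e) pre_digraph \<Rightarrow> 'v \<Rightarrow> 'e edge_end set" where
  "edge_ends G v = {h. fst h \<in> arcs G \<and> end_node G h = v}"

definition trivalent :: "('v, 'e) pre_digraph \<Rightarrow> bool" where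
  "trivalent G \<longleftrightarrow> (\<forall>v\<in>verts G. card (edge_ends G v) = 3)"

definition perfect_matching :: "('v, 'e) pre_digraph \<Rightarrow> 'e set \<Rightarrow> bool" where
  "perfect_matching G M \<longleftrightarrow>
     M \<subseteq> arcs G \<and>
     (\<forall>m\<in>M. tail G m \<noteq> head G m) \<and>
     (\<forall>m\<in>M. \<forall>m'\<in>M. m \<noteq> m' \<longrightarrow> {tail G m, head G m} \<inter> {tail G m', head G m'} = {}) \<and>
     (\<forall>v\<in>verts G. \<exists>m\<in>M. v \<in> {tail G m, head G m})"

definition free_ends :: "('v, 'e) pre_digraph \<Rightarrow> 'e set \<Rightarrow> 'v \<Rightarrow> 'e edge_end set" where
  "free_ends G M v = {h \<in> edge_ends G v. fst h \<notin> M}"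


section \<open>Immersions in the plane\<close>

text \<open>
  \<open>\<gamma> e\<close> is the curve, over the parameter interval \<open>[0,1]\<close>, along which the edge \<open>e\<close> is drawn; a
  pair \<open>(e, t)\<close> with \<open>0 < t < 1\<close> is a point in the interior of \<open>e\<close>.  A crossing is an unordered
  pair of such points (possibly on the same edge) that have the same image.
\<close>

abbreviation velocity :: "('e \<Rightarrow> real \<Rightarrow> complex) \<Rightarrow> 'e \<times> real \<Rightarrow> complex" where
  "velocity \<gamma> x \<equiv> vector_derivative (\<gamma> (fst x)) (at (snd x))"

fun outward_direction :: "('e \<Rightarrow> real \<Rightarrow> complex) \<Rightarrow> 'e edge_end \<Rightarrow> complex" where
  "outward_direction \<gamma> (e, Tail) = velocity \<gamma> (e, 0)"
| "outward_direction \<gamma> (e, Head) = - velocity \<gamma> (e, 1)"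

definition crossings ::
  "('v, 'e) pre_digraph \<Rightarrow> ('e \<Rightarrow> real \<Rightarrow> complex) \<Rightarrow> ('e \<times> real) set set" where
  "crossings G \<gamma> = {{x, y} | x y.
     x \<in> arcs G \<times> {0<..<1} \<and> y \<in> arcs G \<times> {0<..<1} \<and> x \<noteq> y \<and>
     \<gamma> (fst x) (snd x) = \<gamma> (fst y) (snd y)}"

text \<open>
  Disjointness of the crossings says that there are no triple points.  The condition on \<open>sgn\<close> says
  that distinct edge-ends leave a node in distinct directions; this is what gives the edge-ends at
  a node a cyclic order.
\<close>

definition plane_immersion ::
  "('v, 'e) pre_digraph \<Rightarrow> ('v \<Rightarrow> complex) \<Rightarrow> ('e \<Rightarrow> real \<Rightarrow> complex) \<Rightarrow> bool" where
  "plane_immersion G p \<gamma> \<longleftrightarrow>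
     inj_on p (verts G) \<and>
     (\<forall>e\<in>arcs G. \<gamma> e C1_differentiable_on {0..1} \<and>
        (\<forall>t\<in>{0..1}. velocity \<gamma> (e, t) \<noteq> 0) \<and>
        \<gamma> e 0 = p (tail G e) \<and> \<gamma> e 1 = p (head G e) \<and>
        (\<forall>t\<in>{0<..<1}. \<forall>v\<in>verts G. \<gamma> e t \<noteq> p v)) \<and>
     (\<forall>v\<in>verts G. \<forall>h\<in>edge_ends G v. \<forall>k\<in>edge_ends G v. h \<noteq> k \<longrightarrow>
        sgn (outward_direction \<gamma> h) \<noteq> sgn (outward_direction \<gamma> k)) \<and>
     finite (crossings G \<gamma>) \<and>
     (\<forall>X\<in>crossings G \<gamma>. \<forall>Y\<in>crossings G \<gamma>. X \<noteq> Y \<longrightarrow> X \<inter> Y = {}) \<and>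
     (\<forall>x y. {x, y} \<in> crossings G \<gamma> \<longrightarrow>
        \<not> collinear {0, velocity \<gamma> x, velocity \<gamma> y})"


section \<open>Replacements at the matching edges, and the resulting loops\<close>

text \<open>
  A replacement at a matching edge \<open>m\<close> is recorded as the set of its two arcs, where the arc
  \<open>(x, y)\<close> joins the non-matching edge-end \<open>x\<close> at the tail of \<open>m\<close> to the non-matching edge-end
  \<open>y\<close> at the head of \<open>m\<close>.  There are two replacements; a drawing in the plane is needed only to
  say which of them is the parallel one.
\<close>

type_synonym 'e replacement = "('e edge_end \<times> 'e edge_end) set"

definition replacements :: "('v, 'e) pre_digraph \<Rightarrow> 'e set \<Rightarrow> 'e \<Rightarrow> 'e replacement set" where
  "replacements G M m = {{(a, c), (b, d)} | a b c d.
     a \<noteq> b \<and> c \<noteq> d \<and>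
     free_ends G M (tail G m) = {a, b} \<and> free_ends G M (head G m) = {c, d}}"

text \<open>
  \<open>Along m (x, y)\<close> is the arc \<open>(x, y)\<close> of the replacement at \<open>m\<close>; it runs along \<open>m\<close>.
\<close>

datatype 'e strand = Edge 'e | Along 'e "'e edge_end \<times> 'e edge_end"

fun support :: "'e strand \<Rightarrow> 'e" where
  "support (Edge e) = e"
| "support (Along m q) = m"

definition strands ::
  "('v, 'e) pre_digraph \<Rightarrow> 'e set \<Rightarrow> ('e \<Rightarrow> 'e replacement) \<Rightarrow> 'e strand set" where
  "strands G M R = Edge ` (arcs G - M) \<union> {Along m q | m q. m \<in> M \<and> q \<in> R m}"

fun attached :: "'e strand \<Rightarrow> 'e strand \<Rightarrow> bool" where
  "attached (Along m (x, y)) (Edge e) \<longleftrightarrow> e = fst x \<or> e = fst y"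
| "attached _ _ \<longleftrightarrow> False"

text \<open>
  Every end of a strand is glued to the end of exactly one other strand, so the connected
  components of the strands are closed curves.
\<close>

definition loops ::
  "('v, 'e) pre_digraph \<Rightarrow> 'e set \<Rightarrow> ('e \<Rightarrow> 'e replacement) \<Rightarrow> 'e strand set set" where
  "loops G M R = strands G M R //
     {(s, t). s \<in> strands G M R \<and> t \<in> strands G M R \<and> (attached s t \<or> attached t s)}\<^sup>*"


section \<open>The matching polynomial\<close>

definition loop_colorings ::
  "('v, 'e) pre_digraph \<Rightarrow> 'e set \<Rightarrow> ('e \<Rightarrow> 'e replacement) \<Rightarrow> nat \<Rightarrow> ('e strand set \<Rightarrow> nat) set"
  where
  "loop_colorings G M R n = {\<kappa> \<in> loops G M R \<rightarrow>\<^sub>E {1..n}.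
     \<forall>m\<in>M. \<forall>q\<in>R m. \<forall>r\<in>R m. q \<noteq> r \<longrightarrow>
       (\<forall>A\<in>loops G M R. \<forall>B\<in>loops G M R. Along m q \<in> A \<longrightarrow> Along m r \<in> B \<longrightarrow> \<kappa> A \<noteq> \<kappa> B)}"

definition matching_polynomial :: "('v, 'e) pre_digraph \<Rightarrow> 'e set \<Rightarrow> nat \<Rightarrow> nat" where
  "matching_polynomial G M n =
     (\<Sum>R \<in> (\<Pi>\<^sub>E m\<in>M. replacements G M m). card (loop_colorings G M R n))"


section \<open>The generalized Penrose evaluation\<close>

text \<open>
  \<open>turn \<gamma> h k\<close> is the counterclockwise angle, in \<open>[0, 2 * pi)\<close>, from the edge-end \<open>h\<close> to \<open>k\<close>.
  Draw the matching edge \<open>m\<close> vertically, with its tail at the bottom and its head at the top.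
  Going round the bottom node counterclockwise from \<open>m\<close> one meets first the left edge-end and then
  the right one; round the top node, first the right one and then the left one.  (Interchanging
  tail and head interchanges left and right at both nodes, so it affects neither replacement.)
\<close>

definition turn :: "('e \<Rightarrow> real \<Rightarrow> complex) \<Rightarrow> 'e edge_end \<Rightarrow> 'e edge_end \<Rightarrow> real" where
  "turn \<gamma> h k = Arg2pi (outward_direction \<gamma> k / outward_direction \<gamma> h)"

definition tail_left ::
  "('v, 'e) pre_digraph \<Rightarrow> 'e set \<Rightarrow> ('e \<Rightarrow> real \<Rightarrow> complex) \<Rightarrow> 'e \<Rightarrow> 'e edge_end \<Rightarrow> bool" where
  "tail_left G M \<gamma> m x \<longleftrightarrow>
     (\<forall>z \<in> free_ends G M (tail G m) - {x}. turn \<gamma> (m, Tail) x < turn \<gamma> (m, Tail) z)"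

definition head_left ::
  "('v, 'e) pre_digraph \<Rightarrow> 'e set \<Rightarrow> ('e \<Rightarrow> real \<Rightarrow> complex) \<Rightarrow> 'e \<Rightarrow> 'e edge_end \<Rightarrow> bool" where
  "head_left G M \<gamma> m y \<longleftrightarrow>
     (\<forall>z \<in> free_ends G M (head G m) - {y}. turn \<gamma> (m, Head) z < turn \<gamma> (m, Head) y)"

definition parallel_replacement ::
  "('v, 'e) pre_digraph \<Rightarrow> 'e set \<Rightarrow> ('e \<Rightarrow> real \<Rightarrow> complex) \<Rightarrow> 'e \<Rightarrow> 'e replacement" where
  "parallel_replacement G M \<gamma> m =
     {(x, y). x \<in> free_ends G M (tail G m) \<and> y \<in> free_ends G M (head G m) \<and>
        (tail_left G M \<gamma> m x \<longleftrightarrow> head_left G M \<gamma> m y)}"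

definition crossed_replacement ::
  "('v, 'e) pre_digraph \<Rightarrow> 'e set \<Rightarrow> ('e \<Rightarrow> real \<Rightarrow> complex) \<Rightarrow> 'e \<Rightarrow> 'e replacement" where
  "crossed_replacement G M \<gamma> m =
     {(x, y). x \<in> free_ends G M (tail G m) \<and> y \<in> free_ends G M (head G m) \<and>
        (tail_left G M \<gamma> m x \<longleftrightarrow> \<not> head_left G M \<gamma> m y)}"

definition resolve ::
  "('v, 'e) pre_digraph \<Rightarrow> 'e set \<Rightarrow> ('e \<Rightarrow> real \<Rightarrow> complex) \<Rightarrow> 'e set \<Rightarrow> 'e \<Rightarrow> 'e replacement"
  where
  "resolve G M \<gamma> S = (\<lambda>m\<in>M.
     if m \<in> S then crossed_replacement G M \<gamma> m else parallel_replacement G M \<gamma> m)"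

text \<open>
  After the replacements an immersion crossing becomes one, two or four boxed crossings, according
  to how many of its two branches lie on matching edges: each strand along one branch crosses each
  strand along the other.  The crossing that a crossed replacement creates is not boxed and does
  not occur here.
\<close>

definition boxed_crossings ::
  "('v, 'e) pre_digraph \<Rightarrow> 'e set \<Rightarrow> ('e \<Rightarrow> real \<Rightarrow> complex) \<Rightarrow> ('e \<Rightarrow> 'e replacement) \<Rightarrow>
     ('e strand \<times> real) set set" where
  "boxed_crossings G M \<gamma> R = {{(a, s), (b, t)} | a s b t.
     a \<in> strands G M R \<and> b \<in> strands G M R \<and> {(support a, s), (support b, t)} \<in> crossings G \<gamma>}"

text \<open>\<open>D\<close> is the set of boxed crossings that are made dotted; the others become round.\<close>

definition complexes ::
  "('v, 'e) pre_digraph \<Rightarrow> 'e set \<Rightarrow> ('e \<Rightarrow> 'e replacement) \<Rightarrow>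
     ('e strand \<times> real) set set \<Rightarrow> 'e strand set set set" where
  "complexes G M R D = loops G M R //
     {(A, B). A \<in> loops G M R \<and> B \<in> loops G M R \<and>
        (\<exists>a\<in>A. \<exists>b\<in>B. \<exists>s t. {(a, s), (b, t)} \<in> D)}\<^sup>*"

definition PK ::
  "('v, 'e) pre_digraph \<Rightarrow> 'e set \<Rightarrow> ('e \<Rightarrow> real \<Rightarrow> complex) \<Rightarrow> nat \<Rightarrow> int" where
  "PK G M \<gamma> n =
     (\<Sum>S\<in>Pow M. (-1) ^ card S *
        (\<Sum>D\<in>Pow (boxed_crossings G M \<gamma> (resolve G M \<gamma> S)).
           2 ^ card D * (-1) ^ card (boxed_crossings G M \<gamma> (resolve G M \<gamma> S) - D) *
           int n ^ card (complexes G M (resolve G M \<gamma> S) D)))"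

end

(*
  Expand every boxed crossing and every color: PK becomes a signed count of the colorings of the
  non-matching edges, each counted with the replacements it is compatible with. A boxed crossing
  contributes 2 [equal colors] - 1, that is +1 or -1 according to whether its two strands have the
  same color. If some matching edge admits both replacements, the two terms cancel, because the
  colors of the strands along that edge do not depend on the replacement. The remaining colorings
  are those counted by the matching polynomial, and it must be shown that each of them has sign +1,
  i.e. that the crossed replacements and the bicolored boxed crossings together are even in number.

  For two colors i < j the edges carrying them form two systems C and D of disjoint cycles, which may
  share matching edges, and the claim is that C and D cross evenly often, a shared edge counting as
  a crossing when its replacement is crossed. For an edge e with end points a, b there is an
  orientation-free continuous square root u_e of (a - z)(b - z) off e, which changes sign when z
  crosses e. Since each node of C is an end of exactly two edges of C, the product of the u_e
  divided by the product of (v - z) over the nodes v of C takes only the values 1 and -1: it is the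
  winding number of C modulo 2. Its sign changes along the edges of D count the crossings, and
  their product is regrouped by nodes of D. A node off C contributes 1; at a node shared with C the
  contribution is computed from the asymptotics of the u_e, and the two ends of a shared edge
  together contribute -1 exactly when the cyclic orders of the colors at them agree.
*)

theory Submission
  imports Defs "HOL-Complex_Analysis.Complex_Analysis"
begin

section \<open>A square root that changes sign across a curve\<close>

text \<open>The obstacle is that two color classes are not in general position: they coincide along
  every shared matching edge, so their crossings cannot simply be counted as intersections of two
  transverse families of closed curves. This is why the sign of C is built edge by edge: when an
  edge f of D is followed and f also belongs to C, the factor of f itself is left out, and the
  damage is confined to the two ends of f. There the normalising square roots are fixed only up to
  sign, so the value at a single node depends on choices. Each end h contributes - \<i> times a
  cyclic-order sign times \<open>end_limit h / end_coeff h\<close>, which carries the arbitrary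
  sign; these quotients at the two ends of an edge multiply to 1, and (- \<i>)^2 = -1 is what turns
  agreement of the cyclic orders into a crossing. Agreement means a crossed replacement because the
  two ends look along the edge in opposite directions, so that uncrossed arcs are met in opposite
  orders. Crossings of a shared edge with itself are a second degenerate case: each occurs in both
  orders and cancels modulo 2.\<close>

text \<open>
  \<open>branch g\<close> is a square root of \<open>\<lambda>z. (pathstart g - z) * (pathfinish g - z)\<close> on the complement of the
  curve \<open>g\<close>.  Unlike the winding number it does not depend on the orientation of \<open>g\<close>, so no cycle
  below ever has to be oriented.
\<close>

definition branch :: "(real \<Rightarrow> complex) \<Rightarrow> complex \<Rightarrow> complex" where
  "branch g z = (pathstart g - z) * exp (pi * \<i> * winding_number g z)"

lemma branch_square:
  assumes "path g" "z \<notin> path_image g"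
  shows "(branch g z)\<^sup>2 = (pathstart g - z) * (pathfinish g - z)"
proof -
  have "(branch g z)\<^sup>2 = (pathstart g - z)\<^sup>2 * exp (2 * pi * \<i> * winding_number g z)"
    by (simp add: branch_def power_mult_distrib exp_double [symmetric] mult.assoc mult.left_commute)
  then show ?thesis
    using winding_number_exp_2pi [OF assms] by (simp add: power2_eq_square mult.assoc mult.left_commute)
qed

text \<open>Reversing \<open>g\<close> exchanges its two ends and negates the winding number. Two
  half-angle factors carry one end to the other, so the exchange and the negation
  compensate.\<close>

lemma branch_reversepath:
  assumes "path g" "z \<notin> path_image g"
  shows "branch (reversepath g) z = branch g z"
proof -
  have "pathfinish g - z = exp (pi * \<i> * winding_number g z) * exp (pi * \<i> * winding_number g z) * (pathstart g - z)"
    using winding_number_exp_2pi [OF assms] by (simp add: mult.assoc mult.left_commute flip: exp_add)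
  then show ?thesis
    using assms by (simp add: branch_def winding_number_reversepath exp_minus field_simps)
qed

lemma isCont_branch:
  assumes "path g" "z \<notin> path_image g"
  shows "isCont (branch g) z"
  unfolding branch_def by (intro continuous_intros continuous_at_winding_number assms)

text \<open>A continuous logarithm of \<open>g - z\<close> makes the winding number explicit, namely
  \<open>(l 1 - l 0) / (2 * pi * \<i>)\<close>. All later asymptotics of \<open>branch\<close> are
  read off from such a logarithm.\<close>

lemma branch_eq_exp:
  assumes "continuous_on {0..1} l" and l: "\<And>s. s \<in> {0..1} \<Longrightarrow> g s - z = exp (l s)"
  shows "z \<notin> path_image g" and "branch g z = (g 0 - z) * exp ((l 1 - l 0) / 2)"
proof -
  show "z \<notin> path_image g"
    using l by (auto simp: path_image_def) (metis eq_iff_diff_eq_0 exp_not_eq_zero l atLeastAtMost_iff)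
  have "winding_number g z = winding_number (exp \<circ> l) 0"
    unfolding winding_number_offset [of g z] by (rule winding_number_cong) (simp add: l)
  also have "\<dots> = (l 1 - l 0) / (2 * pi * \<i>)"
    using winding_number_compose_exp [of l] assms(1) by (simp add: path_def pathstart_def pathfinish_def)
  finally show "branch g z = (g 0 - z) * exp ((l 1 - l 0) / 2)"
    by (simp add: branch_def pathstart_def)
qed

section \<open>Asymptotics of \<open>branch\<close> near an end and near an interior point of the
  curve\<close>

text \<open>
  Here \<open>g s - z t = exp (L s) * w\<close> with \<open>w = of_real (s - s0) - (z t - v) * exp (- L s)\<close>.  Rotating \<open>w\<close> by a
  suitable \<open>c\<close> keeps it away from the cut of the principal logarithm, which then gives a continuous
  logarithm of \<open>g s - z t\<close> in \<open>s\<close>, uniformly for small \<open>t\<close>.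
\<close>

lemma log_of_perturbation:
  fixes L :: "real \<Rightarrow> complex" and z :: "real \<Rightarrow> complex"
  assumes L: "continuous_on {0..1} L" and g: "\<And>s. s \<in> {0..1} \<Longrightarrow> g s - v = of_real (s - s0) * exp (L s)"
    and z: "((\<lambda>t. (z t - v) / of_real t) \<longlongrightarrow> y) (at_right 0)"
    and s0: "s0 \<in> {0..1}" and U: "open U" "- c * y / exp (L s0) \<in> U"
    and far: "\<And>s. s \<in> {0..1} \<Longrightarrow> s \<noteq> s0 \<Longrightarrow> c * of_real (s - s0) \<notin> \<real>\<^sub>\<le>\<^sub>0"
    and near: "\<And>s t x. s \<in> {0..1} \<Longrightarrow> t > 0 \<Longrightarrow> x \<in> U \<Longrightarrow> c * of_real (s - s0) + of_real t * x \<notin> \<real>\<^sub>\<le>\<^sub>0"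
  shows "\<forall>\<^sub>F t in at_right 0. \<forall>s\<in>{0..1}. c * (of_real (s - s0) - (z t - v) * exp (- L s)) \<notin> \<real>\<^sub>\<le>\<^sub>0"
proof -
  define Y where "Y t = (z t - v) / of_real t" for t
  have Y: "(Y \<longlongrightarrow> y) (at_right 0)"
    using z by (simp add: Y_def [abs_def])
  have pos: "\<forall>\<^sub>F t in at_right 0. (t::real) > 0"
    by (simp add: eventually_at_right_less)
  have zY: "z t - v = of_real t * Y t" if "t > 0" for t
    using that by (simp add: Y_def)
  \<comment> \<open>This filter keeps the point \<open>s0\<close> itself, unlike
    \<open>at s0 within {0..1}\<close>: the estimate near \<open>s0\<close> has to hold at
    \<open>s0\<close> too.\<close>
  let ?F = "inf (nhds s0) (principal {0..1})"
  have "(L \<longlongrightarrow> L s0) ?F"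
    using L s0 by (metis continuous_on_def tendsto_at_iff_tendsto_nhds_within)
  then have "((\<lambda>(t, s). - c * Y t * exp (- L s)) \<longlongrightarrow> - c * y * exp (- L s0)) (at_right 0 \<times>\<^sub>F ?F)"
    unfolding case_prod_beta
    by (intro tendsto_intros filterlim_compose [OF _ filterlim_fst] filterlim_compose [OF _ filterlim_snd] Y)
      auto
  then have "\<forall>\<^sub>F (t, s) in at_right 0 \<times>\<^sub>F ?F. - c * Y t * exp (- L s) \<in> U"
    using U by (auto simp: exp_minus field_simps case_prod_unfold dest!: topological_tendstoD)
  then obtain P Q where P: "eventually P (at_right 0)" and Q: "eventually Q ?F"
    and PQ: "\<And>t s. P t \<Longrightarrow> Q s \<Longrightarrow> - c * Y t * exp (- L s) \<in> U"
    by (auto simp: eventually_prod_filter)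
  obtain e where e: "e > 0" and Qe: "\<And>s. s \<in> {0..1} \<Longrightarrow> \<bar>s - s0\<bar> < e \<Longrightarrow> Q s"
    using Q by (auto simp: eventually_inf_principal eventually_nhds_metric dist_real_def)
  \<comment> \<open>Away from \<open>s0\<close> the unperturbed points form a compact set disjoint
    from the closed cut. Its distance to the cut absorbs the perturbation, which tends to 0
    uniformly in \<open>s\<close> because \<open>exp (- L s)\<close> is bounded.\<close>
  define K where "K = {s \<in> {0..1}. \<bar>s - s0\<bar> \<ge> e}"
  have "compact K"
  proof -
    have "K = {0..1} \<inter> {s. e \<le> \<bar>s - s0\<bar>}"
      by (auto simp: K_def)
    then show ?thesis
      by (simp add: compact_Int_closed closed_Collect_le continuous_intros)
  qed
  then have cpt: "compact ((\<lambda>s. c * of_real (s - s0)) ` K)"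
    by (intro compact_continuous_image continuous_intros)
  have "(\<lambda>s. c * of_real (s - s0)) ` K \<inter> \<real>\<^sub>\<le>\<^sub>0 = {}"
    using far e by (force simp: K_def)
  then obtain \<delta> where \<delta>: "\<delta> > 0" "\<And>s w. s \<in> K \<Longrightarrow> w \<in> \<real>\<^sub>\<le>\<^sub>0 \<Longrightarrow> \<delta> \<le> dist (c * of_real (s - s0)) w"
    using separate_compact_closed [OF cpt closed_nonpos_Reals_complex] by (metis image_eqI)
  have "continuous_on {0..1} (\<lambda>s. exp (- L s))"
    by (intro continuous_intros L)
  then have "bounded ((\<lambda>s. exp (- L s)) ` {0..1})"
    by (simp add: compact_continuous_image compact_imp_bounded)
  then obtain B where B: "\<And>s. s \<in> {0..1} \<Longrightarrow> norm (exp (- L s)) \<le> B" and "B > 0"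
    unfolding bounded_pos by blast
  have "((\<lambda>t. c * (of_real t * Y t)) \<longlongrightarrow> c * (of_real 0 * y)) (at_right 0)"
    by (intro tendsto_intros Y)
  then have "\<forall>\<^sub>F t in at_right 0. norm (c * (of_real t * Y t)) < \<delta> / B"
    using \<delta> \<open>B > 0\<close> by (auto simp: tendsto_iff dest: spec [of _ "\<delta> / B"])
  then show ?thesis
    using pos P
  proof eventually_elim
    case (elim t)
    show ?case
    proof
      fix s :: real
      assume s: "s \<in> {0..1}"
      have eq: "c * (of_real (s - s0) - (z t - v) * exp (- L s)) =
        c * of_real (s - s0) - c * (of_real t * Y t) * exp (- L s)"
        using elim by (simp add: zY algebra_simps)
      show "c * (of_real (s - s0) - (z t - v) * exp (- L s)) \<notin> \<real>\<^sub>\<le>\<^sub>0"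
      proof (cases "\<bar>s - s0\<bar> < e")
        case True
        then have "- c * Y t * exp (- L s) \<in> U"
          using PQ Qe s elim by blast
        from near [OF s _ this, of t] show ?thesis
          unfolding eq using elim by (simp add: algebra_simps)
      next
        case False
        then have "s \<in> K"
          using s by (simp add: K_def)
        moreover have "norm (c * (of_real t * Y t) * exp (- L s)) < \<delta>"
        proof -
          have "norm (c * (of_real t * Y t) * exp (- L s)) \<le> norm (c * (of_real t * Y t)) * B"
            unfolding norm_mult [of "c * (of_real t * Y t)"] using B [OF s] by (intro mult_left_mono) auto
          also have "\<dots> < \<delta>"
            using elim \<open>B > 0\<close> by (simp add: field_simps)
          finally show ?thesis .
        qed
        ultimately show ?thesis
          using \<delta>(2) unfolding eq by (force simp: dist_norm)
      qed
    qed
  qed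
qed

text \<open>The continuous logarithm is \<open>L s + Ln (?w s) - Ln c\<close>; the term
  \<open>Ln c\<close> undoes the rotation and drops out of the difference of the values at 1 and 0.
  The parameters \<open>c\<close> and \<open>U\<close> stay open because ends and interior points of
  the curve call for different rotations.\<close>

lemma branch_of_perturbation:
  fixes L :: "real \<Rightarrow> complex" and z :: "real \<Rightarrow> complex"
  assumes L: "continuous_on {0..1} L" and g: "\<And>s. s \<in> {0..1} \<Longrightarrow> g s - v = of_real (s - s0) * exp (L s)"
    and "((\<lambda>t. (z t - v) / of_real t) \<longlongrightarrow> y) (at_right 0)"
    and "s0 \<in> {0..1}" and "open U" "- c * y / exp (L s0) \<in> U" and c: "c \<noteq> 0"
    and "\<And>s. s \<in> {0..1} \<Longrightarrow> s \<noteq> s0 \<Longrightarrow> c * of_real (s - s0) \<notin> \<real>\<^sub>\<le>\<^sub>0"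
    and "\<And>s t x. s \<in> {0..1} \<Longrightarrow> t > 0 \<Longrightarrow> x \<in> U \<Longrightarrow> c * of_real (s - s0) + of_real t * x \<notin> \<real>\<^sub>\<le>\<^sub>0"
  shows "\<forall>\<^sub>F t in at_right 0. z t \<notin> path_image g \<and> branch g (z t) = (g 0 - z t) *
    exp ((L 1 + Ln (c * (of_real (1 - s0) - (z t - v) * exp (- L 1))) -
         (L 0 + Ln (c * (of_real (0 - s0) - (z t - v) * exp (- L 0))))) / 2)"
  using log_of_perturbation [OF assms(1-6,8,9), simplified]
proof eventually_elim
  case (elim t)
  let ?w = "\<lambda>s. c * (of_real (s - s0) - (z t - v) * exp (- L s))"
  let ?l = "\<lambda>s. L s + Ln (?w s) - Ln c"
  have 1: "continuous_on {0..1} ?l"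
    using elim by (intro continuous_intros L) auto
  have 2: "g s - z t = exp (?l s)" if s: "s \<in> {0..1}" for s
  proof -
    have "?w s \<notin> \<real>\<^sub>\<le>\<^sub>0"
      using elim s by simp
    then have "?w s \<noteq> 0"
      by force
    then have "exp (?l s) = exp (L s) * (of_real (s - s0) - (z t - v) * exp (- L s))"
      using c by (simp add: exp_add exp_diff)
    also have "\<dots> = of_real (s - s0) * exp (L s) - (z t - v)"
      by (simp add: exp_minus field_simps)
    also have "\<dots> = g s - z t"
      unfolding g [OF s, symmetric] by simp
    finally show ?thesis ..
  qed
  show ?case
    using branch_eq_exp [OF 1 2] by (simp add: algebra_simps)
qed

lemma of_real_plus_notin_nonpos_Reals:
  assumes "s \<ge> 0" "t > 0" "x \<notin> \<real>\<^sub>\<le>\<^sub>0"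
  shows "complex_of_real s + of_real t * x \<notin> \<real>\<^sub>\<le>\<^sub>0"
proof
  assume *: "complex_of_real s + of_real t * x \<in> \<real>\<^sub>\<le>\<^sub>0"
  then have "Im x = 0"
    using assms by (simp add: complex_nonpos_Reals_iff)
  then have "Re x > 0"
    using assms by (simp add: complex_nonpos_Reals_iff)
  then have "s + t * Re x > 0"
    using assms by (simp add: add_nonneg_pos)
  with * show False
    by (simp add: complex_nonpos_Reals_iff)
qed

lemma exp_half_Ln: "x \<noteq> 0 \<Longrightarrow> exp (Ln x / 2) = csqrt x"
  by (simp add: csqrt_exp_Ln)

lemma csqrt_of_real_mult:
  assumes "t > 0"
  shows "csqrt (of_real t * x) = of_real (sqrt t) * csqrt x"
proof (cases "x = 0")
  case False
  show ?thesis
  proof -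
    have "exp (complex_of_real (ln t) / 2) = of_real (exp (ln t / 2))"
      by (simp flip: exp_of_real)
    also have "exp (ln t / 2) = sqrt t"
      using assms by (simp flip: ln_sqrt)
    finally show ?thesis
      using assms False by (simp add: csqrt_exp_Ln Ln_times_of_real Ln_of_real add_divide_distrib exp_add)
  qed
qed simp

text \<open>The square of \<open>branch g (z t)\<close> is \<open>(g 0 - z t) * (g 1 - z t)\<close>,
  whose first factor is about \<open>- t * y\<close> while the second tends to
  \<open>exp (L 1)\<close>: this explains the order \<open>sqrt t\<close> and the limit up to sign.
  The hypothesis on \<open>y\<close> says that \<open>z\<close> does not leave \<open>v\<close> in
  the direction of the curve; then the principal root is continuous at
  \<open>- y / exp (L 0)\<close> and the sign can be followed.\<close>

proposition branch_near_end:
  fixes L :: "real \<Rightarrow> complex" and z :: "real \<Rightarrow> complex"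
  assumes L: "continuous_on {0..1} L" and g: "\<And>s. s \<in> {0..1} \<Longrightarrow> g s - v = of_real s * exp (L s)"
    and z: "((\<lambda>t. (z t - v) / of_real t) \<longlongrightarrow> y) (at_right 0)"
    and y: "- y / exp (L 0) \<notin> \<real>\<^sub>\<le>\<^sub>0"
  shows "\<forall>\<^sub>F t in at_right 0. z t \<notin> path_image g"
    and "((\<lambda>t. branch g (z t) / of_real (sqrt t)) \<longlongrightarrow> exp ((L 0 + L 1) / 2) * csqrt (- y / exp (L 0))) (at_right 0)"
proof -
  have g': "\<And>s. s \<in> {0..1} \<Longrightarrow> g s - v = of_real (s - 0) * exp (L s)"
    using g by simp
  \<comment> \<open>At an end, \<open>s - s0 = s\<close> is nonnegative. Hence \<open>c = 1\<close>
    suffices and \<open>U\<close> can be the whole slit plane, which is stable under positive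
    scaling and under adding nonnegative reals.\<close>
  have ev: "\<forall>\<^sub>F t in at_right 0. z t \<notin> path_image g \<and> branch g (z t) = (g 0 - z t) *
    exp ((L 1 + Ln (1 * (of_real (1 - 0) - (z t - v) * exp (- L 1))) -
         (L 0 + Ln (1 * (of_real (0 - 0) - (z t - v) * exp (- L 0))))) / 2)"
    by (rule branch_of_perturbation [OF L g' z, of "- \<real>\<^sub>\<le>\<^sub>0"])
      (use y in \<open>auto simp: open_Compl closed_nonpos_Reals_complex of_real_plus_notin_nonpos_Reals\<close>)
  then show "\<forall>\<^sub>F t in at_right 0. z t \<notin> path_image g"
    by (rule eventually_mono) simp
  define Y where "Y t = (z t - v) / of_real t" for t
  have Y: "(Y \<longlongrightarrow> y) (at_right 0)"
    using z by (simp add: Y_def [abs_def])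
  have pos: "\<forall>\<^sub>F t in at_right 0. (t::real) > 0"
    by (simp add: eventually_at_right_less)
  have "y \<noteq> 0"
    using y by auto
  have Y0: "\<forall>\<^sub>F t in at_right 0. Y t \<noteq> 0"
    using tendsto_imp_eventually_ne [OF Y \<open>y \<noteq> 0\<close>] .
  let ?R = "\<lambda>t. - Y t * exp ((L 1 - L 0) / 2) * csqrt (1 - of_real t * Y t * exp (- L 1)) / csqrt (- Y t / exp (L 0))"
  have lim1: "((\<lambda>t. 1 - of_real t * Y t * exp (- L 1)) \<longlongrightarrow> 1 - of_real 0 * y * exp (- L 1)) (at_right 0)"
    by (intro tendsto_intros Y)
  have ne1: "\<forall>\<^sub>F t in at_right 0. 1 - of_real t * Y t * exp (- L 1) \<noteq> 0"
    by (rule tendsto_imp_eventually_ne [OF lim1]) simp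
  have R: "\<forall>\<^sub>F t in at_right 0. ?R t = branch g (z t) / of_real (sqrt t)"
    using ev pos Y0 ne1
  proof eventually_elim
    case (elim t)
    then have zv: "z t - v = of_real t * Y t"
      by (simp add: Y_def)
    have g0: "g 0 = v"
      using g [of 0] by simp
    have st: "complex_of_real t = of_real (sqrt t) * of_real (sqrt t)"
      unfolding of_real_mult [symmetric] using elim by simp
    have X1: "1 * (of_real (1 - 0) - (z t - v) * exp (- L 1)) = 1 - of_real t * Y t * exp (- L 1)"
      by (simp add: zv)
    have X0: "1 * (of_real (0 - 0) - (z t - v) * exp (- L 0)) = of_real t * (- Y t / exp (L 0))"
      by (simp add: zv exp_minus divide_inverse)
    have eq: "exp ((a + b - (c + d)) / 2) = exp ((a - c) / 2) * exp (b / 2) / exp (d / 2)" for a b c d :: complex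
      by (simp add: exp_add exp_diff add_divide_distrib diff_divide_distrib)
    have "branch g (z t) = - (z t - v) * exp ((L 1 - L 0) / 2) *
       exp (Ln (1 - of_real t * Y t * exp (- L 1)) / 2) / exp (Ln (of_real t * (- Y t / exp (L 0))) / 2)"
      using elim(1) unfolding X1 X0 eq g0 by simp
    also have "\<dots> = - (of_real t * Y t) * exp ((L 1 - L 0) / 2) *
       exp (Ln (1 - of_real t * Y t * exp (- L 1)) / 2) / exp (Ln (of_real t * (- Y t / exp (L 0))) / 2)"
      unfolding zv ..
    also have "\<dots> = - (of_real t * Y t) * exp ((L 1 - L 0) / 2) *
       csqrt (1 - of_real t * Y t * exp (- L 1)) / (of_real (sqrt t) * csqrt (- Y t / exp (L 0)))"
    proof -
      have "exp (Ln (of_real t * (- Y t / exp (L 0))) / 2) = of_real (sqrt t) * csqrt (- Y t / exp (L 0))"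
        using elim csqrt_of_real_mult [of t "- Y t / exp (L 0)"] by (subst exp_half_Ln) auto
      moreover have "exp (Ln (1 - of_real t * Y t * exp (- L 1)) / 2) = csqrt (1 - of_real t * Y t * exp (- L 1))"
        using elim by (intro exp_half_Ln) auto
      ultimately show ?thesis
        by simp
    qed
    finally have "branch g (z t) = \<dots>" .
    moreover have "?R t = - (of_real t * Y t) * exp ((L 1 - L 0) / 2) *
       csqrt (1 - of_real t * Y t * exp (- L 1)) / (of_real (sqrt t) * csqrt (- Y t / exp (L 0))) / of_real (sqrt t)"
    proof -
      have "- y * e * c / d = - (a * y) * e * c / (b * d) / b" if "a = b * b" "b \<noteq> 0" for y e c d a b :: complex
        using that by simp
      from this [OF st] show ?thesis
        using elim by simp
    qed
    ultimately show ?case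
      by simp
  qed
  have limR: "(?R \<longlongrightarrow> - y * exp ((L 1 - L 0) / 2) * csqrt (1 - of_real 0 * y * exp (- L 1)) / csqrt (- y / exp (L 0))) (at_right 0)"
  proof -
    have "isCont csqrt (1 - of_real 0 * y * exp (- L 1))" "isCont csqrt (- y / exp (L 0))"
      using y by (auto intro: continuous_at_csqrt)
    then show ?thesis
      using \<open>y \<noteq> 0\<close> by (intro tendsto_mult tendsto_divide tendsto_minus isCont_tendsto_compose [of _ csqrt] tendsto_const lim1 Y) auto
  qed
  \<comment> \<open>Writing \<open>- y\<close> as \<open>exp (L 0)\<close> times the square of
    \<open>csqrt (- y / exp (L 0))\<close> moves the root from the denominator to the numerator and
    turns \<open>(L 1 - L 0) / 2\<close> into the half-sum.\<close>
  have eq: "- y * exp ((L 1 - L 0) / 2) * csqrt (1 - of_real 0 * y * exp (- L 1)) / csqrt (- y / exp (L 0))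
     = exp ((L 0 + L 1) / 2) * csqrt (- y / exp (L 0))"
  proof -
    have "a * (e * c\<^sup>2) / c = (a * e) * c" if "c \<noteq> 0" for a e c :: complex
      using that by (simp add: power2_eq_square)
    from this [of "csqrt (- y / exp (L 0))" "exp ((L 1 - L 0) / 2)" "exp (L 0)"]
    have "exp ((L 1 - L 0) / 2) * - y / csqrt (- y / exp (L 0)) =
      exp ((L 1 - L 0) / 2 + L 0) * csqrt (- y / exp (L 0))"
      using \<open>y \<noteq> 0\<close> by (simp add: exp_add)
    moreover have "(L 1 - L 0) / 2 + L 0 = (L 0 + L 1) / 2"
      by (simp add: field_simps)
    ultimately have "exp ((L 1 - L 0) / 2) * - y / csqrt (- y / exp (L 0)) = exp ((L 0 + L 1) / 2) * csqrt (- y / exp (L 0))"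
      by simp
    then show ?thesis
      by (simp add: mult.commute)
  qed
  show "((\<lambda>t. branch g (z t) / of_real (sqrt t)) \<longlongrightarrow> exp ((L 0 + L 1) / 2) * csqrt (- y / exp (L 0))) (at_right 0)"
    using Lim_transform_eventually [OF limR R] unfolding eq .
qed

text \<open>The sign \<sigma> tells on which side of the tangent \<open>exp (L s0)\<close> the
  direction \<open>y\<close> points. The arguments of the rotated quantity at the two ends of the
  curve tend to \<open>\<sigma> * pi / 2\<close> and \<open>- \<sigma> * pi / 2\<close>; half their
  difference gives the factor \<open>\<sigma> * \<i>\<close>, and nothing else in the limit depends
  on the side. So the limits from the two sides are opposite.\<close>

proposition branch_near_crossing:
  fixes L :: "real \<Rightarrow> complex" and z :: "real \<Rightarrow> complex" and \<sigma> :: real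
  assumes L: "continuous_on {0..1} L" and g: "\<And>s. s \<in> {0..1} \<Longrightarrow> g s - v = of_real (s - s0) * exp (L s)"
    and z: "((\<lambda>t. (z t - v) / of_real t) \<longlongrightarrow> y) (at_right 0)"
    and s0: "0 < s0" "s0 < 1" and \<sigma>: "\<sigma> = 1 \<or> \<sigma> = -1" and y: "\<sigma> * Im (y / exp (L s0)) > 0"
  shows "\<forall>\<^sub>F t in at_right 0. z t \<notin> path_image g"
    and "((\<lambda>t. branch g (z t)) \<longlongrightarrow>
      \<sigma> * (\<i> * (g 0 - v) * exp ((L 1 - L 0 + of_real (ln (1 - s0) - ln s0)) / 2))) (at_right 0)"
proof -
  \<comment> \<open>The rotation places the points \<open>c * of_real (s - s0)\<close> on the
    imaginary axis, where only \<open>s = s0\<close> meets the cut. The perturbation pushes them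
    into the right half-plane, since \<open>- c * y / exp (L s0)\<close> has real part
    \<open>\<sigma> * Im (y / exp (L s0))\<close>.\<close>
  define c where "c = \<sigma> * \<i>"
  have ev: "\<forall>\<^sub>F t in at_right 0. z t \<notin> path_image g \<and> branch g (z t) = (g 0 - z t) *
    exp ((L 1 + Ln (c * (of_real (1 - s0) - (z t - v) * exp (- L 1))) -
         (L 0 + Ln (c * (of_real (0 - s0) - (z t - v) * exp (- L 0))))) / 2)"
  proof (rule branch_of_perturbation [OF L g z, of "{x. 0 < Re x}"])
    have "- c * y / exp (L s0) = - c * (y / exp (L s0))"
      by simp
    moreover have "Re (- (of_real \<sigma> * \<i>) * w) = \<sigma> * Im w" for w
      by simp
    then have "Re (- c * (y / exp (L s0))) = \<sigma> * Im (y / exp (L s0))"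
      unfolding c_def .
    ultimately show "- c * y / exp (L s0) \<in> {x. 0 < Re x}"
      using y by (simp only: mem_Collect_eq)
    show "c * of_real (s - s0) \<notin> \<real>\<^sub>\<le>\<^sub>0" if "s \<noteq> s0" for s
      using that \<sigma> by (auto simp: c_def complex_nonpos_Reals_iff)
    show "c * of_real (s - s0) + of_real t * x \<notin> \<real>\<^sub>\<le>\<^sub>0" if "t > 0" "x \<in> {x. 0 < Re x}" for s t x
    proof
      assume "c * of_real (s - s0) + of_real t * x \<in> \<real>\<^sub>\<le>\<^sub>0"
      then have "t * Re x \<le> 0"
        by (simp add: c_def complex_nonpos_Reals_iff)
      moreover have "t * Re x > 0"
        using that by (intro mult_pos_pos) auto
      ultimately show False
        by linarith
    qed
  qed (use s0 \<sigma> in \<open>auto simp: c_def open_halfspace_Re_gt\<close>)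
  then show "\<forall>\<^sub>F t in at_right 0. z t \<notin> path_image g"
    by (rule eventually_mono) simp
  have "((\<lambda>t. (z t - v) / of_real t * of_real t) \<longlongrightarrow> y * of_real 0) (at_right 0)"
    by (intro tendsto_intros z)
  moreover have "\<forall>\<^sub>F t in at_right 0. (z t - v) / of_real t * of_real t = z t - v"
    using eventually_at_right_less [of "0::real"] by (rule eventually_mono) simp
  ultimately have zv: "((\<lambda>t. z t - v) \<longlongrightarrow> 0) (at_right 0)"
    using Lim_transform_eventually by fastforce
  show "((\<lambda>t. branch g (z t)) \<longlongrightarrow>
      \<sigma> * (\<i> * (g 0 - v) * exp ((L 1 - L 0 + of_real (ln (1 - s0) - ln s0)) / 2))) (at_right 0)"
  proof -
    have lim: "((\<lambda>t. Ln (c * (of_real x - (z t - v) * exp w))) \<longlongrightarrow> Ln (c * of_real x)) (at_right 0)" if "x \<noteq> 0" for x w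
    proof -
      have "c * of_real x \<notin> \<real>\<^sub>\<le>\<^sub>0"
        using that \<sigma> by (auto simp: c_def complex_nonpos_Reals_iff)
      moreover have "((\<lambda>t. c * (of_real x - (z t - v) * exp w)) \<longlongrightarrow> c * (of_real x - 0 * exp w)) (at_right 0)"
        by (intro tendsto_intros zv)
      ultimately show ?thesis
        using tendsto_Ln by fastforce
    qed
    have "((\<lambda>t. (g 0 - v - (z t - v)) * exp ((L 1 + Ln (c * (of_real (1 - s0) - (z t - v) * exp (- L 1))) -
         (L 0 + Ln (c * (of_real (0 - s0) - (z t - v) * exp (- L 0))))) / 2)) \<longlongrightarrow>
        (g 0 - v - 0) * exp ((L 1 + Ln (c * of_real (1 - s0)) - (L 0 + Ln (c * of_real (0 - s0)))) / 2)) (at_right 0)"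
      by (intro tendsto_intros zv lim) (use s0 in auto)
    moreover have "\<forall>\<^sub>F t in at_right 0. (g 0 - v - (z t - v)) * exp ((L 1 + Ln (c * (of_real (1 - s0) - (z t - v) * exp (- L 1))) -
         (L 0 + Ln (c * (of_real (0 - s0) - (z t - v) * exp (- L 0))))) / 2) = branch g (z t)"
      using ev by eventually_elim simp
    moreover have "exp ((L 1 + Ln (c * of_real (1 - s0)) - (L 0 + Ln (c * of_real (0 - s0)))) / 2) =
        \<sigma> * \<i> * exp ((L 1 - L 0 + of_real (ln (1 - s0) - ln s0)) / 2)"
    proof -
      have "Ln (of_real (1 - s0) * c) = of_real (ln (1 - s0)) + \<sigma> * \<i> * (pi / 2)"
        using s0 \<sigma> Ln_of_real [of "1 - s0"] by (subst Ln_times_of_real) (auto simp: c_def)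
      moreover have "Ln (of_real s0 * - c) = of_real (ln s0) - \<sigma> * \<i> * (pi / 2)"
        using s0 \<sigma> by (subst Ln_times_of_real) (auto simp: c_def Ln_of_real)
      ultimately have eq: "(L 1 + Ln (c * of_real (1 - s0)) - (L 0 + Ln (c * of_real (0 - s0)))) / 2 =
          \<sigma> * \<i> * (pi / 2) + (L 1 - L 0 + of_real (ln (1 - s0) - ln s0)) / 2"
        by (simp add: field_simps)
      have "exp (\<sigma> * \<i> * (pi / 2)) = \<sigma> * \<i>"
        using \<sigma> by (auto simp: exp_eq_polar exp_minus simp flip: cis_conv_exp)
      then show ?thesis
        unfolding eq exp_add by simp
    qed
    ultimately show ?thesis
      by (simp add: Lim_transform_eventually mult_ac)
  qed
qed

section \<open>Functions with values 1 and -1 on an interval\<close>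

lemma sign_tendsto_eventually:
  fixes \<rho> :: "'a \<Rightarrow> complex"
  assumes lim: "(\<rho> \<longlongrightarrow> l) F" and ev: "\<forall>\<^sub>F t in F. \<rho> t \<in> {1, -1}" and "F \<noteq> bot"
  shows "l \<in> {1, -1}" and "\<forall>\<^sub>F t in F. \<rho> t = l"
proof -
  have "l \<in> closure {1, -1}"
    by (rule Lim_in_closed_set [OF _ _ \<open>F \<noteq> bot\<close> lim]) (auto intro: eventually_mono [OF ev])
  then show l: "l \<in> {1, -1}"
    by simp
  have "\<forall>\<^sub>F t in F. dist (\<rho> t) l < 1"
    using lim by (simp add: tendsto_iff)
  with ev show "\<forall>\<^sub>F t in F. \<rho> t = l"
    by eventually_elim (use l in \<open>auto simp: dist_norm\<close>)
qed

text \<open>Only punctured neighbourhoods are controlled, because nothing is known about \<sigma> at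
  the jump points themselves. The function \<open>f\<close> of local values is locally constant
  everywhere, and the interval is connected.\<close>

lemma eventually_constant_interval:
  fixes \<sigma> :: "real \<Rightarrow> complex"
  assumes ev: "\<And>t. a < t \<Longrightarrow> t < b \<Longrightarrow> \<exists>c. \<forall>\<^sub>F u in at t. \<sigma> u = c" and "a < b"
  shows "\<exists>c. \<forall>t. a < t \<longrightarrow> t < b \<longrightarrow> (\<forall>\<^sub>F u in at t. \<sigma> u = c)"
proof -
  define f where "f t = (SOME c. \<forall>\<^sub>F u in at t. \<sigma> u = c)" for t
  have f: "\<forall>\<^sub>F u in at t. \<sigma> u = f t" if "a < t" "t < b" for t
    unfolding f_def by (rule someI_ex) (rule ev [OF that])
  have "f constant_on {a<..<b}"
  proof (rule locally_constant_imp_constant)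
    fix t assume t: "t \<in> {a<..<b}"
    then have "\<forall>\<^sub>F u in at t. \<sigma> u = f t"
      using f by simp
    then obtain S where S: "open S" "t \<in> S" "\<And>u. u \<in> S \<Longrightarrow> u \<noteq> t \<Longrightarrow> \<sigma> u = f t"
      unfolding eventually_at_topological by blast
    have "f u = f t" if u: "u \<in> {a<..<b} \<inter> S" for u
    proof (cases "u = t")
      case False
      have "\<forall>\<^sub>F w in at u. w \<in> S - {t}"
        using False u S by (intro eventually_at_in_open') auto
      moreover have "\<forall>\<^sub>F w in at u. \<sigma> w = f u"
        using f u by simp
      ultimately have "\<forall>\<^sub>F w in at u. f u = f t"
        by eventually_elim (use S in auto)
      then show ?thesis
        by simp
    qed simp
    moreover have "openin (top_of_set {a<..<b}) ({a<..<b} \<inter> S)"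
      using S by (simp add: openin_open_Int)
    moreover have "t \<in> {a<..<b} \<inter> S"
      using S t by blast
    ultimately show "\<exists>T. openin (top_of_set {a<..<b}) T \<and> t \<in> T \<and> (\<forall>x\<in>T. f x = f t)"
      by blast
  qed (rule connected_Ioo)
  then obtain c where c: "\<forall>t\<in>{a<..<b}. f t = c"
    unfolding constant_on_def by blast
  show ?thesis
  proof (intro exI [of _ c] allI impI)
    fix t assume "a < t" "t < b"
    then show "\<forall>\<^sub>F u in at t. \<sigma> u = c"
      using f [of t] c by simp
  qed
qed

text \<open>With \<open>N t\<close> the number of jump points before \<open>t\<close>, the factor
  \<open>(-1) ^ N t\<close> compensates every jump, so that \<open>\<sigma>\<close> is a single
  constant off \<open>Z\<close>. Near 0 no jump has been passed, near 1 all of them.\<close>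

proposition sign_changes:
  fixes \<rho> :: "real \<Rightarrow> complex"
  assumes Z: "finite Z" "Z \<subseteq> {0<..<1}"
    and sgn: "\<And>t. t \<in> {0<..<1} - Z \<Longrightarrow> \<rho> t \<in> {1, -1} \<and> isCont \<rho> t"
    and jump: "\<And>t. t \<in> Z \<Longrightarrow> \<exists>l. (\<rho> \<longlongrightarrow> l) (at_right t) \<and> (\<rho> \<longlongrightarrow> - l) (at_left t)"
  obtains c where "c \<in> {1, -1}" "\<forall>\<^sub>F t in at_right 0. \<rho> t = c" "\<forall>\<^sub>F t in at_left 1. \<rho> t = c * (-1) ^ card Z"
proof -
  define N where "N t = card {z \<in> Z. z < t}" for t
  define \<sigma> where "\<sigma> t = \<rho> t * (-1) ^ N t" for t
  have ev_off: "\<forall>\<^sub>F u in at t. u \<in> {0<..<1} - Z" if "t \<in> {0<..<1}" for t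
  proof -
    have "\<forall>\<^sub>F u in at t. u \<in> ({0<..<1} - (Z - {t})) - {t}"
      using that Z by (intro eventually_at_in_open open_Diff finite_imp_closed) auto
    then show ?thesis
      by (rule eventually_mono) auto
  qed
  have ev_sgn: "\<forall>\<^sub>F u in at t. \<rho> u \<in> {1, -1}" if "t \<in> {0<..<1}" for t
    using ev_off [OF that] by (rule eventually_mono) (use sgn in blast)
  have N: "\<forall>\<^sub>F u in at t. N u = (if t < u \<and> t \<in> Z then Suc (N t) else N t)" for t
  proof -
    have "\<forall>\<^sub>F u in at t. \<forall>z\<in>Z - {t}. (z < u \<longleftrightarrow> z < t)"
    proof (intro eventually_ball_finite ballI)
      fix z assume "z \<in> Z - {t}"
      then consider "z < t" | "t < z" by fastforce
      then show "\<forall>\<^sub>F u in at t. (z < u \<longleftrightarrow> z < t)"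
      proof cases
        case 1
        then have "\<forall>\<^sub>F u in at t. u \<in> {z<..}"
          by (intro eventually_at_in_open') auto
        then show ?thesis
          by (rule eventually_mono) (use 1 in auto)
      next
        case 2
        then have "\<forall>\<^sub>F u in at t. u \<in> {..<z}"
          by (intro eventually_at_in_open') auto
        then show ?thesis
          by (rule eventually_mono) (use 2 in auto)
      qed
    qed (use Z in auto)
    then show ?thesis
    proof (rule eventually_mono)
      fix u assume *: "\<forall>z\<in>Z - {t}. (z < u \<longleftrightarrow> z < t)"
      show "N u = (if t < u \<and> t \<in> Z then Suc (N t) else N t)"
      proof (cases "t < u \<and> t \<in> Z")
        case True
        then have "{z \<in> Z. z < u} = insert t {z \<in> Z. z < t}"
          using * by auto
        then show ?thesis
          using True Z by (simp add: N_def)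
      next
        case False
        have "z < u \<longleftrightarrow> z < t" if "z \<in> Z" for z
          using * that False by (cases "z = t") simp_all
        then have "{z \<in> Z. z < u} = {z \<in> Z. z < t}"
          by blast
        then show ?thesis
          using False by (simp add: N_def)
      qed
    qed
  qed
  have "\<exists>c. \<forall>\<^sub>F u in at t. \<sigma> u = c" if t: "0 < t" "t < 1" for t
  proof (cases "t \<in> Z")
    case True
    then obtain l where l: "(\<rho> \<longlongrightarrow> l) (at_right t)" "(\<rho> \<longlongrightarrow> - l) (at_left t)"
      using jump by blast
    have r: "\<forall>\<^sub>F u in at_right t. \<rho> u = l" and le: "\<forall>\<^sub>F u in at_left t. \<rho> u = - l"
      using ev_sgn [of t] t unfolding eventually_at_split
      by (auto intro: sign_tendsto_eventually(2) [OF l(1)] sign_tendsto_eventually(2) [OF l(2)])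
    have "\<forall>\<^sub>F u in at_right t. \<sigma> u = - l * (-1) ^ N t"
      using N [of t, unfolded eventually_at_split, THEN conjunct2] r eventually_at_right_less [of t]
      by eventually_elim (use True in \<open>simp add: \<sigma>_def\<close>)
    moreover have "\<forall>\<^sub>F u in at_left t. \<sigma> u = - l * (-1) ^ N t"
    proof -
      have "\<forall>\<^sub>F u in at_left t. u < t"
        by (simp add: eventually_at_filter)
      with le N [of t, unfolded eventually_at_split, THEN conjunct1] show ?thesis
        by eventually_elim (simp add: \<sigma>_def)
    qed
    ultimately show ?thesis
      unfolding eventually_at_split by blast
  next
    case False
    then have "(\<rho> \<longlongrightarrow> \<rho> t) (at t)"
      using sgn t by (auto simp: isCont_def)
    then have "\<forall>\<^sub>F u in at t. \<rho> u = \<rho> t"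
      using ev_sgn t by (intro sign_tendsto_eventually) auto
    with N [of t] have "\<forall>\<^sub>F u in at t. \<sigma> u = \<rho> t * (-1) ^ N t"
      by eventually_elim (simp add: \<sigma>_def False)
    then show ?thesis ..
  qed
  then have "\<exists>c. \<forall>t. 0 < t \<longrightarrow> t < 1 \<longrightarrow> (\<forall>\<^sub>F u in at t. \<sigma> u = c)"
    by (rule eventually_constant_interval) simp_all
  then obtain c where c: "\<And>t. 0 < t \<Longrightarrow> t < 1 \<Longrightarrow> \<forall>\<^sub>F u in at t. \<sigma> u = c"
    by blast
  have \<sigma>c: "\<sigma> t = c" if t: "t \<in> {0<..<1} - Z" for t
  proof -
    have "(\<rho> \<longlongrightarrow> \<rho> t) (at t)"
      using sgn t by (auto simp: isCont_def)
    then have "\<forall>\<^sub>F u in at t. \<rho> u = \<rho> t"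
      using ev_sgn t by (intro sign_tendsto_eventually) auto
    moreover have "\<forall>\<^sub>F u in at t. \<sigma> u = c"
      using t c by simp
    ultimately have "\<forall>\<^sub>F u in at t. \<sigma> t = c"
      using N [of t] by eventually_elim (use t in \<open>simp add: \<sigma>_def\<close>)
    then show ?thesis
      by simp
  qed
  have r: "\<forall>\<^sub>F t in at_right 0. t \<in> {0<..<1} \<and> (\<forall>z\<in>Z. t < z)"
  proof (intro eventually_conj eventually_ball_finite ballI)
    show "\<forall>\<^sub>F t in at_right 0. t \<in> {0<..<1::real}"
      by (rule eventually_at_right_real) simp
    fix z assume "z \<in> Z"
    then have "0 < z"
      using Z by auto
    then show "\<forall>\<^sub>F t in at_right 0. t < z"
      by (rule eventually_mono [OF eventually_at_right_real]) simp
  qed (rule Z)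
  have l: "\<forall>\<^sub>F t in at_left 1. t \<in> {0<..<1} \<and> (\<forall>z\<in>Z. z < t)"
  proof (intro eventually_conj eventually_ball_finite ballI)
    show "\<forall>\<^sub>F t in at_left 1. t \<in> {0<..<1::real}"
      by (rule eventually_at_left_real) simp
    fix z assume "z \<in> Z"
    then have "z < 1"
      using Z by auto
    then show "\<forall>\<^sub>F t in at_left 1. z < t"
      by (rule eventually_mono [OF eventually_at_left_real]) simp
  qed (rule Z)
  have 1: "\<forall>\<^sub>F t in at_right 0. \<rho> t = c"
    using r
  proof eventually_elim
    case (elim t)
    then have "{z \<in> Z. z < t} = {}" "t \<notin> Z" by force+
    then have "N t = 0"
      by (simp only: N_def card.empty)
    with \<open>t \<notin> Z\<close> show ?case
      using \<sigma>c [of t] elim by (simp add: \<sigma>_def)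
  qed
  have 2: "\<forall>\<^sub>F t in at_left 1. \<rho> t = c * (-1) ^ card Z"
    using l
  proof eventually_elim
    case (elim t)
    then have "{z \<in> Z. z < t} = Z" "t \<notin> Z" by force+
    then have "N t = card Z"
      by (simp only: N_def)
    with \<open>t \<notin> Z\<close> have "\<rho> t * (-1) ^ card Z = c"
      using \<sigma>c [of t] elim by (simp add: \<sigma>_def)
    then show ?case
      by (cases "even (card Z)") auto
  qed
  have "c \<in> {1, -1}"
  proof -
    have "infinite {0<..<1::real}" by simp
    then obtain t where "t \<in> {0<..<1} - Z"
      using Z by (metis Diff_eq_empty_iff equals0I finite_subset)
    then show ?thesis
      using sgn [of t] \<sigma>c [of t] by (cases "even (N t)") (auto simp: \<sigma>_def)
  qed
  then show ?thesis
    using 1 2 by (rule that)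
qed

section \<open>Principal square roots and the cyclic order of three directions\<close>

lemma csqrt_polar:
  assumes "r > 0" "- pi < \<theta>" "\<theta> \<le> pi"
  shows "csqrt (of_real r * exp (\<i> * of_real \<theta>)) = of_real (sqrt r) * exp (\<i> * of_real (\<theta> / 2))"
proof -
  have "Ln (exp (\<i> * of_real \<theta>)) = \<i> * of_real \<theta>"
    using assms by (intro Ln_exp) auto
  then show ?thesis
    using assms exp_half_Ln [of "exp (\<i> * of_real \<theta>)"] by (simp add: csqrt_of_real_mult)
qed

text \<open>The left-hand side has square -1, so only a sign is in question. With angles measured
  from \<open>m\<close>, a shift by pi brings the arguments of \<open>- b / m\<close> and
  \<open>- m / a\<close> into the principal range whatever the order of \<open>a\<close> and
  \<open>b\<close>. For \<open>- b / a\<close> the direction of the shift depends on which of the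
  two comes first, and this is where the cyclic order enters. The product itself is what remains of
  the leading coefficients at a node shared by two systems of cycles.\<close>

lemma csqrt_cyclic:
  assumes nz: "m \<noteq> 0" "a \<noteq> 0" "b \<noteq> 0"
    and ne: "Arg2pi (a / m) \<noteq> 0" "Arg2pi (b / m) \<noteq> 0" "Arg2pi (a / m) \<noteq> Arg2pi (b / m)"
  shows "csqrt (- b / m) * csqrt (- b / a) * csqrt (- m / a) * (a / b) =
    - \<i> * (if Arg2pi (b / m) < Arg2pi (a / m) then -1 else 1)"
proof -
  define \<alpha> \<beta> A B where "\<alpha> = Arg2pi (a / m)" and "\<beta> = Arg2pi (b / m)" and "A = cmod (a / m)" and "B = cmod (b / m)"
  define e where "e x = exp (\<i> * complex_of_real x)" for x
  have e_add: "e (x + y) = e x * e y" and e_minus: "e (- x) = inverse (e x)" and e_nz [simp]: "e x \<noteq> 0" for x y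
    by (simp_all add: e_def ring_distribs exp_add exp_minus)
  have e_diff: "e (x - y) = e x / e y" for x y
    by (simp add: e_def ring_distribs exp_diff)
  have e_pi: "e pi = -1" "e (- pi) = -1" "e (- (pi / 2)) = - \<i>" "e (pi / 2) = \<i>"
  proof -
    have "e pi = cis pi" "e (pi / 2) = cis (pi / 2)"
      by (simp_all only: e_def cis_conv_exp)
    then show pi: "e pi = -1" and pi2: "e (pi / 2) = \<i>"
      by simp_all
    show "e (- pi) = -1" "e (- (pi / 2)) = - \<i>"
      using e_minus [of pi] e_minus [of "pi / 2"] by (simp_all add: pi pi2)
  qed
  have pos: "A > 0" "B > 0"
    using nz by (auto simp: A_def B_def)
  have bd: "0 < \<alpha>" "\<alpha> < 2 * pi" "0 < \<beta>" "\<beta> < 2 * pi" "\<alpha> \<noteq> \<beta>"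
    using Arg2pi [of "a / m"] Arg2pi [of "b / m"] ne by (auto simp: \<alpha>_def \<beta>_def)
  have a: "a = m * (A * e \<alpha>)" and b: "b = m * (B * e \<beta>)"
  proof -
    have "a / m = A * e \<alpha>" "b / m = B * e \<beta>"
      unfolding \<alpha>_def \<beta>_def A_def B_def e_def by (rule Arg2pi_eq)+
    then have "m * (a / m) = m * (A * e \<alpha>)" "m * (b / m) = m * (B * e \<beta>)"
      by simp_all
    then show "a = m * (A * e \<alpha>)" "b = m * (B * e \<beta>)"
      using nz by simp_all
  qed
  have sq: "csqrt (of_real r * e x) = of_real (sqrt r) * e (x / 2)" if "r > 0" "- pi < x" "x \<le> pi" for r x
    using csqrt_polar [OF that] by (simp add: e_def)
  have 1: "csqrt (- b / m) = sqrt B * e ((\<beta> - pi) / 2)"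
  proof -
    have "- b / m = B * e (\<beta> - pi)"
      using nz by (simp add: b e_pi e_diff)
    then show ?thesis
      using sq [OF pos(2), of "\<beta> - pi"] bd by simp
  qed
  have 2: "csqrt (- m / a) = sqrt (1 / A) * e ((pi - \<alpha>) / 2)"
  proof -
    have "- m / a = of_real (1 / A) * e (pi - \<alpha>)"
      using nz pos by (simp add: a e_pi e_diff)
    then show ?thesis
      using sq [of "1 / A" "pi - \<alpha>"] pos bd by simp
  qed
  have 3: "csqrt (- b / a) = sqrt (B / A) * e ((\<beta> - \<alpha> - (if \<beta> < \<alpha> then - pi else pi)) / 2)"
  proof -
    have "- b / a = of_real (B / A) * e (\<beta> - \<alpha> - (if \<beta> < \<alpha> then - pi else pi))"
      using nz pos by (cases "\<beta> < \<alpha>") (simp_all add: a b e_pi e_diff e_add)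
    then show ?thesis
      using sq [of "B / A" "\<beta> - \<alpha> - (if \<beta> < \<alpha> then - pi else pi)"] pos bd by auto
  qed
  have 4: "a / b = of_real (A / B) * e (\<alpha> - \<beta>)"
    using nz pos by (simp add: a b e_diff)
  have r: "sqrt B * sqrt (B / A) * sqrt (1 / A) * (A / B) = 1"
    using pos by (simp add: real_sqrt_divide)
  have "csqrt (- b / m) * csqrt (- b / a) * csqrt (- m / a) * (a / b) =
    of_real (sqrt B * sqrt (B / A) * sqrt (1 / A) * (A / B)) *
    e ((\<beta> - pi) / 2 + (\<beta> - \<alpha> - (if \<beta> < \<alpha> then - pi else pi)) / 2 + (pi - \<alpha>) / 2 + (\<alpha> - \<beta>))"
    unfolding 1 2 3 4 e_add by simp
  \<comment> \<open>All angles cancel; what survives is half the shift chosen for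
    \<open>- b / a\<close>, with opposite sign.\<close>
  also have "(\<beta> - pi) / 2 + (\<beta> - \<alpha> - (if \<beta> < \<alpha> then - pi else pi)) / 2 + (pi - \<alpha>) / 2 + (\<alpha> - \<beta>) = (if \<beta> < \<alpha> then pi / 2 else - pi / 2)"
    by (simp add: field_simps)
  finally show ?thesis
    unfolding r by (simp add: e_pi \<alpha>_def \<beta>_def)
qed

section \<open>Signs along the edges of an immersed graph\<close>

lemma difference_quotient_tendsto:
  fixes g :: "real \<Rightarrow> complex"
  assumes "(g has_vector_derivative d) (at s0 within S)"
  shows "((\<lambda>t. (g t - g s0) / of_real (t - s0)) \<longlongrightarrow> d) (at s0 within S)"
proof -
  define q where "q t = (g t - g s0) / of_real (t - s0)" for t
  have lim: "((\<lambda>t. norm (g t - g s0 - (t - s0) *\<^sub>R d) / norm (t - s0)) \<longlongrightarrow> 0) (at s0 within S)"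
    using assms unfolding has_vector_derivative_def has_derivative_iff_norm by blast
  have "norm (g t - g s0 - (t - s0) *\<^sub>R d) / norm (t - s0) = norm (q t - d)" if "t \<noteq> s0" for t
  proof -
    have "q t - d = (g t - g s0 - (t - s0) *\<^sub>R d) / of_real (t - s0)"
      using that by (simp add: q_def scaleR_conv_of_real diff_divide_distrib del: of_real_diff)
    then show ?thesis
      by (simp only: norm_divide norm_of_real real_norm_def)
  qed
  then have "\<forall>\<^sub>F t in at s0 within S. norm (g t - g s0 - (t - s0) *\<^sub>R d) / norm (t - s0) = norm (q t - d)"
    unfolding eventually_at_filter by (simp add: always_eventually)
  from Lim_transform_eventually [OF lim this] show ?thesis
    unfolding q_def by (rule LIM_zero_cancel [OF tendsto_norm_zero_cancel])
qed

text \<open>The difference quotient at \<open>s0\<close>, completed by the derivative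
  \<open>d\<close>, is continuous and has no zero; since the interval is contractible, it has a
  continuous logarithm. This supplies the form \<open>of_real (s - s0) * exp (L s)\<close> on which
  the asymptotics of \<open>branch\<close> rest.\<close>

lemma secant_logarithm:
  fixes g :: "real \<Rightarrow> complex"
  assumes g: "continuous_on {0..1} g" and d: "(g has_vector_derivative d) (at s0)" "d \<noteq> 0"
    and s0: "s0 \<in> {0..1}" and inj: "\<And>s. s \<in> {0..1} \<Longrightarrow> s \<noteq> s0 \<Longrightarrow> g s \<noteq> g s0"
  shows "\<exists>L. continuous_on {0..1} L \<and> exp (L s0) = d \<and> (\<forall>s\<in>{0..1}. g s - g s0 = of_real (s - s0) * exp (L s))"
proof -
  define q where "q s = (if s = s0 then d else (g s - g s0) / of_real (s - s0))" for s
  have q: "continuous_on {0..1} q"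
    unfolding continuous_on_eq_continuous_within
  proof
    fix s :: real
    assume s: "s \<in> {0..1}"
    show "continuous (at s within {0..1}) q"
    proof (cases "s = s0")
      case True
      have "((\<lambda>t. (g t - g s0) / of_real (t - s0)) \<longlongrightarrow> d) (at s0 within {0..1})"
        by (rule difference_quotient_tendsto [OF has_vector_derivative_at_within [OF d(1)]])
      moreover have "\<forall>\<^sub>F t in at s0 within {0..1}. (g t - g s0) / of_real (t - s0) = q t"
        unfolding eventually_at_filter by (simp add: always_eventually q_def)
      ultimately have "(q \<longlongrightarrow> d) (at s0 within {0..1})"
        by (rule Lim_transform_eventually)
      then show ?thesis
        using True by (simp add: continuous_within q_def)
    next
      case False
      have 1: "continuous (at s within {0..1}) g"
        using g s by (simp add: continuous_on_eq_continuous_within)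
      have "continuous (at s within {0..1}) (\<lambda>t. (g t - g s0) / of_real (t - s0))"
        using False by (intro continuous_intros 1) auto
      then have lim: "((\<lambda>t. (g t - g s0) / of_real (t - s0)) \<longlongrightarrow> q s) (at s within {0..1})"
        using False by (simp add: continuous_within q_def)
      have "\<forall>\<^sub>F t in at s within {0..1}. t \<noteq> s0"
        by (rule tendsto_imp_eventually_ne [OF tendsto_ident_at False])
      then have "\<forall>\<^sub>F t in at s within {0..1}. (g t - g s0) / of_real (t - s0) = q t"
        by (rule eventually_mono) (simp add: q_def)
      from Lim_transform_eventually [OF lim this] show ?thesis
        by (simp add: continuous_within)
    qed
  qed
  have q0: "q s \<noteq> 0" if "s \<in> {0..1}" for s
    using that d(2) inj [OF that] by (auto simp: q_def)
  have "\<exists>L. continuous_on {0..1} L \<and> (\<forall>s\<in>{0..1}. q s = exp (L s))"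
    by (rule continuous_logarithm_on_contractible [OF q convex_imp_contractible]) (use q0 in auto)
  then obtain L where "continuous_on {0..1} L" and L: "\<And>s. s \<in> {0..1} \<Longrightarrow> q s = exp (L s)"
    by blast
  show ?thesis
  proof (intro exI conjI ballI)
    show "exp (L s0) = d"
      using L [OF s0] by (simp add: q_def)
    show "g s - g s0 = of_real (s - s0) * exp (L s)" if "s \<in> {0..1}" for s
      using L [OF that] by (cases "s = s0") (auto simp: q_def field_simps)
  qed fact
qed

section \<open>Edge-ends and elementary consequences of the immersion\<close>

fun opposite :: "'e edge_end \<Rightarrow> 'e edge_end" where
  "opposite (e, Tail) = (e, Head)"
| "opposite (e, Head) = (e, Tail)"

fun along :: "'e edge_end \<Rightarrow> real \<Rightarrow> real" where
  "along (e, Tail) s = s"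
| "along (e, Head) s = 1 - s"

lemma fst_opposite [simp]: "fst (opposite h) = fst h"
  by (cases h rule: opposite.cases) auto

lemma opposite_opposite [simp]: "opposite (opposite h) = h"
  by (cases h rule: opposite.cases) auto

lemma opposite_neq [simp]: "opposite h \<noteq> h"
  by (cases h rule: opposite.cases) auto

lemma edge_end_eq_or_opposite: "fst h = fst k \<Longrightarrow> h = k \<or> h = opposite k"
  by (cases h rule: opposite.cases; cases k rule: opposite.cases) auto

lemma along_in [simp]: "along h s \<in> {0<..<1} \<longleftrightarrow> s \<in> {0<..<1}" "along h s \<in> {0..1} \<longleftrightarrow> s \<in> {0..1}"
  by (cases h rule: opposite.cases; auto)+

locale immersed_digraph = fin_digraph G
  for G :: "('v, 'e) pre_digraph" +
  fixes p :: "'v \<Rightarrow> complex" and \<gamma> :: "'e \<Rightarrow> real \<Rightarrow> complex"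
  assumes immersion: "plane_immersion G p \<gamma>"
begin

lemma inj_p: "inj_on p (verts G)"
  and edge_conditions: "\<forall>e\<in>arcs G. \<gamma> e C1_differentiable_on {0..1} \<and>
        (\<forall>t\<in>{0..1}. velocity \<gamma> (e, t) \<noteq> 0) \<and>
        \<gamma> e 0 = p (tail G e) \<and> \<gamma> e 1 = p (head G e) \<and>
        (\<forall>t\<in>{0<..<1}. \<forall>v\<in>verts G. \<gamma> e t \<noteq> p v)"
  and sgn_directions: "\<forall>v\<in>verts G. \<forall>h\<in>edge_ends G v. \<forall>k\<in>edge_ends G v. h \<noteq> k \<longrightarrow>
        sgn (outward_direction \<gamma> h) \<noteq> sgn (outward_direction \<gamma> k)"
  and finite_crossings: "finite (crossings G \<gamma>)"
  and crossings_disjoint: "\<forall>X\<in>crossings G \<gamma>. \<forall>Y\<in>crossings G \<gamma>. X \<noteq> Y \<longrightarrow> X \<inter> Y = {}"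
  and crossings_transverse: "\<forall>x y. {x, y} \<in> crossings G \<gamma> \<longrightarrow>
        \<not> collinear {0, velocity \<gamma> x, velocity \<gamma> y}"
  using immersion unfolding plane_immersion_def by - (elim conjE, assumption)+

lemma edge_derivative:
  assumes "e \<in> arcs G" "t \<in> {0..1}"
  shows "(\<gamma> e has_vector_derivative velocity \<gamma> (e, t)) (at t)" "velocity \<gamma> (e, t) \<noteq> 0"
proof -
  have "\<gamma> e C1_differentiable_on {0..1}"
    using assms(1) edge_conditions by simp
  then have "\<gamma> e differentiable at t"
    using assms(2) unfolding C1_differentiable_on_eq by simp
  then show "(\<gamma> e has_vector_derivative velocity \<gamma> (e, t)) (at t)"
    by (simp add: vector_derivative_works)
  show "velocity \<gamma> (e, t) \<noteq> 0"
    using assms edge_conditions by simp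
qed

lemma isCont_edge: "e \<in> arcs G \<Longrightarrow> t \<in> {0..1} \<Longrightarrow> isCont (\<gamma> e) t"
  by (rule has_vector_derivative_continuous [OF edge_derivative(1)])

lemma continuous_edge: "e \<in> arcs G \<Longrightarrow> continuous_on {0..1} (\<gamma> e)"
  by (intro continuous_at_imp_continuous_on ballI isCont_edge)

lemma path_edge: "e \<in> arcs G \<Longrightarrow> path (\<gamma> e)"
  by (simp add: path_def continuous_edge)

lemma edge_ends_at:
  assumes "e \<in> arcs G"
  shows "\<gamma> e 0 = p (tail G e)" "\<gamma> e 1 = p (head G e)"
  using assms edge_conditions by simp_all

lemma edge_avoids_nodes: "e \<in> arcs G \<Longrightarrow> t \<in> {0<..<1} \<Longrightarrow> v \<in> verts G \<Longrightarrow> \<gamma> e t \<noteq> p v"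
  using edge_conditions by simp

lemma node_in_verts: "fst h \<in> arcs G \<Longrightarrow> end_node G h \<in> verts G"
  by (cases h rule: opposite.cases) auto

text \<open>Every edge can be run outward from either end, so that tails and heads are both treated
  by limits at \<open>at_right 0\<close>. By \<open>branch_reversepath\<close> this change of
  direction is invisible to \<open>branch\<close>.\<close>

definition curve :: "'e edge_end \<Rightarrow> real \<Rightarrow> complex" where
  "curve h s = \<gamma> (fst h) (along h s)"

lemma curve_Tail: "curve (e, Tail) = \<gamma> e" and curve_Head: "curve (e, Head) = reversepath (\<gamma> e)"
  by (auto simp: curve_def reversepath_def)

lemma curve_derivative:
  assumes "fst h \<in> arcs G"
  shows "(curve h has_vector_derivative outward_direction \<gamma> h) (at 0)" "outward_direction \<gamma> h \<noteq> 0"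
proof -
  show "outward_direction \<gamma> h \<noteq> 0"
    using assms edge_derivative(2) [of "fst h" 0] edge_derivative(2) [of "fst h" 1]
    by (cases h rule: opposite.cases) auto
  show "(curve h has_vector_derivative outward_direction \<gamma> h) (at 0)"
  proof (cases h rule: opposite.cases)
    case (1 e)
    then show ?thesis
      using assms edge_derivative(1) [of "fst h" 0] by (simp add: curve_Tail)
  next
    case (2 e)
    have "((\<lambda>s. 1 - s) has_vector_derivative (- 1 :: real)) (at 0)"
      by (auto intro!: derivative_eq_intros)
    then have "(\<gamma> e \<circ> (\<lambda>s. 1 - s) has_vector_derivative (- 1) *\<^sub>R velocity \<gamma> (e, 1)) (at 0)"
      using assms edge_derivative(1) [of e 1] 2 by (intro vector_diff_chain_at) auto
    then show ?thesis
      using 2 by (simp add: curve_Head reversepath_def o_def)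
  qed
qed

lemma curve_0: "fst h \<in> arcs G \<Longrightarrow> curve h 0 = p (end_node G h)"
  and curve_1: "fst h \<in> arcs G \<Longrightarrow> curve h 1 = p (end_node G (opposite h))"
  by (cases h rule: opposite.cases; simp add: curve_def edge_ends_at)+

lemma continuous_curve: "fst h \<in> arcs G \<Longrightarrow> continuous_on {0..1} (curve h)"
  using path_edge [of "fst h"] by (cases h rule: opposite.cases) (auto simp: curve_Tail curve_Head simp flip: path_def)

lemma path_image_curve: "path_image (curve h) = path_image (\<gamma> (fst h))"
  by (cases h rule: opposite.cases) (auto simp: curve_Tail curve_Head)

lemma branch_curve:
  assumes "fst h \<in> arcs G" "z \<notin> path_image (\<gamma> (fst h))"
  shows "branch (curve h) z = branch (\<gamma> (fst h)) z"
  using assms by (cases h rule: opposite.cases) (auto simp: curve_Tail curve_Head branch_reversepath path_edge)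

lemma curve_avoids_nodes: "fst h \<in> arcs G \<Longrightarrow> s \<in> {0<..<1} \<Longrightarrow> v \<in> verts G \<Longrightarrow> curve h s \<noteq> p v"
  unfolding curve_def by (rule edge_avoids_nodes) (simp_all only: along_in)

lemma node_on_edge:
  assumes "e \<in> arcs G" "v \<in> verts G" "p v \<in> path_image (\<gamma> e)"
  shows "v = tail G e \<or> v = head G e"
proof -
  obtain t where t: "t \<in> {0..1}" "\<gamma> e t = p v"
    using assms by (auto simp: path_image_def)
  then have "t \<notin> {0<..<1}"
    using edge_avoids_nodes assms by blast
  then have "t = 0 \<or> t = 1"
    using t by auto
  then show ?thesis
    using t edge_ends_at [OF assms(1)] inj_onD [OF inj_p] assms(1,2) by fastforce
qed

text \<open>The ends of \<open>e\<close> are nodes and the interior of \<open>f\<close> avoids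
  nodes; so a common point in the interior of \<open>f\<close> is interior to \<open>e\<close> as
  well.\<close>

lemma same_point_is_crossing:
  assumes "e \<in> arcs G" "f \<in> arcs G" "s \<in> {0..1}" "t \<in> {0<..<1}" "\<gamma> e s = \<gamma> f t" "(e, s) \<noteq> (f, t)"
  shows "s \<in> {0<..<1}" "{(e, s), (f, t)} \<in> crossings G \<gamma>"
proof -
  have "s \<noteq> 0" "s \<noteq> 1"
    using assms edge_avoids_nodes [of f t] edge_ends_at [of e] tail_in_verts [of e] head_in_verts [of e]
    by fastforce+
  then show "s \<in> {0<..<1}"
    using assms by auto
  then show "{(e, s), (f, t)} \<in> crossings G \<gamma>"
    using assms by (force simp: crossings_def)
qed

lemma no_triple_points:
  "X \<in> crossings G \<gamma> \<Longrightarrow> Y \<in> crossings G \<gamma> \<Longrightarrow> x \<in> X \<Longrightarrow> x \<in> Y \<Longrightarrow> X = Y"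
  using crossings_disjoint by blast

lemma crossing_transverse:
  assumes "{(e, s), (f, t)} \<in> crossings G \<gamma>"
  shows "Im (velocity \<gamma> (f, t) / velocity \<gamma> (e, s)) \<noteq> 0"
proof
  let ?u = "velocity \<gamma> (e, s)" and ?w = "velocity \<gamma> (f, t)"
  assume "Im (?w / ?u) = 0"
  then obtain r where r: "?w / ?u = of_real r"
    by (metis complex_is_Real_iff Reals_cases)
  have "collinear {0, ?u, ?w}"
  proof (cases "?u = 0")
    case False
    then have "?w = r *\<^sub>R ?u"
      using r by (simp add: field_simps scaleR_conv_of_real)
    then show ?thesis
      by (auto simp: collinear_lemma)
  qed auto
  then show False
    using assms crossings_transverse by blast
qed

text \<open>This is the form in which distinct directions are used by
  \<open>branch_near_end\<close>: the negated quotient stays off the cut of the principal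
  root.\<close>

lemma directions_distinct:
  assumes "h \<in> edge_ends G v" "k \<in> edge_ends G v" "h \<noteq> k"
  shows "outward_direction \<gamma> k / outward_direction \<gamma> h \<notin> \<real>\<^sub>\<ge>\<^sub>0"
proof
  let ?d = "outward_direction \<gamma> h" and ?y = "outward_direction \<gamma> k"
  assume "?y / ?d \<in> \<real>\<^sub>\<ge>\<^sub>0"
  then obtain r where r: "?y / ?d = of_real r" "r \<ge> 0"
    by (auto elim: nonneg_Reals_cases)
  have nz: "?d \<noteq> 0" "?y \<noteq> 0"
    using assms curve_derivative(2) by (auto simp: edge_ends_def)
  then have "?y = r *\<^sub>R ?d" "r > 0"
    using r by (auto simp: field_simps scaleR_conv_of_real less_le)
  then have "sgn ?y = sgn ?d"
    by (simp add: sgn_scaleR)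
  moreover have "v \<in> verts G"
    using assms node_in_verts [of h] by (auto simp: edge_ends_def)
  ultimately show False
    using assms sgn_directions by fastforce
qed

lemma turn_neq:
  assumes h: "fst h \<in> arcs G" and ab: "a \<in> edge_ends G v" "b \<in> edge_ends G v" "a \<noteq> b"
  shows "turn \<gamma> h a \<noteq> turn \<gamma> h b"
proof
  let ?d = "outward_direction \<gamma>"
  assume *: "turn \<gamma> h a = turn \<gamma> h b"
  have d_nz: "?d h \<noteq> 0" "?d a \<noteq> 0" "?d b \<noteq> 0"
    using curve_derivative(2) h ab by (auto simp: edge_ends_def)
  define \<theta> where "\<theta> = turn \<gamma> h b"
  have "(?d b / ?d h) / (?d a / ?d h) = (of_real (cmod (?d b / ?d h)) * exp (\<i> * of_real \<theta>)) / (of_real (cmod (?d a / ?d h)) * exp (\<i> * of_real \<theta>))"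
    using Arg2pi_eq [of "?d b / ?d h"] Arg2pi_eq [of "?d a / ?d h"] * unfolding \<theta>_def turn_def by simp
  then have "?d b / ?d a = of_real (cmod (?d b / ?d h) / cmod (?d a / ?d h))"
    using d_nz by simp
  then have "?d b / ?d a \<in> \<real>\<^sub>\<ge>\<^sub>0"
    by (metis divide_nonneg_nonneg nonneg_Reals_of_real_iff norm_ge_zero)
  then show False
    using directions_distinct [OF ab] by simp
qed

section \<open>The sign of one edge along another\<close>

definition node_sqrt :: "'v \<Rightarrow> 'e \<Rightarrow> real \<Rightarrow> complex" where
  "node_sqrt v f = (SOME h. continuous_on {0<..<1} h \<and> (\<forall>t\<in>{0<..<1}. p v - \<gamma> f t = (h t)\<^sup>2))"

lemma node_sqrt:
  assumes "v \<in> verts G" "f \<in> arcs G"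
  shows "continuous_on {0<..<1} (node_sqrt v f)"
    and "\<And>t. t \<in> {0<..<1} \<Longrightarrow> (node_sqrt v f t)\<^sup>2 = p v - \<gamma> f t"
    and "\<And>t. t \<in> {0<..<1} \<Longrightarrow> node_sqrt v f t \<noteq> 0"
proof -
  have cont: "continuous_on {0<..<1} (\<lambda>t. p v - \<gamma> f t)"
    using continuous_edge [OF assms(2)] by (intro continuous_intros) (auto elim: continuous_on_subset)
  have nz: "p v - \<gamma> f t \<noteq> 0" if "t \<in> {0<..<1}" for t
    using edge_avoids_nodes assms that by force
  have "\<exists>h. continuous_on {0<..<1} h \<and> (\<forall>t\<in>{0<..<1}. p v - \<gamma> f t = (h t)\<^sup>2)"
    by (rule continuous_sqrt_on_contractible [OF cont convex_imp_contractible]) (use nz in auto)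
  from someI_ex [OF this] have *: "continuous_on {0<..<1} (node_sqrt v f) \<and> (\<forall>t\<in>{0<..<1}. p v - \<gamma> f t = (node_sqrt v f t)\<^sup>2)"
    unfolding node_sqrt_def .
  then show "continuous_on {0<..<1} (node_sqrt v f)"
    by blast
  show sq: "(node_sqrt v f t)\<^sup>2 = p v - \<gamma> f t" if "t \<in> {0<..<1}" for t
    using conjunct2 [OF *] that by fastforce
  show "node_sqrt v f t \<noteq> 0" if "t \<in> {0<..<1}" for t
    using sq [OF that] nz [OF that] by auto
qed

text \<open>The root is split over the two nodes of \<open>e\<close>, and each factor depends only
  on the node and on \<open>f\<close>. In a system of cycles every node then contributes the same
  factor twice, and its arbitrary sign drops out of the product.\<close>

definition end_sqrt :: "'e \<Rightarrow> 'e \<Rightarrow> real \<Rightarrow> complex" where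
  "end_sqrt e f t = node_sqrt (tail G e) f t * node_sqrt (head G e) f t"

lemma end_sqrt:
  assumes "e \<in> arcs G" "f \<in> arcs G" "t \<in> {0<..<1}"
  shows "(end_sqrt e f t)\<^sup>2 = (p (tail G e) - \<gamma> f t) * (p (head G e) - \<gamma> f t)"
    and "end_sqrt e f t \<noteq> 0" and "isCont (end_sqrt e f) t"
proof -
  have "isCont (node_sqrt v f) t" if "v \<in> verts G" for v
    using node_sqrt(1) [OF that assms(2)] assms(3) by (simp add: continuous_on_eq_continuous_at)
  then show "isCont (end_sqrt e f) t"
    using assms unfolding end_sqrt_def by (intro continuous_intros) auto
qed (use assms in \<open>simp_all add: end_sqrt_def power_mult_distrib node_sqrt\<close>)

text \<open>
  Both factors of the quotient are square roots of the same function of \<open>t\<close>, but only the numerator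
  sees the interior of \<open>e\<close>: it jumps exactly where \<open>f\<close> crosses \<open>e\<close>.
\<close>

definition rel_sign :: "'e \<Rightarrow> 'e \<Rightarrow> real \<Rightarrow> complex" where
  "rel_sign e f t = branch (\<gamma> e) (\<gamma> f t) / end_sqrt e f t"

lemma rel_sign:
  assumes "e \<in> arcs G" "f \<in> arcs G" "t \<in> {0<..<1}" "\<gamma> f t \<notin> path_image (\<gamma> e)"
  shows "rel_sign e f t \<in> {1, -1}" and "isCont (rel_sign e f) t"
proof -
  have "(branch (\<gamma> e) (\<gamma> f t))\<^sup>2 = (end_sqrt e f t)\<^sup>2"
    using assms by (simp add: end_sqrt branch_square path_edge pathstart_def pathfinish_def edge_ends_at)
  then have "(rel_sign e f t)\<^sup>2 = 1"
    using end_sqrt(2) [OF assms(1-3)] by (simp add: rel_sign_def power_divide)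
  then show "rel_sign e f t \<in> {1, -1}"
    by (simp add: power2_eq_1_iff)
  have "isCont (\<lambda>t. branch (\<gamma> e) (\<gamma> f t)) t"
    using assms by (intro isCont_o2 [OF isCont_edge isCont_branch]) (auto simp: path_edge)
  then show "isCont (rel_sign e f) t"
    unfolding rel_sign_def using end_sqrt(2,3) [OF assms(1-3)] by (intro continuous_intros)
qed

definition hits :: "'e \<Rightarrow> 'e \<Rightarrow> real set" where
  "hits e f = {t \<in> {0<..<1}. \<gamma> f t \<in> path_image (\<gamma> e)}"

lemma hits_crossing:
  assumes "e \<in> arcs G" "f \<in> arcs G" "e \<noteq> f" "t \<in> hits e f"
  obtains s where "s \<in> {0<..<1}" "\<gamma> e s = \<gamma> f t" "{(e, s), (f, t)} \<in> crossings G \<gamma>"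
proof -
  obtain s where "s \<in> {0..1}" "\<gamma> e s = \<gamma> f t" and t: "t \<in> {0<..<1}"
    using assms by (auto simp: hits_def path_image_def)
  then show ?thesis
    using same_point_is_crossing [of e f s t] assms that by blast
qed

lemma finite_crossing: "X \<in> crossings G \<gamma> \<Longrightarrow> finite X"
  by (auto simp: crossings_def)

lemma finite_hits:
  assumes "e \<in> arcs G" "f \<in> arcs G" "e \<noteq> f"
  shows "finite (hits e f)"
proof (rule finite_subset)
  show "hits e f \<subseteq> snd ` \<Union>(crossings G \<gamma>)"
  proof
    fix t assume "t \<in> hits e f"
    then obtain s where "{(e, s), (f, t)} \<in> crossings G \<gamma>"
      using hits_crossing [OF assms] by blast
    then show "t \<in> snd ` \<Union>(crossings G \<gamma>)"
      by force
  qed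
qed (use finite_crossings finite_crossing in auto)

text \<open>By transversality \<open>f\<close> passes from one side of \<open>e\<close> to the
  other, so the numerator has opposite one-sided limits, while the denominator is continuous and
  nonzero.\<close>

lemma rel_sign_jump:
  assumes ef: "e \<in> arcs G" "f \<in> arcs G" "e \<noteq> f" and t: "t \<in> hits e f"
  shows "\<exists>l. (rel_sign e f \<longlongrightarrow> l) (at_right t) \<and> (rel_sign e f \<longlongrightarrow> - l) (at_left t)"
proof -
  obtain s where s: "s \<in> {0<..<1}" "\<gamma> e s = \<gamma> f t" and X: "{(e, s), (f, t)} \<in> crossings G \<gamma>"
    using hits_crossing [OF ef t] by blast
  have t01: "t \<in> {0<..<1}"
    using t by (simp add: hits_def)
  \<comment> \<open>A second passage of \<open>e\<close> through this point would make it a triple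
    point.\<close>
  have "\<gamma> e u \<noteq> \<gamma> e s" if u: "u \<in> {0..1}" "u \<noteq> s" for u
  proof
    assume "\<gamma> e u = \<gamma> e s"
    then have "{(e, u), (e, s)} \<in> crossings G \<gamma>"
      using same_point_is_crossing(2) [of e e u s] ef s u by simp
    then have "{(e, u), (e, s)} = {(e, s), (f, t)}"
      using no_triple_points [OF _ X, of _ "(e, s)"] by simp
    then show False
      using ef by (auto simp: doubleton_eq_iff)
  qed
  then have "\<exists>L. continuous_on {0..1} L \<and> exp (L s) = velocity \<gamma> (e, s) \<and>
      (\<forall>u\<in>{0..1}. \<gamma> e u - \<gamma> e s = of_real (u - s) * exp (L u))"
    using ef(1) s by (intro secant_logarithm continuous_edge edge_derivative) auto
  then obtain L where L: "continuous_on {0..1} L" "exp (L s) = velocity \<gamma> (e, s)"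
    "\<And>u. u \<in> {0..1} \<Longrightarrow> \<gamma> e u - \<gamma> e s = of_real (u - s) * exp (L u)"
    by blast
  have L': "\<And>u. u \<in> {0..1} \<Longrightarrow> \<gamma> e u - \<gamma> f t = of_real (u - s) * exp (L u)"
    using L(3) s(2) by simp
  let ?y = "velocity \<gamma> (f, t)"
  define \<sigma> where "\<sigma> = sgn (Im (?y / exp (L s)))"
  have "Im (?y / exp (L s)) \<noteq> 0"
    using crossing_transverse [OF X] L(2) by simp
  then have \<sigma>: "\<sigma> = 1 \<or> \<sigma> = -1" "\<sigma> * Im (?y / exp (L s)) > 0"
    by (auto simp: \<sigma>_def sgn_if)
  have der: "(\<gamma> f has_vector_derivative ?y) (at t within S)" for S
    using t01 by (intro has_vector_derivative_at_within [OF edge_derivative(1) [OF ef(2)]]) simp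
  have "((\<lambda>u. (\<gamma> f (u + t) - \<gamma> f t) / of_real (u + t - t)) \<longlongrightarrow> ?y) (at_right 0)"
    by (rule difference_quotient_tendsto [OF der, of "{t<..}", unfolded filterlim_at_right_to_0 [of _ _ t]])
  then have right: "((\<lambda>u. (\<gamma> f (u + t) - \<gamma> f t) / of_real u) \<longlongrightarrow> ?y) (at_right 0)"
    by simp
  \<comment> \<open>From the left the parameter runs backwards: the direction of approach becomes
    \<open>- ?y\<close>, and with it the side \<sigma> changes sign.\<close>
  have "((\<lambda>u. (\<gamma> f (- (u + - t)) - \<gamma> f t) / of_real (- (u + - t) - t)) \<longlongrightarrow> ?y) (at_right 0)"
    by (rule difference_quotient_tendsto [OF der, of "{..<t}",
          unfolded filterlim_at_left_to_right [of _ _ t] filterlim_at_right_to_0 [of _ _ "- t"]])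
  from tendsto_minus [OF this] have left: "((\<lambda>u. (\<gamma> f (- (u + - t)) - \<gamma> f t) / of_real u) \<longlongrightarrow> - ?y) (at_right 0)"
    by simp
  define K where "K = \<i> * (\<gamma> e 0 - \<gamma> f t) * exp ((L 1 - L 0 + of_real (ln (1 - s) - ln s)) / 2)"
  have s': "0 < s" "s < 1"
    using s by auto
  have "((\<lambda>u. branch (\<gamma> e) (\<gamma> f (u + t))) \<longlongrightarrow> of_real \<sigma> * K) (at_right 0)"
    unfolding K_def by (rule branch_near_crossing(2) [OF L(1) L' right s' \<sigma>])
  then have lim_right: "((\<lambda>u. branch (\<gamma> e) (\<gamma> f u)) \<longlongrightarrow> of_real \<sigma> * K) (at_right t)"
    by (subst filterlim_at_right_to_0)
  have "((\<lambda>u. branch (\<gamma> e) (\<gamma> f (- (u + - t)))) \<longlongrightarrow> of_real (- \<sigma>) * K) (at_right 0)"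
    unfolding K_def by (rule branch_near_crossing(2) [OF L(1) L' left s']) (use \<sigma> in auto)
  then have lim_left: "((\<lambda>u. branch (\<gamma> e) (\<gamma> f u)) \<longlongrightarrow> - (of_real \<sigma> * K)) (at_left t)"
    by (subst filterlim_at_left_to_right, subst filterlim_at_right_to_0) simp
  have E: "(end_sqrt e f \<longlongrightarrow> end_sqrt e f t) (at t within S)" for S
    using end_sqrt(3) [OF ef(1,2) t01] unfolding isCont_def by (rule tendsto_within_subset) simp
  have nz: "end_sqrt e f t \<noteq> 0"
    by (rule end_sqrt(2) [OF ef(1,2) t01])
  show ?thesis
  proof (intro exI [of _ "of_real \<sigma> * K / end_sqrt e f t"] conjI)
    show "(rel_sign e f \<longlongrightarrow> of_real \<sigma> * K / end_sqrt e f t) (at_right t)"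
      unfolding rel_sign_def by (rule tendsto_divide [OF lim_right E nz])
    show "(rel_sign e f \<longlongrightarrow> - (of_real \<sigma> * K / end_sqrt e f t)) (at_left t)"
      unfolding rel_sign_def using tendsto_divide [OF lim_left E nz] by simp
  qed
qed

lemma rel_sign_ends:
  assumes ef: "e \<in> arcs G" "f \<in> arcs G" "e \<noteq> f"
  obtains c where "c \<in> {1, -1}" "\<forall>\<^sub>F t in at_right 0. rel_sign e f t = c"
    "\<forall>\<^sub>F t in at_left 1. rel_sign e f t = c * (-1) ^ card (hits e f)"
proof (rule sign_changes [of "hits e f" "rel_sign e f"])
  show "hits e f \<subseteq> {0<..<1}"
    by (auto simp: hits_def)
  show "rel_sign e f t \<in> {1, -1} \<and> isCont (rel_sign e f) t" if "t \<in> {0<..<1} - hits e f" for t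
    using that rel_sign [OF ef(1,2), of t] by (auto simp: hits_def)
qed (use finite_hits rel_sign_jump ef that in blast)+

text \<open>At the node itself \<open>rel_sign\<close> has no meaning if \<open>e\<close> ends
  there; the constant value close to the node is therefore extracted as a limit.\<close>

definition end_sign :: "'e \<Rightarrow> 'e edge_end \<Rightarrow> complex" where
  "end_sign e h = Lim (at_right 0) (\<lambda>s. rel_sign e (fst h) (along h s))"

lemma end_sign_eqI:
  assumes "\<forall>\<^sub>F s in at_right 0. rel_sign e (fst h) (along h s) = c"
  shows "end_sign e h = c"
  unfolding end_sign_def by (intro tendsto_Lim tendsto_eventually assms) simp

lemma eventually_at_left_1: "(\<forall>\<^sub>F t in at_left 1. P t) \<longleftrightarrow> (\<forall>\<^sub>F s in at_right 0. P (1 - s :: real))"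
  by (simp add: eventually_at_left_to_right eventually_at_right_to_0 [of _ "-1"])

lemma end_sign:
  assumes ef: "e \<in> arcs G" "fst h \<in> arcs G" "e \<noteq> fst h"
  shows "end_sign e h \<in> {1, -1}" "\<forall>\<^sub>F s in at_right 0. rel_sign e (fst h) (along h s) = end_sign e h"
    and "end_sign e h * end_sign e (opposite h) = (-1) ^ card (hits e (fst h))"
proof -
  obtain c where c: "c \<in> {1, -1}" "\<forall>\<^sub>F t in at_right 0. rel_sign e (fst h) t = c"
    "\<forall>\<^sub>F t in at_left 1. rel_sign e (fst h) t = c * (-1) ^ card (hits e (fst h))"
    using rel_sign_ends [OF ef] by blast
  have T: "\<forall>\<^sub>F s in at_right 0. rel_sign e (fst h) (along (fst h, Tail) s) = c"
    using c by simp
  have H: "\<forall>\<^sub>F s in at_right 0. rel_sign e (fst h) (along (fst h, Head) s) = c * (-1) ^ card (hits e (fst h))"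
    using c by (simp add: eventually_at_left_1)
  have eqs: "end_sign e (fst h, Tail) = c" "end_sign e (fst h, Head) = c * (-1) ^ card (hits e (fst h))"
    using T H by (auto intro!: end_sign_eqI)
  have h: "h = (fst h, Tail) \<or> h = (fst h, Head)"
    by (cases h rule: opposite.cases) auto
  have pm: "c * (-1) ^ n \<in> {1, -1}" for n
    using c(1) by (cases "even n") auto
  show "end_sign e h \<in> {1, -1}"
    using h eqs c(1) pm by metis
  show "\<forall>\<^sub>F s in at_right 0. rel_sign e (fst h) (along h s) = end_sign e h"
    using h eqs T H by metis
  have "end_sign e (fst h, Tail) * end_sign e (fst h, Head) = (-1) ^ card (hits e (fst h))"
    using c(1) eqs by auto
  moreover have "end_sign e h * end_sign e (opposite h) = end_sign e (fst h, Tail) * end_sign e (fst h, Head)"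
    by (cases h rule: opposite.cases) auto
  ultimately show "end_sign e h * end_sign e (opposite h) = (-1) ^ card (hits e (fst h))"
    by simp
qed

end

lemma UNIV_side: "(UNIV :: side set) = {Tail, Head}"
  using side.exhaust by auto

instance side :: finite
  by standard (simp add: UNIV_side)

section \<open>Systems of cycles as two-regular edge sets\<close>

context immersed_digraph
begin

definition ends_at :: "'e set \<Rightarrow> 'v \<Rightarrow> 'e edge_end set" where
  "ends_at C v = {h \<in> edge_ends G v. fst h \<in> C}"

definition nodes_of :: "'e set \<Rightarrow> 'v set" where
  "nodes_of C = {v \<in> verts G. ends_at C v \<noteq> {}}"

text \<open>A disjoint union of cycles is described by its degrees alone, so that color classes
  enter without being decomposed into single cycles.\<close>

definition two_regular :: "'e set \<Rightarrow> bool" where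
  "two_regular C \<longleftrightarrow> C \<subseteq> arcs G \<and> (\<forall>v\<in>verts G. ends_at C v = {} \<or> card (ends_at C v) = 2)"

lemma finite_edge_set: "C \<subseteq> arcs G \<Longrightarrow> finite C"
  using finite_arcs by (rule finite_subset [rotated])

lemma finite_nodes_of: "finite (nodes_of C)"
  by (simp add: nodes_of_def)

lemma ends_at_eq: "C \<subseteq> arcs G \<Longrightarrow> ends_at C v = {h \<in> C \<times> UNIV. end_node G h = v}"
  by (auto simp: ends_at_def edge_ends_def)

lemma prod_over_ends: "(\<Prod>h\<in>C \<times> UNIV. f h) = (\<Prod>e\<in>C. f (e, Tail) * f (e, Head))"
  for f :: "'e edge_end \<Rightarrow> 'c :: comm_monoid_mult"
  by (subst prod.cartesian_product' ) (simp add: UNIV_side)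

lemma prod_ends_by_node:
  fixes f :: "'e edge_end \<Rightarrow> 'c :: comm_monoid_mult"
  assumes "C \<subseteq> arcs G"
  shows "(\<Prod>h\<in>C \<times> UNIV. f h) = (\<Prod>v\<in>verts G. \<Prod>h\<in>ends_at C v. f h)"
  unfolding ends_at_eq [OF assms]
  by (rule prod.group [symmetric]) (use assms finite_edge_set node_in_verts in auto)

text \<open>Each node of the system carries two ends, hence the square. The set \<open>S\<close>
  makes it possible to leave out one node, as is required when the system is studied near that
  node.\<close>

lemma prod_nodes:
  fixes F :: "'v \<Rightarrow> 'c :: comm_monoid_mult"
  assumes "two_regular C" "S \<subseteq> verts G"
  shows "(\<Prod>h\<in>{h \<in> C \<times> UNIV. end_node G h \<in> S}. F (end_node G h)) = (\<Prod>v\<in>nodes_of C \<inter> S. (F v)\<^sup>2)"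
proof -
  have C: "C \<subseteq> arcs G"
    using assms by (simp add: two_regular_def)
  let ?H = "{h \<in> C \<times> UNIV. end_node G h \<in> S}"
  have "(\<Prod>h\<in>?H. F (end_node G h)) =
    (\<Prod>v\<in>nodes_of C \<inter> S. \<Prod>h\<in>{h \<in> ?H. end_node G h = v}. F (end_node G h))"
  proof (rule prod.group [symmetric])
    show "finite ?H"
      using finite_edge_set [OF C] by simp
    show "end_node G ` ?H \<subseteq> nodes_of C \<inter> S"
      using assms(2) by (auto simp: nodes_of_def ends_at_eq [OF C])
  qed (simp add: finite_nodes_of)
  also have "\<dots> = (\<Prod>v\<in>nodes_of C \<inter> S. (F v)\<^sup>2)"
  proof (rule prod.cong [OF refl])
    fix v assume v: "v \<in> nodes_of C \<inter> S"
    then have "{h \<in> ?H. end_node G h = v} = ends_at C v"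
      by (auto simp: ends_at_eq [OF C])
    moreover have "(\<Prod>h\<in>ends_at C v. F (end_node G h)) = (\<Prod>h\<in>ends_at C v. F v)"
      by (rule prod.cong) (auto simp: ends_at_eq [OF C])
    moreover have "card (ends_at C v) = 2"
      using v assms by (auto simp: two_regular_def nodes_of_def)
    ultimately show "(\<Prod>h\<in>{h \<in> ?H. end_node G h = v}. F (end_node G h)) = (F v)\<^sup>2"
      by simp
  qed
  finally show ?thesis .
qed

text \<open>The denominators of the \<open>rel_sign\<close> multiply to a polynomial in the moving
  point: every \<open>node_sqrt\<close> occurs exactly twice, so its arbitrary sign is squared
  away.\<close>

lemma prod_end_sqrt:
  assumes "two_regular C" "f \<in> arcs G" "t \<in> {0<..<1}"
  shows "(\<Prod>e\<in>C. end_sqrt e f t) = (\<Prod>v\<in>nodes_of C. p v - \<gamma> f t)"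
proof -
  have C: "C \<subseteq> arcs G"
    using assms by (simp add: two_regular_def)
  have "(\<Prod>e\<in>C. end_sqrt e f t) = (\<Prod>h\<in>C \<times> UNIV. node_sqrt (end_node G h) f t)"
    by (simp add: prod_over_ends end_sqrt_def)
  also have "C \<times> UNIV = {h \<in> C \<times> UNIV. end_node G h \<in> verts G}"
    using C node_in_verts by auto
  also have "(\<Prod>h\<in>\<dots>. node_sqrt (end_node G h) f t) = (\<Prod>v\<in>nodes_of C \<inter> verts G. (node_sqrt v f t)\<^sup>2)"
    by (rule prod_nodes [OF assms(1) order_refl])
  also have "\<dots> = (\<Prod>v\<in>nodes_of C. p v - \<gamma> f t)"
    by (rule prod.cong) (use assms in \<open>auto simp: nodes_of_def node_sqrt\<close>)
  finally show ?thesis .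
qed

text \<open>For an edge outside \<open>C\<close> this is the sign of the overview, read off close to
  the end \<open>h\<close>. For an edge of \<open>C\<close> its own factor is omitted, and the value
  then depends on the chosen square roots.\<close>

definition cycle_sign :: "'e set \<Rightarrow> 'e edge_end \<Rightarrow> complex" where
  "cycle_sign C h = (\<Prod>e\<in>C - {fst h}. end_sign e h)"

lemma cycle_sign_pm:
  assumes "C \<subseteq> arcs G" "fst h \<in> arcs G"
  shows "cycle_sign C h \<in> {1, -1}"
proof -
  have "(\<Prod>e\<in>A. end_sign e h) \<in> {1, -1}" if "finite A" "A \<subseteq> C - {fst h}" for A
    using that
  proof (induction A rule: finite_induct)
    case (insert e A)
    then have "end_sign e h \<in> {1, -1}"
      using assms by (intro end_sign) auto
    then show ?case
      using insert by auto
  qed simp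
  then show ?thesis
    using assms finite_edge_set by (simp add: cycle_sign_def)
qed

lemma eventually_cycle_sign:
  assumes "C \<subseteq> arcs G" "fst h \<in> arcs G"
  shows "\<forall>\<^sub>F s in at_right 0. s \<in> {0<..<1} \<and> cycle_sign C h =
    (\<Prod>e\<in>C - {fst h}. branch (\<gamma> e) (curve h s)) / (\<Prod>e\<in>C - {fst h}. end_sqrt e (fst h) (along h s))"
proof -
  have "\<forall>\<^sub>F s in at_right 0. \<forall>e\<in>C - {fst h}. rel_sign e (fst h) (along h s) = end_sign e h"
    using assms finite_edge_set by (intro eventually_ball_finite ballI end_sign) auto
  moreover have "\<forall>\<^sub>F s in at_right 0. s \<in> {0<..<1::real}"
    by (rule eventually_at_right_real) simp
  ultimately show ?thesis
  proof eventually_elim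
    case (elim s)
    then have "cycle_sign C h = (\<Prod>e\<in>C - {fst h}. rel_sign e (fst h) (along h s))"
      by (simp add: cycle_sign_def)
    then show ?case
      using elim by (simp add: rel_sign_def prod_dividef curve_def)
  qed
qed

lemma curve_tendsto: "fst h \<in> arcs G \<Longrightarrow> (curve h \<longlongrightarrow> p (end_node G h)) (at_right 0)"
  using has_vector_derivative_continuous [OF curve_derivative(1), of h] curve_0 [of h]
  unfolding isCont_def by (auto intro: tendsto_within_subset)

lemma node_not_on_other_edge:
  assumes "e \<in> arcs G" "v \<in> verts G" "(e, Tail) \<notin> edge_ends G v" "(e, Head) \<notin> edge_ends G v"
  shows "p v \<notin> path_image (\<gamma> e)"
  using node_on_edge assms by (auto simp: edge_ends_def)

lemma tendsto_branch_node:
  assumes "e \<in> arcs G" "fst h \<in> arcs G"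
    "(e, Tail) \<notin> edge_ends G (end_node G h)" "(e, Head) \<notin> edge_ends G (end_node G h)"
  shows "((\<lambda>s. branch (\<gamma> e) (curve h s)) \<longlongrightarrow> branch (\<gamma> e) (p (end_node G h))) (at_right 0)"
  using assms node_not_on_other_edge node_in_verts
  by (intro isCont_tendsto_compose [OF isCont_branch] path_edge curve_tendsto) auto

text \<open>The quotient extends continuously to \<open>p v\<close>, because no edge of
  \<open>C\<close> passes through that point and no node of \<open>C\<close> lies there. Hence all
  ends at \<open>v\<close> see one and the same sign, and the two ends of \<open>D\<close> at
  \<open>v\<close> contribute its square.\<close>

lemma cycle_sign_at_outer_node:
  assumes C: "two_regular C" and v: "v \<in> verts G" "ends_at C v = {}" and k: "k \<in> edge_ends G v"
  shows "cycle_sign C k = (\<Prod>e\<in>C. branch (\<gamma> e) (p v)) / (\<Prod>x\<in>nodes_of C. p x - p v)"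
proof -
  have CG: "C \<subseteq> arcs G" and kG: "fst k \<in> arcs G" "end_node G k = v"
    using C k by (auto simp: two_regular_def edge_ends_def)
  have "fst k \<notin> C"
  proof
    assume "fst k \<in> C"
    then have "k \<in> ends_at C v"
      using k by (simp add: ends_at_def)
    then show False
      using v by simp
  qed
  then have [simp]: "C - {fst k} = C"
    by simp
  have "\<forall>\<^sub>F s in at_right 0. (\<Prod>e\<in>C. branch (\<gamma> e) (curve k s)) / (\<Prod>x\<in>nodes_of C. p x - curve k s) = cycle_sign C k"
    using eventually_cycle_sign [OF CG kG(1)]
  proof eventually_elim
    case (elim s)
    then show ?case
      using prod_end_sqrt [OF C kG(1), of "along k s"] along_in(1) [of k s] by (simp add: curve_def)
  qed
  then have 1: "((\<lambda>s. (\<Prod>e\<in>C. branch (\<gamma> e) (curve k s)) / (\<Prod>x\<in>nodes_of C. p x - curve k s)) \<longlongrightarrow> cycle_sign C k) (at_right 0)"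
    by (rule tendsto_eventually)
  have "(\<Prod>x\<in>nodes_of C. p x - p v) \<noteq> 0"
    using v inj_onD [OF inj_p, of _ v] finite_nodes_of by (auto simp: nodes_of_def)
  moreover have "((\<lambda>s. branch (\<gamma> e) (curve k s)) \<longlongrightarrow> branch (\<gamma> e) (p v)) (at_right 0)" if "e \<in> C" for e
    using tendsto_branch_node [of e k] that v CG kG by (auto simp: ends_at_def)
  ultimately have "((\<lambda>s. (\<Prod>e\<in>C. branch (\<gamma> e) (curve k s)) / (\<Prod>x\<in>nodes_of C. p x - curve k s)) \<longlongrightarrow>
      (\<Prod>e\<in>C. branch (\<gamma> e) (p v)) / (\<Prod>x\<in>nodes_of C. p x - p v)) (at_right 0)"
    using curve_tendsto [OF kG(1)] kG(2) by (intro tendsto_intros) auto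
  from tendsto_unique [OF _ 1 this] show ?thesis
    by simp
qed

lemma prod_cycle_sign_outer_node:
  assumes C: "two_regular C" and D: "two_regular D" and v: "v \<in> verts G" "ends_at C v = {}"
  shows "(\<Prod>h\<in>ends_at D v. cycle_sign C h) = 1"
proof (cases "ends_at D v = {}")
  case False
  then obtain k where k: "k \<in> ends_at D v"
    by blast
  have "(\<Prod>h\<in>ends_at D v. cycle_sign C h) = (\<Prod>h\<in>ends_at D v. cycle_sign C k)"
    using cycle_sign_at_outer_node [OF C v] k by (intro prod.cong) (auto simp: ends_at_def)
  also have "\<dots> = (cycle_sign C k)\<^sup>2"
    using D v False by (auto simp: two_regular_def)
  also have "\<dots> = 1"
    using cycle_sign_pm [of C k] C k by (auto simp: two_regular_def ends_at_def edge_ends_def)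
  finally show ?thesis .
qed simp

lemma prod_hits_eq_prod_cycle_sign:
  assumes C: "C \<subseteq> arcs G" and D: "D \<subseteq> arcs G"
  shows "(\<Prod>e\<in>C. \<Prod>f\<in>D - {e}. (-1) ^ card (hits e f)) = (\<Prod>v\<in>verts G. \<Prod>h\<in>ends_at D v. cycle_sign C h)"
proof -
  have "(\<Prod>e\<in>C. \<Prod>f\<in>D - {e}. (-1) ^ card (hits e f)) = (\<Prod>e\<in>C. \<Prod>f\<in>{f \<in> D. f \<noteq> e}. (-1) ^ card (hits e f) :: complex)"
    by (intro prod.cong) auto
  also have "\<dots> = (\<Prod>f\<in>D. \<Prod>e\<in>{e \<in> C. f \<noteq> e}. (-1) ^ card (hits e f))"
    using C D finite_edge_set by (intro prod.swap_restrict) auto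
  also have "\<dots> = (\<Prod>f\<in>D. cycle_sign C (f, Tail) * cycle_sign C (f, Head))"
  proof (intro prod.cong refl)
    fix f assume f: "f \<in> D"
    have "end_sign e (f, Tail) * end_sign e (f, Head) = (-1) ^ card (hits e f)" if "e \<in> C" "f \<noteq> e" for e
      using that C D f end_sign(3) [of e "(f, Tail)"] by auto
    then have "(\<Prod>e\<in>{e \<in> C. f \<noteq> e}. (-1) ^ card (hits e f)) = (\<Prod>e\<in>C - {f}. end_sign e (f, Tail) * end_sign e (f, Head))"
      by (intro prod.cong) auto
    then show "(\<Prod>e\<in>{e \<in> C. f \<noteq> e}. (-1) ^ card (hits e f)) = cycle_sign C (f, Tail) * cycle_sign C (f, Head)"
      by (simp add: cycle_sign_def prod.distrib)
  qed
  also have "\<dots> = (\<Prod>v\<in>verts G. \<Prod>h\<in>ends_at D v. cycle_sign C h)"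
    unfolding prod_ends_by_node [OF D, symmetric] prod_over_ends ..
  finally show ?thesis .
qed

end

section \<open>Local analysis at a node shared by two systems of cycles\<close>

lemma exp_half_square: "(exp (x / 2))\<^sup>2 = exp (x :: complex)"
  using exp_double [of "x / 2"] by simp

lemma continuous_on_tendsto_0:
  fixes f :: "real \<Rightarrow> 'a :: topological_space"
  assumes "continuous_on {0..1} f"
  shows "(f \<longlongrightarrow> f 0) (at_right 0)"
proof -
  have "(f \<longlongrightarrow> f 0) (at 0 within {0..1})"
    using assms by (simp add: continuous_on)
  then show ?thesis
    by (simp add: at_within_Icc_at_right)
qed

context immersed_digraph
begin

text \<open>This is a logarithm of the secant quotient taken from the node, followed along the whole
  edge. Its value at 0 encodes the outward direction, its value at 1 the displacement to the other
  node, and continuity ties the two determinations together.\<close>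

definition end_log :: "'e edge_end \<Rightarrow> real \<Rightarrow> complex" where
  "end_log h = (SOME L. continuous_on {0..1} L \<and> exp (L 0) = outward_direction \<gamma> h \<and>
    (\<forall>s\<in>{0..1}. curve h s - p (end_node G h) = of_real s * exp (L s)))"

text \<open>At \<open>s = 1\<close> the secant quotient behind \<open>end_log\<close> is the
  difference of the two node positions, which would vanish for a loop.\<close>

definition loopless_end :: "'e edge_end \<Rightarrow> bool" where
  "loopless_end h \<longleftrightarrow> fst h \<in> arcs G \<and> end_node G h \<noteq> end_node G (opposite h)"

lemma loopless_end_opposite [simp]: "loopless_end (opposite h) \<longleftrightarrow> loopless_end h"
  by (auto simp: loopless_end_def)

lemma end_log:
  assumes "loopless_end h"
  shows "continuous_on {0..1} (end_log h)" "exp (end_log h 0) = outward_direction \<gamma> h"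
    and "\<And>s. s \<in> {0..1} \<Longrightarrow> curve h s - p (end_node G h) = of_real s * exp (end_log h s)"
    and "exp (end_log h 1) = p (end_node G (opposite h)) - p (end_node G h)"
proof -
  have hG: "fst h \<in> arcs G" and ne: "end_node G h \<noteq> end_node G (opposite h)"
    using assms by (auto simp: loopless_end_def)
  have "curve h s \<noteq> curve h 0" if s: "s \<in> {0..1}" "s \<noteq> 0" for s
  proof (cases "s = 1")
    case True
    have "p (end_node G (opposite h)) \<noteq> p (end_node G h)"
      using ne inj_onD [OF inj_p] hG node_in_verts [of h] node_in_verts [of "opposite h"] by fastforce
    then show ?thesis
      using True hG by (simp add: curve_0 curve_1)
  next
    case False
    then have "s \<in> {0<..<1}"
      using s by auto
    then have "curve h s \<noteq> p (end_node G h)"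
      using hG by (intro curve_avoids_nodes node_in_verts)
    then show ?thesis
      using hG by (simp add: curve_0)
  qed
  then have "\<exists>L. continuous_on {0..1} L \<and> exp (L 0) = outward_direction \<gamma> h \<and>
      (\<forall>s\<in>{0..1}. curve h s - curve h 0 = of_real (s - 0) * exp (L s))"
    using hG by (intro secant_logarithm continuous_curve curve_derivative) auto
  then have "\<exists>L. continuous_on {0..1} L \<and> exp (L 0) = outward_direction \<gamma> h \<and>
      (\<forall>s\<in>{0..1}. curve h s - p (end_node G h) = of_real s * exp (L s))"
    by (simp only: curve_0 [OF hG] diff_zero)
  from someI_ex [OF this] have *: "continuous_on {0..1} (end_log h) \<and> exp (end_log h 0) = outward_direction \<gamma> h \<and>
      (\<forall>s\<in>{0..1}. curve h s - p (end_node G h) = of_real s * exp (end_log h s))"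
    unfolding end_log_def .
  then show "continuous_on {0..1} (end_log h)" "exp (end_log h 0) = outward_direction \<gamma> h"
    and eq: "\<And>s. s \<in> {0..1} \<Longrightarrow> curve h s - p (end_node G h) = of_real s * exp (end_log h s)"
    by blast+
  show "exp (end_log h 1) = p (end_node G (opposite h)) - p (end_node G h)"
    using eq [of 1] hG by (simp add: curve_1)
qed

lemma continuous_end_log_minus:
  assumes "loopless_end h"
  shows "continuous_on {0..1} (\<lambda>s. end_log h (1 - s))"
  by (rule continuous_on_compose2 [OF end_log(1) [OF assms]]) (auto intro!: continuous_intros)

text \<open>
  \<open>end_coeff h\<close> is the constant in \<open>branch e (v + s * y) \<sim> end_coeff h * csqrt (- y / d) * sqrt s\<close>, where \<open>d\<close> is
  the outward direction of the end \<open>h\<close> of \<open>e\<close> at \<open>v\<close>; \<open>end_limit h\<close> below is its analogue for \<open>end_sqrt\<close>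
  along \<open>h\<close> itself.  Only the products over the two ends of an edge are canonical, and these agree.
\<close>

definition end_coeff :: "'e edge_end \<Rightarrow> complex" where
  "end_coeff h = exp ((end_log h 0 + end_log h 1) / 2)"

lemma end_coeff_square:
  assumes "loopless_end h"
  shows "(end_coeff h)\<^sup>2 = outward_direction \<gamma> h * (p (end_node G (opposite h)) - p (end_node G h))"
  unfolding end_coeff_def exp_half_square exp_add end_log [OF assms] ..

lemma end_coeff_nonzero: "end_coeff h \<noteq> 0"
  by (simp add: end_coeff_def)

lemma curve_quotient_tendsto:
  assumes "fst k \<in> arcs G"
  shows "((\<lambda>s. (curve k s - p (end_node G k)) / of_real s) \<longlongrightarrow> outward_direction \<gamma> k) (at_right 0)"
  using difference_quotient_tendsto [OF has_vector_derivative_at_within [OF curve_derivative(1) [OF assms]], of "{0<..}"]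
  by (simp add: curve_0 assms)

text \<open>The end \<open>k\<close> approaches the node in the direction
  \<open>outward_direction \<gamma> k\<close>, which plays the role of \<open>y\<close> in
  \<open>branch_near_end\<close>; distinctness of the directions at a node supplies the condition on
  it.\<close>

lemma branch_along_other_end:
  assumes h: "loopless_end h" "h \<in> edge_ends G v" and k: "k \<in> edge_ends G v" "h \<noteq> k"
  shows "((\<lambda>s. branch (\<gamma> (fst h)) (curve k s) / of_real (sqrt s)) \<longlongrightarrow>
    end_coeff h * csqrt (- outward_direction \<gamma> k / outward_direction \<gamma> h)) (at_right 0)"
proof -
  have hv: "fst h \<in> arcs G" "end_node G h = v" "fst k \<in> arcs G" "end_node G k = v"
    using h k by (auto simp: edge_ends_def)
  note L = end_log [OF h(1)]
  have "- outward_direction \<gamma> k / exp (end_log h 0) \<notin> \<real>\<^sub>\<le>\<^sub>0"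
    using directions_distinct [OF h(2) k] by (simp add: L(2) complex_nonpos_Reals_iff complex_nonneg_Reals_iff)
  note nonpos = this
  have L3: "\<And>s. s \<in> {0..1} \<Longrightarrow> curve h s - p v = of_real s * exp (end_log h s)"
    using L(3) by (simp only: hv)
  note quot = curve_quotient_tendsto [OF hv(3), unfolded hv(4)]
  have 1: "\<forall>\<^sub>F s in at_right 0. curve k s \<notin> path_image (curve h)"
    by (rule branch_near_end(1) [OF L(1) L3 quot nonpos])
  have 2: "((\<lambda>s. branch (curve h) (curve k s) / of_real (sqrt s)) \<longlongrightarrow>
      exp ((end_log h 0 + end_log h 1) / 2) * csqrt (- outward_direction \<gamma> k / exp (end_log h 0))) (at_right 0)"
    by (rule branch_near_end(2) [OF L(1) L3 quot nonpos])
  have "\<forall>\<^sub>F s in at_right 0. branch (curve h) (curve k s) / of_real (sqrt s) = branch (\<gamma> (fst h)) (curve k s) / of_real (sqrt s)"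
    using 1 by eventually_elim (simp add: branch_curve hv path_image_curve)
  from Lim_transform_eventually [OF 2 this] show ?thesis
    unfolding L(2) end_coeff_def .
qed

definition end_limit :: "'e edge_end \<Rightarrow> complex" where
  "end_limit h = Lim (at_right 0) (\<lambda>s. end_sqrt (fst h) (fst h) (along h s) / of_real (sqrt s))"

text \<open>Both \<open>end_sqrt m m\<close> and the explicit function \<open>S\<close> are
  continuous square roots of the same zero-free function on the open edge, so they differ by one
  sign \<epsilon>. The point is that the same \<epsilon> serves both ends and thus cancels in
  products over them.\<close>

lemma end_limit_aux:
  assumes m: "loopless_end (m, Tail)"
  obtains \<epsilon> where "\<epsilon> \<in> {1, -1}" "\<And>h. fst h = m \<Longrightarrow>
    ((\<lambda>s. end_sqrt m m (along h s) / of_real (sqrt s)) \<longlongrightarrow> \<epsilon> * exp ((end_log h 0 + end_log (opposite h) 1) / 2)) (at_right 0)"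
proof -
  define S where "S h s = of_real (sqrt s * sqrt (1 - s)) * exp ((end_log h s + end_log (opposite h) (1 - s)) / 2)"
    for h :: "'e edge_end" and s
  have mG: "m \<in> arcs G"
    using m by (simp add: loopless_end_def)
  have S_along: "S (m, Tail) (along h s) = S h s" if "fst h = m" for h s
    using that by (cases h rule: opposite.cases) (auto simp: S_def add.commute mult.commute)
  note T = end_log [OF m]
  have mH: "loopless_end (m, Head)"
    using m loopless_end_opposite [of "(m, Tail)"] by simp
  note H = end_log [OF mH]
  have sq: "(S (m, Tail) t)\<^sup>2 = (p (tail G m) - \<gamma> m t) * (p (head G m) - \<gamma> m t)" if t: "t \<in> {0<..<1}" for t
  proof -
    have "complex_of_real (sqrt t * sqrt (1 - t)) ^ 2 = of_real t * of_real (1 - t)"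
    proof -
      have "(sqrt t * sqrt (1 - t))\<^sup>2 = t * (1 - t)"
        using t by (simp add: power_mult_distrib)
      then show ?thesis
        by (simp only: flip: of_real_power of_real_mult)
    qed
    moreover have "exp ((end_log (m, Tail) t + end_log (m, Head) (1 - t)) / 2) ^ 2 =
        exp (end_log (m, Tail) t) * exp (end_log (m, Head) (1 - t))"
      by (simp only: exp_half_square exp_add)
    moreover have "\<gamma> m t - p (tail G m) = of_real t * exp (end_log (m, Tail) t)"
      using T(3) [of t] t by (simp add: curve_def)
    moreover have "\<gamma> m t - p (head G m) = of_real (1 - t) * exp (end_log (m, Head) (1 - t))"
      using H(3) [of "1 - t"] t by (simp add: curve_def)
    ultimately have "(S (m, Tail) t)\<^sup>2 = (\<gamma> m t - p (tail G m)) * (\<gamma> m t - p (head G m))"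
      by (simp only: S_def power_mult_distrib opposite.simps mult_ac)
    then show ?thesis
      by (simp add: algebra_simps)
  qed
  have cont: "continuous_on {0..1} (S h)" if "fst h = m" for h
  proof -
    have "loopless_end h"
      using that m mH by (cases h rule: opposite.cases) auto
    then show ?thesis
      unfolding S_def by (intro continuous_intros end_log(1) continuous_end_log_minus) auto
  qed
  \<comment> \<open>With an empty set of jumps the constants near the two ends coincide.\<close>
  have "\<exists>c. c \<in> {1, -1} \<and> (\<forall>\<^sub>F t in at_right 0. end_sqrt m m t / S (m, Tail) t = c) \<and>
    (\<forall>\<^sub>F t in at_left 1. end_sqrt m m t / S (m, Tail) t = c * (-1) ^ card ({} :: real set))"
  proof (rule sign_changes [of "{}" "\<lambda>t. end_sqrt m m t / S (m, Tail) t"])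
    fix t :: real
    assume "t \<in> {0<..<1} - {}"
    then have t: "t \<in> {0<..<1}"
      by simp
    have nz: "S (m, Tail) t \<noteq> 0"
      using t by (simp add: S_def)
    have "(end_sqrt m m t)\<^sup>2 = (S (m, Tail) t)\<^sup>2"
      unfolding end_sqrt(1) [OF mG mG t] sq [OF t] ..
    then have "(end_sqrt m m t / S (m, Tail) t)\<^sup>2 = 1"
      using nz by (simp add: power_divide)
    moreover have "isCont (S (m, Tail)) t"
      using cont [of "(m, Tail)"] t by (intro continuous_on_interior [of "{0..1}"]) auto
    then have "isCont (\<lambda>t. end_sqrt m m t / S (m, Tail) t) t"
      using end_sqrt(3) [OF mG mG t] nz by (intro continuous_intros)
    ultimately show "end_sqrt m m t / S (m, Tail) t \<in> {1, -1} \<and> isCont (\<lambda>t. end_sqrt m m t / S (m, Tail) t) t"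
      by (simp add: power2_eq_1_iff)
  qed auto
  then obtain c where c: "c \<in> {1, -1}" "\<forall>\<^sub>F t in at_right 0. end_sqrt m m t / S (m, Tail) t = c"
    "\<forall>\<^sub>F t in at_left 1. end_sqrt m m t / S (m, Tail) t = c"
    by auto
  show ?thesis
  proof (rule that [OF c(1)])
    fix h :: "'e edge_end"
    assume h: "fst h = m"
    have "\<forall>\<^sub>F s in at_right 0. end_sqrt m m (along h s) / S (m, Tail) (along h s) = c"
      using h c(2,3) by (cases h rule: opposite.cases) (auto simp: eventually_at_left_1)
    moreover have "\<forall>\<^sub>F s in at_right 0. s \<in> {0<..<1::real}"
      by (rule eventually_at_right_real) simp
    ultimately have ev: "\<forall>\<^sub>F s in at_right 0. c * (of_real (sqrt (1 - s)) * exp ((end_log h s + end_log (opposite h) (1 - s)) / 2)) =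
        end_sqrt m m (along h s) / of_real (sqrt s)"
    proof eventually_elim
      case (elim s)
      have "S h s \<noteq> 0"
        using elim by (simp add: S_def)
      then have "end_sqrt m m (along h s) = c * S h s"
        using elim by (simp add: S_along h field_simps)
      then show ?case
        using elim by (simp add: S_def)
    qed
    have ll: "loopless_end h"
      using h m mH by (cases h rule: opposite.cases) auto
    have 1: "(end_log h \<longlongrightarrow> end_log h 0) (at_right 0)"
      by (rule continuous_on_tendsto_0 [OF end_log(1) [OF ll]])
    have 2: "((\<lambda>s. end_log (opposite h) (1 - s)) \<longlongrightarrow> end_log (opposite h) 1) (at_right 0)"
      using continuous_on_tendsto_0 [OF continuous_end_log_minus [of "opposite h"]] ll by simp
    have "((\<lambda>s. c * (of_real (sqrt (1 - s)) * exp ((end_log h s + end_log (opposite h) (1 - s)) / 2))) \<longlongrightarrow>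
       c * (of_real (sqrt (1 - 0)) * exp ((end_log h 0 + end_log (opposite h) 1) / 2))) (at_right 0)"
      by (intro tendsto_intros 1 2) auto
    from Lim_transform_eventually [OF this ev]
    show "((\<lambda>s. end_sqrt m m (along h s) / of_real (sqrt s)) \<longlongrightarrow> c * exp ((end_log h 0 + end_log (opposite h) 1) / 2)) (at_right 0)"
      by simp
  qed
qed

text \<open>In the second claim both sides are the exponential of half the sum of the same four
  logarithms, grouped differently; the sign \<epsilon> enters squared.\<close>

lemma end_limit:
  assumes "loopless_end h"
  shows "((\<lambda>s. end_sqrt (fst h) (fst h) (along h s) / of_real (sqrt s)) \<longlongrightarrow> end_limit h) (at_right 0)"
    and "end_limit h * end_limit (opposite h) = end_coeff h * end_coeff (opposite h)"
proof -
  have "loopless_end (fst h, Tail)"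
    using assms loopless_end_opposite [of h] by (cases h rule: opposite.cases) auto
  then obtain \<epsilon> where \<epsilon>: "\<epsilon> \<in> {1, -1}" and lim: "\<And>k. fst k = fst h \<Longrightarrow>
    ((\<lambda>s. end_sqrt (fst h) (fst h) (along k s) / of_real (sqrt s)) \<longlongrightarrow> \<epsilon> * exp ((end_log k 0 + end_log (opposite k) 1) / 2)) (at_right 0)"
    by (rule end_limit_aux) auto
  have eq: "end_limit k = \<epsilon> * exp ((end_log k 0 + end_log (opposite k) 1) / 2)" if "fst k = fst h" for k
    unfolding end_limit_def using lim [OF that] that by (intro tendsto_Lim) auto
  show "((\<lambda>s. end_sqrt (fst h) (fst h) (along h s) / of_real (sqrt s)) \<longlongrightarrow> end_limit h) (at_right 0)"
    using lim [of h] by (simp add: eq)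
  have "end_limit h * end_limit (opposite h) =
    exp ((end_log h 0 + end_log (opposite h) 1) / 2 + (end_log (opposite h) 0 + end_log h 1) / 2)"
    using \<epsilon> eq [of h] eq [of "opposite h"] by (auto simp: exp_add)
  also have "\<dots> = end_coeff h * end_coeff (opposite h)"
    unfolding end_coeff_def exp_add [symmetric] by (rule arg_cong [of _ _ exp]) (simp add: field_simps)
  finally show "end_limit h * end_limit (opposite h) = end_coeff h * end_coeff (opposite h)" .
qed

text \<open>Exactly two edges of \<open>C\<close> are singular at \<open>v\<close>, those of
  \<open>h\<close> and \<open>a\<close>; all others are collected in \<open>R\<close>, which is
  continuous there. Along \<open>b\<close> both singular branches have order \<open>sqrt s\<close>.
  Along \<open>h\<close> the branch of its own edge is omitted, and \<open>end_sqrt\<close> of this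
  edge along itself takes its place. In both cases the node \<open>v\<close> contributes a
  denominator of order \<open>s\<close>, so finite limits exist, and their product is simplified by
  \<open>csqrt_cyclic\<close>.\<close>

lemma cycle_sign_at_shared_node:
  assumes C: "two_regular C" and D: "two_regular D" and loopless: "\<And>k. fst k \<in> C \<Longrightarrow> loopless_end k"
    and v: "v \<in> verts G" and Cv: "ends_at C v = {h, a}" and Dv: "ends_at D v = {h, b}"
    and ne: "h \<noteq> a" "h \<noteq> b" "a \<noteq> b"
  shows "cycle_sign C h * cycle_sign C b =
    - \<i> * (if turn \<gamma> h b < turn \<gamma> h a then -1 else 1) * end_limit h / end_coeff h"
proof -
  have CG: "C \<subseteq> arcs G" and DG: "D \<subseteq> arcs G"
    using C D by (auto simp: two_regular_def)
  have "h \<in> ends_at C v" "a \<in> ends_at C v" "b \<in> ends_at D v"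
    using Cv Dv by auto
  then have in_C: "fst h \<in> C" "fst a \<in> C" "fst b \<in> D" and ends: "h \<in> edge_ends G v" "a \<in> edge_ends G v" "b \<in> edge_ends G v"
    by (auto simp: ends_at_def)
  then have node: "end_node G h = v" "end_node G a = v" "end_node G b = v"
    and arcs: "fst h \<in> arcs G" "fst a \<in> arcs G" "fst b \<in> arcs G"
    by (auto simp: edge_ends_def)
  have "fst b \<notin> C"
  proof
    assume "fst b \<in> C"
    then have "b \<in> ends_at C v"
      using ends by (simp add: ends_at_def)
    then show False
      using Cv ne by auto
  qed
  have lh: "loopless_end h" and la: "loopless_end a"
    using in_C loopless by auto
  have ha: "fst h \<noteq> fst a"
    using edge_end_eq_or_opposite [of h a] ne lh la node by (auto simp: loopless_end_def)
  let ?m = "fst h" and ?a = "fst a"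
  define C' where "C' = C - {?m, ?a}"
  define N where "N = nodes_of C - {v}"
  have fin: "finite C" "finite C'" "finite N"
    using CG finite_edge_set finite_nodes_of by (auto simp: C'_def N_def)
  have C_eq: "C = insert ?m (insert ?a C')" and Cm_eq: "C - {?m} = insert ?a C'"
    using in_C ha by (auto simp: C'_def)
  have notin: "?m \<notin> insert ?a C'" "?a \<notin> C'"
    using ha by (auto simp: C'_def)
  have prod_C: "(\<Prod>e\<in>C. f e) = f ?m * (f ?a * (\<Prod>e\<in>C'. f e))" for f :: "'e \<Rightarrow> complex"
    by (subst C_eq) (use fin notin in simp)
  have v_node: "v \<in> nodes_of C"
    using v Cv by (simp add: nodes_of_def)
  have N_eq: "nodes_of C = insert v N" and vN: "v \<notin> N"
    using v_node by (auto simp: N_def)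
  define R where "R z = (\<Prod>e\<in>C'. branch (\<gamma> e) z) / (\<Prod>x\<in>N. p x - z)" for z
  have N_nz: "(\<Prod>x\<in>N. p x - p v) \<noteq> 0"
    using v inj_onD [OF inj_p, of _ v] fin by (auto simp: N_def nodes_of_def)
  have no_end: "(e, s) \<notin> edge_ends G v" if "e \<in> C'" for e s
  proof
    assume "(e, s) \<in> edge_ends G v"
    then have "(e, s) \<in> ends_at C v"
      using that by (simp add: ends_at_def C'_def)
    then show False
      using that Cv by (auto simp: C'_def)
  qed
  have R_lim: "((\<lambda>s. R (curve k s)) \<longlongrightarrow> R (p v)) (at_right 0)" if k: "k \<in> edge_ends G v" for k
  proof -
    have kv: "fst k \<in> arcs G" "end_node G k = v"
      using k by (auto simp: edge_ends_def)
    have "((\<lambda>s. branch (\<gamma> e) (curve k s)) \<longlongrightarrow> branch (\<gamma> e) (p v)) (at_right 0)" if "e \<in> C'" for e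
      using tendsto_branch_node [of e k] no_end [OF that] that CG kv by (auto simp: C'_def)
    then show ?thesis
      unfolding R_def using curve_tendsto [OF kv(1)] kv(2) N_nz by (intro tendsto_intros) auto
  qed
  let ?d = "outward_direction \<gamma>"
  define c1 c2 c3 where "c1 = csqrt (- ?d b / ?d h)" and "c2 = csqrt (- ?d b / ?d a)" and "c3 = csqrt (- ?d h / ?d a)"
  have d_nz: "?d h \<noteq> 0" "?d a \<noteq> 0" "?d b \<noteq> 0"
    using curve_derivative(2) arcs by auto
  have quot: "((\<lambda>s. (p v - curve k s) / of_real s) \<longlongrightarrow> - ?d k) (at_right 0)" if "k \<in> edge_ends G v" for k
  proof -
    have "(p v - curve k s) / of_real s = - ((curve k s - p v) / of_real s)" for s
      by (simp only: minus_divide_left minus_diff_eq)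
    then show ?thesis
      using tendsto_minus [OF curve_quotient_tendsto [of k]] that by (simp only: edge_ends_def mem_Collect_eq)
  qed
  have Cb: "C - {fst b} = C"
    using \<open>fst b \<notin> C\<close> by simp
  have s_eq: "complex_of_real s = of_real (sqrt s) * of_real (sqrt s)" if "s \<in> {0<..<1}" for s
    using that by (simp flip: of_real_mult)
  have frac: "r * m * a / (d * n) = r / n * (m / q) * (a / q) / (d / (q * q))" if "q \<noteq> 0" for r m a d n q :: complex
    using that by (simp add: mult_ac)
  have 1: "\<forall>\<^sub>F s in at_right 0. R (curve b s) * (branch (\<gamma> ?m) (curve b s) / of_real (sqrt s)) *
      (branch (\<gamma> ?a) (curve b s) / of_real (sqrt s)) / ((p v - curve b s) / of_real s) = cycle_sign C b"
    using eventually_cycle_sign [OF CG arcs(3)]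
  proof eventually_elim
    case (elim s)
    then have s: "s \<in> {0<..<1}" and q: "complex_of_real (sqrt s) \<noteq> 0"
      by simp_all
    have "cycle_sign C b = (\<Prod>e\<in>C. branch (\<gamma> e) (curve b s)) / (\<Prod>x\<in>nodes_of C. p x - curve b s)"
      using elim prod_end_sqrt [OF C arcs(3), of "along b s"] along_in(1) [of b s] by (simp add: curve_def Cb)
    also have "\<dots> = (\<Prod>e\<in>C'. branch (\<gamma> e) (curve b s)) * branch (\<gamma> ?m) (curve b s) * branch (\<gamma> ?a) (curve b s) /
        ((p v - curve b s) * (\<Prod>x\<in>N. p x - curve b s))"
      unfolding prod_C N_eq using fin vN by (simp add: mult_ac)
    finally show ?case
      unfolding R_def s_eq [OF s] by (simp only: frac [OF q])
  qed
  have 2: "\<forall>\<^sub>F s in at_right 0. R (curve h s) * (branch (\<gamma> ?a) (curve h s) / of_real (sqrt s)) *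
      (end_sqrt ?m ?m (along h s) / of_real (sqrt s)) / ((p v - curve h s) / of_real s) = cycle_sign C h"
    using eventually_cycle_sign [OF CG arcs(1)]
  proof eventually_elim
    case (elim s)
    then have s: "s \<in> {0<..<1}" and s': "along h s \<in> {0<..<1}" and q: "complex_of_real (sqrt s) \<noteq> 0"
      using along_in(1) [of h s] by simp_all
    \<comment> \<open>Leaving out the factor of \<open>?m\<close> divides the product over the nodes
      by \<open>end_sqrt ?m ?m\<close>, which therefore reappears in the numerator of the
      sign.\<close>
    have "(\<Prod>e\<in>C - {?m}. end_sqrt e ?m (along h s)) = (\<Prod>x\<in>nodes_of C. p x - curve h s) / end_sqrt ?m ?m (along h s)"
      using prod_end_sqrt [OF C arcs(1) s'] end_sqrt(2) [OF arcs(1) arcs(1) s'] prod.remove [OF fin(1) in_C(1), of "\<lambda>e. end_sqrt e ?m (along h s)"]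
      by (simp add: curve_def field_simps)
    then have "cycle_sign C h = (\<Prod>e\<in>C - {?m}. branch (\<gamma> e) (curve h s)) * end_sqrt ?m ?m (along h s) / (\<Prod>x\<in>nodes_of C. p x - curve h s)"
      using elim by simp
    also have "\<dots> = (\<Prod>e\<in>C'. branch (\<gamma> e) (curve h s)) * branch (\<gamma> ?a) (curve h s) * end_sqrt ?m ?m (along h s) /
        ((p v - curve h s) * (\<Prod>x\<in>N. p x - curve h s))"
      unfolding Cm_eq N_eq using fin notin vN by (simp add: mult_ac)
    finally show ?case
      unfolding R_def s_eq [OF s] by (simp only: frac [OF q])
  qed
  have b_eq: "cycle_sign C b = R (p v) * (end_coeff h * c1) * (end_coeff a * c2) / (- ?d b)"
  proof (rule tendsto_unique [OF _ tendsto_eventually [OF 1]])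
    show "((\<lambda>s. R (curve b s) * (branch (\<gamma> ?m) (curve b s) / of_real (sqrt s)) *
      (branch (\<gamma> ?a) (curve b s) / of_real (sqrt s)) / ((p v - curve b s) / of_real s)) \<longlongrightarrow>
      R (p v) * (end_coeff h * c1) * (end_coeff a * c2) / (- ?d b)) (at_right 0)"
      unfolding c1_def c2_def using ne ends lh la d_nz
      by (intro tendsto_divide tendsto_mult R_lim branch_along_other_end [of _ v] quot) auto
  qed simp
  have h_eq: "cycle_sign C h = R (p v) * (end_coeff a * c3) * end_limit h / (- ?d h)"
  proof (rule tendsto_unique [OF _ tendsto_eventually [OF 2]])
    show "((\<lambda>s. R (curve h s) * (branch (\<gamma> ?a) (curve h s) / of_real (sqrt s)) *
      (end_sqrt ?m ?m (along h s) / of_real (sqrt s)) / ((p v - curve h s) / of_real s)) \<longlongrightarrow>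
      R (p v) * (end_coeff a * c3) * end_limit h / (- ?d h)) (at_right 0)"
      unfolding c3_def using ne ends lh la d_nz
      by (intro tendsto_divide tendsto_mult R_lim branch_along_other_end [of _ v] quot end_limit) auto
  qed simp
  let ?w = "p (end_node G (opposite h)) - p v" and ?a1 = "p (end_node G (opposite a)) - p v"
  \<comment> \<open>The ends of \<open>C\<close> away from \<open>v\<close> are the ends of
    \<open>C'\<close> and the far ends of the edges of \<open>h\<close> and \<open>a\<close>. The
    product of their displacements from \<open>p v\<close> is a square, node by node; the square of
    \<open>R (p v)\<close> lacks precisely the two far ends.\<close>
  have R2: "(R (p v))\<^sup>2 * ?w * ?a1 = 1"
  proof -
    define F where "F k = p (end_node G k) - p v" for k
    have "{k \<in> C \<times> UNIV. end_node G k \<in> verts G - {v}} = insert (opposite h) (insert (opposite a) (C' \<times> UNIV))" (is "?A = ?B")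
    proof
      show "?A \<subseteq> ?B"
      proof
        fix k
        assume k: "k \<in> ?A"
        then have "fst k \<in> C"
          by (simp add: mem_Times_iff)
        then consider "fst k = fst h" | "fst k = fst a" | "fst k \<in> C'"
          unfolding C'_def by blast
        then show "k \<in> ?B"
          using k node edge_end_eq_or_opposite [of k h] edge_end_eq_or_opposite [of k a]
          by cases (auto simp: mem_Times_iff)
      qed
      have "end_node G k \<noteq> v" if "k \<in> C' \<times> UNIV" for k
        using that no_end [of "fst k" "snd k"] CG by (auto simp: edge_ends_def C'_def)
      moreover have "end_node G k \<in> verts G" if "fst k \<in> C" for k
        using that CG node_in_verts by blast
      ultimately show "?B \<subseteq> ?A"
        using lh la node in_C unfolding loopless_end_def by (auto simp: C'_def mem_Times_iff)
    qed
    then have "(\<Prod>k\<in>insert (opposite h) (insert (opposite a) (C' \<times> UNIV)). F k) = (\<Prod>x\<in>nodes_of C \<inter> (verts G - {v}). (p x - p v)\<^sup>2)"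
      using prod_nodes [OF C, of "verts G - {v}" "\<lambda>x. p x - p v"] by (simp add: F_def)
    also have "nodes_of C \<inter> (verts G - {v}) = N"
      by (auto simp: N_def nodes_of_def)
    also have "(\<Prod>k\<in>insert (opposite h) (insert (opposite a) (C' \<times> UNIV)). F k) = F (opposite h) * (F (opposite a) * (\<Prod>k\<in>C' \<times> UNIV. F k))"
    proof -
      have "opposite h \<notin> insert (opposite a) (C' \<times> UNIV)" "opposite a \<notin> C' \<times> UNIV"
        using notin ha by (auto simp: mem_Times_iff) (metis fst_opposite)
      then show ?thesis
        using fin by simp
    qed
    finally have prod_F: "F (opposite h) * (F (opposite a) * (\<Prod>k\<in>C' \<times> UNIV. F k)) = (\<Prod>x\<in>N. p x - p v)\<^sup>2"
      by (simp add: prod_power_distrib)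
    have "(\<Prod>e\<in>C'. branch (\<gamma> e) (p v))\<^sup>2 = (\<Prod>e\<in>C'. F (e, Tail) * F (e, Head))"
      unfolding prod_power_distrib
    proof (rule prod.cong [OF refl])
      fix e
      assume e: "e \<in> C'"
      then have "e \<in> arcs G"
        using CG by (auto simp: C'_def)
      moreover have "p v \<notin> path_image (\<gamma> e)"
        using no_end e \<open>e \<in> arcs G\<close> v by (intro node_not_on_other_edge) auto
      ultimately show "(branch (\<gamma> e) (p v))\<^sup>2 = F (e, Tail) * F (e, Head)"
        by (simp add: F_def branch_square path_edge pathstart_def pathfinish_def edge_ends_at)
    qed
    then have "(R (p v))\<^sup>2 = (\<Prod>k\<in>C' \<times> UNIV. F k) / (\<Prod>x\<in>N. p x - p v)\<^sup>2"
      by (simp add: R_def power_divide prod_over_ends)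
    then have "(R (p v))\<^sup>2 * F (opposite h) * F (opposite a) =
        F (opposite h) * (F (opposite a) * (\<Prod>k\<in>C' \<times> UNIV. F k)) / (\<Prod>x\<in>N. p x - p v)\<^sup>2"
      by simp
    then show ?thesis
      using N_nz unfolding prod_F by (simp add: F_def)
  qed
  have h2: "(end_coeff h)\<^sup>2 = ?d h * ?w" and a2: "(end_coeff a)\<^sup>2 = ?d a * ?a1"
    using end_coeff_square lh la node by auto
  have arg: "c1 * c2 * c3 * (?d a / ?d b) = - \<i> * (if turn \<gamma> h b < turn \<gamma> h a then -1 else 1)"
  proof -
    have zero: "Arg2pi z \<noteq> 0" if "z \<notin> \<real>\<^sub>\<ge>\<^sub>0" for z
    proof
      assume "Arg2pi z = 0"
      then have "z = of_real (cmod z)"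
        using Arg2pi_eq [of z] by simp
      then show False
        using that by (metis nonneg_Reals_of_real_iff norm_ge_zero)
    qed
    have "Arg2pi (?d a / ?d h) \<noteq> Arg2pi (?d b / ?d h)"
      using turn_neq [OF arcs(1) ends(2,3) ne(3)] unfolding turn_def .
    moreover have "Arg2pi (?d a / ?d h) \<noteq> 0" "Arg2pi (?d b / ?d h) \<noteq> 0"
      using directions_distinct ends ne zero by auto
    ultimately show ?thesis
      unfolding c1_def c2_def c3_def turn_def using d_nz by (intro csqrt_cyclic)
  qed
  \<comment> \<open>\<open>end_coeff a\<close> enters through its square only, whereas one factor
    \<open>end_coeff h\<close> remains against \<open>end_limit h\<close> until the other end of the
    edge is taken into account.\<close>
  have "cycle_sign C h * cycle_sign C b =
     ((R (p v))\<^sup>2 * ?w * ?a1) * (c1 * c2 * c3 * (?d a / ?d b)) * end_limit h / end_coeff h"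
  proof -
    have w: "?w = end_coeff h * end_coeff h / ?d h"
      using h2 d_nz by (simp add: power2_eq_square)
    have "cycle_sign C h * cycle_sign C b =
        (R (p v))\<^sup>2 * (end_coeff a)\<^sup>2 * end_coeff h * c1 * c2 * c3 * end_limit h / (?d h * ?d b)"
      unfolding b_eq h_eq by (simp add: power2_eq_square mult_ac)
    also have "\<dots> = ((R (p v))\<^sup>2 * ?w * ?a1) * (c1 * c2 * c3 * (?d a / ?d b)) * end_limit h / end_coeff h"
      unfolding a2 w using end_coeff_nonzero [of h] by (simp add: mult_ac)
    finally show ?thesis .
  qed
  then show ?thesis
    unfolding R2 arg by simp
qed

text \<open>The hypotheses \<open>shared\<close> and \<open>meet\<close> say that every common node
  of the two systems is an end of a shared edge, and that the systems part from each other there.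
  The product over nodes thus becomes a product over the ends of shared edges.\<close>

proposition crossing_parity:
  fixes \<alpha> \<beta> :: "'e edge_end \<Rightarrow> 'e edge_end"
  defines "\<tau> \<equiv> \<lambda>h. if turn \<gamma> h (\<beta> h) < turn \<gamma> h (\<alpha> h) then -1 else 1 :: complex"
  assumes C: "two_regular C" and D: "two_regular D" and loopless: "\<And>k. fst k \<in> C \<Longrightarrow> loopless_end k"
    and shared: "\<And>h. fst h \<in> C \<inter> D \<Longrightarrow> ends_at C (end_node G h) = {h, \<alpha> h} \<and> ends_at D (end_node G h) = {h, \<beta> h} \<and>
      h \<noteq> \<alpha> h \<and> h \<noteq> \<beta> h \<and> \<alpha> h \<noteq> \<beta> h"
    and meet: "\<And>v. v \<in> verts G \<Longrightarrow> ends_at C v \<noteq> {} \<Longrightarrow> ends_at D v \<noteq> {} \<Longrightarrow> \<exists>h. fst h \<in> C \<inter> D \<and> end_node G h = v"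
  shows "(\<Prod>e\<in>C. \<Prod>f\<in>D - {e}. (-1) ^ card (hits e f)) = (\<Prod>m\<in>C \<inter> D. - (\<tau> (m, Tail) * \<tau> (m, Head)))"
proof -
  have CG: "C \<subseteq> arcs G" and DG: "D \<subseteq> arcs G"
    using C D by (auto simp: two_regular_def)
  let ?H = "(C \<inter> D) \<times> (UNIV :: side set)"
  let ?f = "\<lambda>v. \<Prod>h\<in>ends_at D v. cycle_sign C h"
  \<comment> \<open>If two different shared ends lay at one node, the second one would be both
    \<open>\<alpha> h\<close> and \<open>\<beta> h\<close>.\<close>
  have inj: "inj_on (end_node G) ?H"
  proof (rule inj_onI)
    fix h k
    assume hk: "h \<in> ?H" "k \<in> ?H" "end_node G h = end_node G k"
    then have "fst h \<in> C \<inter> D" "fst k \<in> C \<inter> D"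
      by auto
    from shared [OF this(1)] shared [OF this(2)] hk(3) show "h = k"
      by (metis doubleton_eq_iff)
  qed
  have "(\<Prod>e\<in>C. \<Prod>f\<in>D - {e}. (-1) ^ card (hits e f)) = (\<Prod>v\<in>verts G. ?f v)"
    by (rule prod_hits_eq_prod_cycle_sign [OF CG DG])
  also have "\<dots> = (\<Prod>v\<in>end_node G ` ?H. ?f v)"
  proof (rule prod.mono_neutral_right [OF finite_verts])
    show "end_node G ` ?H \<subseteq> verts G"
      using CG node_in_verts by auto
    show "\<forall>v\<in>verts G - end_node G ` ?H. ?f v = 1"
    proof
      fix v
      assume v: "v \<in> verts G - end_node G ` ?H"
      then have "\<not> (\<exists>h. fst h \<in> C \<inter> D \<and> end_node G h = v)"
        by (auto simp: image_iff)
      then have "ends_at C v = {} \<or> ends_at D v = {}"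
        using meet v by blast
      then show "?f v = 1"
        using prod_cycle_sign_outer_node [OF C D] v by auto
    qed
  qed
  also have "\<dots> = (\<Prod>h\<in>?H. ?f (end_node G h))"
    using inj by (simp add: prod.reindex)
  also have "\<dots> = (\<Prod>h\<in>?H. - \<i> * \<tau> h * end_limit h / end_coeff h)"
  proof (rule prod.cong [OF refl])
    fix h assume "h \<in> ?H"
    then have h: "fst h \<in> C \<inter> D"
      by auto
    note * = shared [OF h]
    have "?f (end_node G h) = cycle_sign C h * cycle_sign C (\<beta> h)"
      using * by simp
    also have "\<dots> = - \<i> * \<tau> h * end_limit h / end_coeff h"
      unfolding \<tau>_def using * h CG by (intro cycle_sign_at_shared_node [OF C D loopless]) (auto intro: node_in_verts)
    finally show "?f (end_node G h) = - \<i> * \<tau> h * end_limit h / end_coeff h" .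
  qed
  also have "\<dots> = (\<Prod>m\<in>C \<inter> D. - (\<tau> (m, Tail) * \<tau> (m, Head)))"
    unfolding prod_over_ends
  proof (rule prod.cong [OF refl])
    fix m assume "m \<in> C \<inter> D"
    then have m: "loopless_end (m, Tail)"
      by (intro loopless) simp
    have "end_limit (m, Tail) * end_limit (m, Head) / (end_coeff (m, Tail) * end_coeff (m, Head)) = 1"
      using end_limit(2) [OF m] end_coeff_nonzero [of "(m, Tail)"] end_coeff_nonzero [of "(m, Head)"] by simp
    moreover have "- \<i> * \<tau> (m, Tail) * end_limit (m, Tail) / end_coeff (m, Tail) * (- \<i> * \<tau> (m, Head) * end_limit (m, Head) / end_coeff (m, Head)) =
      - (\<tau> (m, Tail) * \<tau> (m, Head)) * (end_limit (m, Tail) * end_limit (m, Head) / (end_coeff (m, Tail) * end_coeff (m, Head)))"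
      by (simp add: mult_ac)
    ultimately show "- \<i> * \<tau> (m, Tail) * end_limit (m, Tail) / end_coeff (m, Tail) * (- \<i> * \<tau> (m, Head) * end_limit (m, Head) / end_coeff (m, Head)) =
      - (\<tau> (m, Tail) * \<tau> (m, Head))"
      by (simp only: mult_1_right)
  qed
  finally show ?thesis .
qed

end

section \<open>States and edge colorings\<close>

lemma card_Collect_bij_betw:
  assumes "bij_betw f A B" "\<And>x. x \<in> A \<Longrightarrow> P x \<longleftrightarrow> Q (f x)"
  shows "card {x \<in> A. P x} = card {y \<in> B. Q y}"
proof -
  have "bij_betw f {x \<in> A. P x} {y \<in> B. Q y}"
    using assms unfolding bij_betw_def by (auto intro: inj_on_subset)
  then show ?thesis
    by (rule bij_betw_same_card)
qed

lemma quotient_class_eq: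
  assumes "sym r" "(x, y) \<in> r\<^sup>*"
  shows "r\<^sup>* `` {x} = r\<^sup>* `` {y}"
proof -
  have "(y, x) \<in> r\<^sup>*"
    using assms sym_rtrancl by (metis symD)
  then show ?thesis
    using assms(2) by (auto intro: rtrancl_trans)
qed

lemma quotient_class_subset:
  assumes "r \<subseteq> A \<times> A" "x \<in> A"
  shows "r\<^sup>* `` {x} \<subseteq> A"
proof
  fix y
  assume "y \<in> r\<^sup>* `` {x}"
  then have "(x, y) \<in> r\<^sup>*"
    by simp
  then show "y \<in> A"
    using assms by (induction rule: rtrancl_induct) auto
qed

lemma quotient_class_unique:
  assumes "sym r" "L \<in> A // r\<^sup>*" "x \<in> L"
  shows "L = r\<^sup>* `` {x}"
  using assms quotient_class_eq [OF assms(1)] by (auto elim!: quotientE)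

text \<open>For a symmetric \<open>r\<close>, a function constant along \<open>r\<close> is constant
  on the classes of the reflexive transitive closure, by induction along chains. The inverse map
  evaluates such a function at chosen representatives.\<close>

lemma bij_betw_quotient_colorings:
  assumes r: "r \<subseteq> A \<times> A" "sym r"
  shows "bij_betw (\<lambda>\<kappa>. \<lambda>x\<in>A. \<kappa> (r\<^sup>* `` {x})) (A // r\<^sup>* \<rightarrow>\<^sub>E B) {\<phi> \<in> A \<rightarrow>\<^sub>E B. \<forall>(x, y)\<in>r. \<phi> x = \<phi> y}"
proof (rule bij_betwI)
  let ?rep = "\<lambda>L. SOME x. x \<in> L"
  let ?g = "\<lambda>\<phi>. \<lambda>L\<in>A // r\<^sup>*. \<phi> (?rep L)"
  have rep: "?rep L \<in> L" "?rep L \<in> A" "r\<^sup>* `` {?rep L} = L" if "L \<in> A // r\<^sup>*" for L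
  proof -
    have "\<exists>x\<in>A. L = r\<^sup>* `` {x}"
      using that unfolding quotient_def by blast
    then obtain x where x: "x \<in> A" "L = r\<^sup>* `` {x}"
      by blast
    then have "x \<in> L"
      by simp
    then show "?rep L \<in> L"
      by (rule someI)
    then show "?rep L \<in> A"
      using quotient_class_subset [OF r(1) x(1)] x(2) by blast
    show "r\<^sup>* `` {?rep L} = L"
      using quotient_class_unique [OF r(2) that \<open>?rep L \<in> L\<close>] by simp
  qed
  show "(\<lambda>\<kappa>. \<lambda>x\<in>A. \<kappa> (r\<^sup>* `` {x})) \<in> (A // r\<^sup>* \<rightarrow>\<^sub>E B) \<rightarrow> {\<phi> \<in> A \<rightarrow>\<^sub>E B. \<forall>(x, y)\<in>r. \<phi> x = \<phi> y}"
  proof (intro Pi_I CollectI conjI ballI PiE_I)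
    fix \<kappa> z
    assume \<kappa>: "\<kappa> \<in> A // r\<^sup>* \<rightarrow>\<^sub>E B" and z: "z \<in> r"
    obtain x y where xy: "z = (x, y)"
      by (cases z)
    then have "x \<in> A" "y \<in> A" "r\<^sup>* `` {x} = r\<^sup>* `` {y}"
      using r z quotient_class_eq [OF r(2), of x y] by auto
    then show "case z of (x, y) \<Rightarrow> (\<lambda>x\<in>A. \<kappa> (r\<^sup>* `` {x})) x = (\<lambda>x\<in>A. \<kappa> (r\<^sup>* `` {x})) y"
      using xy by simp
  qed (auto simp: PiE_iff intro: quotientI)
  show "?g \<in> {\<phi> \<in> A \<rightarrow>\<^sub>E B. \<forall>(x, y)\<in>r. \<phi> x = \<phi> y} \<rightarrow> (A // r\<^sup>* \<rightarrow>\<^sub>E B)"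
    using rep by (auto simp: PiE_iff)
  show "?g (\<lambda>x\<in>A. \<kappa> (r\<^sup>* `` {x})) = \<kappa>" if "\<kappa> \<in> A // r\<^sup>* \<rightarrow>\<^sub>E B" for \<kappa>
  proof
    fix L
    show "?g (\<lambda>x\<in>A. \<kappa> (r\<^sup>* `` {x})) L = \<kappa> L"
      using that rep [of L] by (cases "L \<in> A // r\<^sup>*") (auto simp: PiE_iff extensional_def)
  qed
  show "(\<lambda>x\<in>A. ?g \<phi> (r\<^sup>* `` {x})) = \<phi>" if \<phi>: "\<phi> \<in> {\<phi> \<in> A \<rightarrow>\<^sub>E B. \<forall>(x, y)\<in>r. \<phi> x = \<phi> y}" for \<phi>
  proof
    fix x
    show "(\<lambda>x\<in>A. ?g \<phi> (r\<^sup>* `` {x})) x = \<phi> x"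
    proof (cases "x \<in> A")
      case True
      then have L: "r\<^sup>* `` {x} \<in> A // r\<^sup>*"
        by (rule quotientI)
      have "\<phi> y = \<phi> x" if "(x, y) \<in> r\<^sup>*" for y
        using that by (induction rule: rtrancl_induct) (use \<phi> in auto)
      moreover have "(x, ?rep (r\<^sup>* `` {x})) \<in> r\<^sup>*"
        using rep(1) [OF L] by simp
      ultimately have "\<phi> (?rep (r\<^sup>* `` {x})) = \<phi> x"
        by blast
      then show ?thesis
        using True L by simp
    qed (use \<phi> in \<open>auto simp: PiE_iff extensional_def\<close>)
  qed
qed

text \<open>Turns a power whose exponent is a number of loops or complexes into a count of colorings
  subject to local conditions; only in this form can the sums over all choices be interchanged and
  factored.\<close>

lemma power_card_quotient:
  assumes "finite A" "r \<subseteq> A \<times> A" "sym r"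
  shows "n ^ card (A // r\<^sup>*) = card {\<phi> \<in> A \<rightarrow>\<^sub>E {1..n::nat}. \<forall>(x, y)\<in>r. \<phi> x = \<phi> y}"
proof -
  have "A // r\<^sup>* = (\<lambda>x. r\<^sup>* `` {x}) ` A"
    by (auto simp: quotient_def)
  then have "finite (A // r\<^sup>*)"
    using assms(1) by simp
  then have "card (A // r\<^sup>* \<rightarrow>\<^sub>E {1..n}) = n ^ card (A // r\<^sup>*)"
    by (simp add: card_PiE)
  then show ?thesis
    using bij_betw_same_card [OF bij_betw_quotient_colorings [OF assms(2,3)]] by metis
qed

text \<open>An arc takes the color of the edge at its tail-side end. Both replacements at a matching
  edge have the same tail-side ends, so these colors do not depend on the state.\<close>

fun strand_color :: "('e \<Rightarrow> nat) \<Rightarrow> 'e strand \<Rightarrow> nat" where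
  "strand_color c (Edge e) = c e"
| "strand_color c (Along m q) = c (fst (fst q))"

locale matched_immersion = immersed_digraph G p \<gamma>
  for G :: "('v, 'e) pre_digraph" and p \<gamma> +
  fixes M :: "'e set"
  assumes trivalent: "trivalent G" and matching: "perfect_matching G M"
begin

lemma M_arcs: "M \<subseteq> arcs G"
  and M_loopless: "\<forall>m\<in>M. tail G m \<noteq> head G m"
  and M_disjoint: "\<forall>m\<in>M. \<forall>m'\<in>M. m \<noteq> m' \<longrightarrow> {tail G m, head G m} \<inter> {tail G m', head G m'} = {}"
  and M_covers: "\<forall>v\<in>verts G. \<exists>m\<in>M. v \<in> {tail G m, head G m}"
  using matching unfolding perfect_matching_def by - (elim conjE, assumption)+

lemma finite_M: "finite M"
  using M_arcs finite_arcs by (rule finite_subset)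

lemma finite_edge_ends: "finite (edge_ends G v)"
proof (rule finite_subset)
  show "edge_ends G v \<subseteq> arcs G \<times> UNIV"
    by (auto simp: edge_ends_def)
qed simp

lemma matching_end:
  assumes "v \<in> verts G"
  obtains h where "fst h \<in> M" "end_node G h = v"
proof -
  obtain m where m: "m \<in> M" "v = tail G m \<or> v = head G m"
    using M_covers assms by auto
  then have "end_node G (m, Tail) = v \<or> end_node G (m, Head) = v"
    by auto
  then show ?thesis
    using m that by (metis fst_conv)
qed

lemma matching_end_unique:
  assumes "fst h \<in> M" "fst k \<in> M" "end_node G h = end_node G k"
  shows "h = k"
proof -
  have "fst h = fst k"
  proof (rule ccontr)
    assume "fst h \<noteq> fst k"
    then have "{tail G (fst h), head G (fst h)} \<inter> {tail G (fst k), head G (fst k)} = {}"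
      using M_disjoint assms by blast
    then show False
      using assms(3) by (cases h rule: opposite.cases; cases k rule: opposite.cases) auto
  qed
  then have "h = k \<or> h = opposite k"
    by (rule edge_end_eq_or_opposite)
  moreover have "h \<noteq> opposite k"
    using assms M_loopless by (cases k rule: opposite.cases) force+
  ultimately show ?thesis
    by blast
qed

lemma edge_ends_matching_end:
  assumes "fst h \<in> M"
  shows "edge_ends G (end_node G h) = insert h (free_ends G M (end_node G h))"
proof
  have "h \<in> edge_ends G (end_node G h)"
    using assms M_arcs by (auto simp: edge_ends_def)
  then show "insert h (free_ends G M (end_node G h)) \<subseteq> edge_ends G (end_node G h)"
    by (auto simp: free_ends_def)
  show "edge_ends G (end_node G h) \<subseteq> insert h (free_ends G M (end_node G h))"
    using assms matching_end_unique [of _ h] by (auto simp: free_ends_def edge_ends_def)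
qed

lemma free_endsD:
  assumes "x \<in> free_ends G M v"
  shows "fst x \<in> arcs G - M" "end_node G x = v" "x \<in> edge_ends G v"
  using assms by (auto simp: free_ends_def edge_ends_def)

lemma card_free_ends:
  assumes "v \<in> verts G"
  shows "card (free_ends G M v) = 2"
proof -
  obtain h where h: "fst h \<in> M" "end_node G h = v"
    using matching_end [OF assms] .
  have "h \<notin> free_ends G M v"
    using h by (simp add: free_ends_def)
  moreover have "edge_ends G v = insert h (free_ends G M v)"
    using edge_ends_matching_end [OF h(1)] h(2) by simp
  moreover have "finite (free_ends G M v)"
    using finite_edge_ends [of v] by (simp add: free_ends_def)
  moreover have "card (edge_ends G v) = 3"
    using trivalent assms by (simp add: trivalent_def)
  ultimately show ?thesis
    by simp
qed

lemma M_nodes: "m \<in> M \<Longrightarrow> tail G m \<in> verts G" "m \<in> M \<Longrightarrow> head G m \<in> verts G"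
  using M_arcs by auto

definition state :: "('e \<Rightarrow> 'e replacement) \<Rightarrow> bool" where
  "state R \<longleftrightarrow> R \<in> (\<Pi>\<^sub>E m\<in>M. replacements G M m)"

lemma state_ends:
  assumes "state R" "m \<in> M" "q \<in> R m"
  shows "fst q \<in> free_ends G M (tail G m)" "snd q \<in> free_ends G M (head G m)"
    "fst (fst q) \<in> arcs G - M" "fst (snd q) \<in> arcs G - M"
proof -
  have "R m \<in> replacements G M m"
    using assms by (auto simp: state_def)
  then show "fst q \<in> free_ends G M (tail G m)" "snd q \<in> free_ends G M (head G m)"
    using assms(3) by (auto simp: replacements_def)
  then show "fst (fst q) \<in> arcs G - M" "fst (snd q) \<in> arcs G - M"
    using free_endsD(1) by blast+
qed

lemma state_bij:
  assumes "state R" "m \<in> M"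
  shows "bij_betw fst (R m) (free_ends G M (tail G m))"
proof -
  obtain a b c d where "a \<noteq> b" "c \<noteq> d" "free_ends G M (tail G m) = {a, b}" "R m = {(a, c), (b, d)}"
    using assms by (auto simp: state_def replacements_def PiE_iff) (metis)
  then show ?thesis
    by (simp add: bij_betw_def)
qed

lemma finite_strands:
  assumes "state R"
  shows "finite (strands G M R)"
proof -
  have "{Along m q | m q. m \<in> M \<and> q \<in> R m} = (\<Union>m\<in>M. Along m ` R m)"
    by auto
  moreover have "finite (R m)" if "m \<in> M" for m
    using bij_betw_finite [OF state_bij [OF assms that]] finite_edge_ends [of "tail G m"] by (simp add: free_ends_def)
  ultimately show ?thesis
    using finite_M by (simp add: strands_def)
qed

section \<open>From colorings of loops and complexes to colorings of non-matching edges\<close>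

abbreviation joined :: "('e \<Rightarrow> 'e replacement) \<Rightarrow> ('e strand \<times> 'e strand) set" where
  "joined R \<equiv> {(s, t). s \<in> strands G M R \<and> t \<in> strands G M R \<and> (attached s t \<or> attached t s)}"

definition strand_colorings :: "('e \<Rightarrow> 'e replacement) \<Rightarrow> nat \<Rightarrow> ('e strand \<Rightarrow> nat) set" where
  "strand_colorings R n = {\<phi> \<in> strands G M R \<rightarrow>\<^sub>E {1..n}. \<forall>(s, t)\<in>joined R. \<phi> s = \<phi> t}"

definition edge_colorings :: "nat \<Rightarrow> ('e \<Rightarrow> nat) set" where
  "edge_colorings n = (arcs G - M) \<rightarrow>\<^sub>E {1..n}"

definition compatible :: "('e \<Rightarrow> nat) \<Rightarrow> 'e replacement \<Rightarrow> bool" where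
  "compatible c Q \<longleftrightarrow> (\<forall>(x, y)\<in>Q. c (fst x) = c (fst y))"

lemma bij_betw_loops:
  "bij_betw (\<lambda>\<kappa>. \<lambda>s\<in>strands G M R. \<kappa> ((joined R)\<^sup>* `` {s})) (loops G M R \<rightarrow>\<^sub>E {1..n}) (strand_colorings R n)"
  unfolding loops_def strand_colorings_def
  by (rule bij_betw_quotient_colorings) (auto simp: sym_def)

lemma attached_iff: "attached s t \<longleftrightarrow> (\<exists>m q e. s = Along m q \<and> t = Edge e \<and> (e = fst (fst q) \<or> e = fst (snd q)))"
  by (cases "(s, t)" rule: attached.cases) auto

text \<open>Every arc is joined to the non-matching edges at its two ends, so a coloring constant
  along \<open>joined R\<close> is determined by its values on these edges. Conversely, such values
  extend to the arcs exactly when each arc has equal colors at its two ends.\<close>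

lemma bij_betw_edge_colorings:
  assumes R: "state R"
  shows "bij_betw (\<lambda>c. \<lambda>s\<in>strands G M R. strand_color c s)
    {c \<in> edge_colorings n. \<forall>m\<in>M. compatible c (R m)} (strand_colorings R n)"
proof (rule bij_betwI)
  let ?g = "\<lambda>\<phi>. \<lambda>e\<in>arcs G - M. \<phi> (Edge e)"
  have edge: "Edge e \<in> strands G M R \<longleftrightarrow> e \<in> arcs G - M" for e
    by (auto simp: strands_def)
  have al: "Along m q \<in> strands G M R \<longleftrightarrow> m \<in> M \<and> q \<in> R m" for m q
    unfolding strands_def by blast
  show "(\<lambda>c. \<lambda>s\<in>strands G M R. strand_color c s) \<in> {c \<in> edge_colorings n. \<forall>m\<in>M. compatible c (R m)} \<rightarrow> strand_colorings R n"
  proof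
    fix c
    assume c: "c \<in> {c \<in> edge_colorings n. \<forall>m\<in>M. compatible c (R m)}"
    have range: "strand_color c s \<in> {1..n}" if "s \<in> strands G M R" for s
      using that c state_ends(3) [OF R] by (cases s) (auto simp: edge al edge_colorings_def PiE_iff)
    have eq: "strand_color c s = strand_color c t" if s: "s \<in> strands G M R" and att: "attached s t" for s t
    proof -
      obtain m q e where st: "s = Along m q" "t = Edge e" "e = fst (fst q) \<or> e = fst (snd q)"
        using att unfolding attached_iff by blast
      then have "compatible c (R m)" "q \<in> R m"
        using c s al by auto
      then have "c (fst (fst q)) = c (fst (snd q))"
        by (auto simp: compatible_def)
      then show ?thesis
        using st by auto
    qed
    have "(\<lambda>s\<in>strands G M R. strand_color c s) \<in> strands G M R \<rightarrow>\<^sub>E {1..n}"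
      using range by (simp add: PiE_iff)
    moreover have "(\<lambda>s\<in>strands G M R. strand_color c s) s = (\<lambda>s\<in>strands G M R. strand_color c s) t"
      if "(s, t) \<in> joined R" for s t
    proof -
      have st: "s \<in> strands G M R" "t \<in> strands G M R" "attached s t \<or> attached t s"
        using that by blast+
      then have "strand_color c s = strand_color c t"
        using eq [of s t] eq [of t s] by argo
      then show ?thesis
        using st by simp
    qed
    ultimately show "(\<lambda>s\<in>strands G M R. strand_color c s) \<in> strand_colorings R n"
      unfolding strand_colorings_def by blast
  qed
  have att: "\<phi> (Along m q) = \<phi> (Edge (fst (fst q)))" "\<phi> (Along m q) = \<phi> (Edge (fst (snd q)))"
    if "\<phi> \<in> strand_colorings R n" "m \<in> M" "q \<in> R m" for \<phi> m q
  proof -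
    have "(Along m q, Edge (fst (fst q))) \<in> joined R" "(Along m q, Edge (fst (snd q))) \<in> joined R"
    proof -
      have "attached (Along m q) (Edge (fst (fst q)))" "attached (Along m q) (Edge (fst (snd q)))"
        unfolding attached_iff by blast+
      moreover have "Along m q \<in> strands G M R" "Edge (fst (fst q)) \<in> strands G M R" "Edge (fst (snd q)) \<in> strands G M R"
        using that(2,3) state_ends(3,4) [OF R that(2,3)] edge al by blast+
      ultimately show "(Along m q, Edge (fst (fst q))) \<in> joined R" "(Along m q, Edge (fst (snd q))) \<in> joined R"
        by blast+
    qed
    then show "\<phi> (Along m q) = \<phi> (Edge (fst (fst q)))" "\<phi> (Along m q) = \<phi> (Edge (fst (snd q)))"
      using that(1) unfolding strand_colorings_def by blast+
  qed
  show "?g \<in> strand_colorings R n \<rightarrow> {c \<in> edge_colorings n. \<forall>m\<in>M. compatible c (R m)}"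
  proof
    fix \<phi>
    assume \<phi>: "\<phi> \<in> strand_colorings R n"
    have "?g \<phi> \<in> edge_colorings n"
      using \<phi> edge by (auto simp: strand_colorings_def edge_colorings_def PiE_iff)
    moreover have "compatible (?g \<phi>) (R m)" if m: "m \<in> M" for m
      unfolding compatible_def
    proof clarify
      fix x y
      assume q: "(x, y) \<in> R m"
      show "?g \<phi> (fst x) = ?g \<phi> (fst y)"
        using state_ends(3,4) [OF R m q] att [OF \<phi> m q] by simp
    qed
    ultimately show "?g \<phi> \<in> {c \<in> edge_colorings n. \<forall>m\<in>M. compatible c (R m)}"
      by simp
  qed
  show "?g (\<lambda>s\<in>strands G M R. strand_color c s) = c" if "c \<in> {c \<in> edge_colorings n. \<forall>m\<in>M. compatible c (R m)}" for c
  proof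
    fix e
    show "?g (\<lambda>s\<in>strands G M R. strand_color c s) e = c e"
      using that by (cases "e \<in> arcs G - M") (auto simp: edge edge_colorings_def PiE_iff extensional_def)
  qed
  show "(\<lambda>s\<in>strands G M R. strand_color (?g \<phi>) s) = \<phi>" if \<phi>: "\<phi> \<in> strand_colorings R n" for \<phi>
  proof
    fix s
    show "(\<lambda>s\<in>strands G M R. strand_color (?g \<phi>) s) s = \<phi> s"
    proof (cases "s \<in> strands G M R")
      case True
      then show ?thesis
        using att [OF \<phi>] state_ends(3) [OF R] edge al by (cases s) auto
    next
      case False
      then show ?thesis
        using \<phi> by (auto simp: strand_colorings_def PiE_iff extensional_def)
    qed
  qed
qed

lemma loop_containing:
  assumes "L \<in> loops G M R" "s \<in> L"
  shows "L = (joined R)\<^sup>* `` {s}" "s \<in> strands G M R"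
proof -
  have "sym (joined R)"
    by (auto simp: sym_def)
  then show "L = (joined R)\<^sup>* `` {s}"
    using assms unfolding loops_def by (rule quotient_class_unique)
  have "\<exists>t\<in>strands G M R. L = (joined R)\<^sup>* `` {t}"
    using assms(1) unfolding loops_def quotient_def by blast
  then obtain t where t: "t \<in> strands G M R" "L = (joined R)\<^sup>* `` {t}"
    by blast
  have "joined R \<subseteq> strands G M R \<times> strands G M R"
    by auto
  then have "L \<subseteq> strands G M R"
    unfolding t(2) by (rule quotient_class_subset) (rule t(1))
  then show "s \<in> strands G M R"
    using assms(2) by blast
qed

lemma loop_of_strand: "s \<in> strands G M R \<Longrightarrow> (joined R)\<^sup>* `` {s} \<in> loops G M R"
  unfolding loops_def by (rule quotientI)

text \<open>Colors are transported from loops to strands and from strands to edges. A marker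
  condition on loops becomes one on two strands because each strand lies in a unique loop.\<close>

lemma card_loop_colorings:
  assumes R: "state R"
  shows "card (loop_colorings G M R n) = card {c \<in> edge_colorings n. (\<forall>m\<in>M. compatible c (R m)) \<and>
    (\<forall>m\<in>M. \<forall>q\<in>R m. \<forall>r\<in>R m. q \<noteq> r \<longrightarrow> c (fst (fst q)) \<noteq> c (fst (fst r)))}"
proof -
  let ?f = "\<lambda>\<kappa>. \<lambda>s\<in>strands G M R. \<kappa> ((joined R)\<^sup>* `` {s})"
  let ?Q = "\<lambda>\<phi>. \<forall>m\<in>M. \<forall>q\<in>R m. \<forall>r\<in>R m. q \<noteq> r \<longrightarrow> \<phi> (Along m q) \<noteq> \<phi> (Along m r)"
  have al: "Along m q \<in> strands G M R \<longleftrightarrow> m \<in> M \<and> q \<in> R m" for m q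
    unfolding strands_def by blast
  have cond: "(\<forall>A\<in>loops G M R. \<forall>B\<in>loops G M R. Along m q \<in> A \<longrightarrow> Along m r \<in> B \<longrightarrow> \<kappa> A \<noteq> \<kappa> B) \<longleftrightarrow>
      ?f \<kappa> (Along m q) \<noteq> ?f \<kappa> (Along m r)" if "m \<in> M" "q \<in> R m" "r \<in> R m" for \<kappa> m q r
  proof -
    have s: "Along m q \<in> strands G M R" "Along m r \<in> strands G M R"
      using that al by auto
    let ?A = "(joined R)\<^sup>* `` {Along m q}" and ?B = "(joined R)\<^sup>* `` {Along m r}"
    show ?thesis
    proof
      assume *: "\<forall>A\<in>loops G M R. \<forall>B\<in>loops G M R. Along m q \<in> A \<longrightarrow> Along m r \<in> B \<longrightarrow> \<kappa> A \<noteq> \<kappa> B"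
      have "Along m q \<in> ?A" "Along m r \<in> ?B"
        by auto
      then have "\<kappa> ?A \<noteq> \<kappa> ?B"
        using * loop_of_strand [OF s(1)] loop_of_strand [OF s(2)] by blast
      then show "?f \<kappa> (Along m q) \<noteq> ?f \<kappa> (Along m r)"
        using s by simp
    next
      assume *: "?f \<kappa> (Along m q) \<noteq> ?f \<kappa> (Along m r)"
      show "\<forall>A\<in>loops G M R. \<forall>B\<in>loops G M R. Along m q \<in> A \<longrightarrow> Along m r \<in> B \<longrightarrow> \<kappa> A \<noteq> \<kappa> B"
      proof (intro ballI impI)
        fix A B
        assume "A \<in> loops G M R" "B \<in> loops G M R" "Along m q \<in> A" "Along m r \<in> B"
        then have "A = ?A" "B = ?B"
          using loop_containing(1) by blast+
        then show "\<kappa> A \<noteq> \<kappa> B"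
          using * s by simp
      qed
    qed
  qed
  have "card (loop_colorings G M R n) = card {\<phi> \<in> strand_colorings R n. ?Q \<phi>}"
    unfolding loop_colorings_def
    by (intro card_Collect_bij_betw [OF bij_betw_loops] ball_cong refl imp_cong cond)
  also have "\<dots> = card {c \<in> {c \<in> edge_colorings n. \<forall>m\<in>M. compatible c (R m)}.
      \<forall>m\<in>M. \<forall>q\<in>R m. \<forall>r\<in>R m. q \<noteq> r \<longrightarrow> c (fst (fst q)) \<noteq> c (fst (fst r))}"
    by (intro card_Collect_bij_betw [OF bij_betw_edge_colorings [OF R], symmetric]) (simp add: al)
  finally show ?thesis
    by (simp add: conj_assoc)
qed

definition unicolored :: "('e \<Rightarrow> nat) \<Rightarrow> ('e strand \<times> real) set \<Rightarrow> bool" where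
  "unicolored c X \<longleftrightarrow> (\<forall>x\<in>X. \<forall>y\<in>X. strand_color c (fst x) = strand_color c (fst y))"

lemma unicolored_pair: "unicolored c {(a, s), (b, t)} \<longleftrightarrow> strand_color c a = strand_color c b"
proof
  assume "unicolored c {(a, s), (b, t)}"
  then have "strand_color c (fst (a, s)) = strand_color c (fst (b, t))"
    unfolding unicolored_def by blast
  then show "strand_color c a = strand_color c b"
    by simp
qed (auto simp: unicolored_def)

text \<open>A dotted crossing only forces the loops of its two strands to have equal colors. The
  closure that defines complexes thereby dissolves into independent conditions on the elements of
  \<open>D\<close>.\<close>

lemma power_card_complexes:
  assumes R: "state R" and D: "D \<subseteq> boxed_crossings G M \<gamma> R"
  shows "n ^ card (complexes G M R D) = card {c \<in> edge_colorings n. (\<forall>m\<in>M. compatible c (R m)) \<and> (\<forall>X\<in>D. unicolored c X)}"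
proof -
  let ?r = "{(A, B). A \<in> loops G M R \<and> B \<in> loops G M R \<and> (\<exists>a\<in>A. \<exists>b\<in>B. \<exists>s t. {(a, s), (b, t)} \<in> D)}"
  let ?f = "\<lambda>\<kappa>. \<lambda>s\<in>strands G M R. \<kappa> ((joined R)\<^sup>* `` {s})"
  have form: "\<exists>a s b t. X = {(a, s), (b, t)} \<and> a \<in> strands G M R \<and> b \<in> strands G M R" if "X \<in> D" for X
    using that D unfolding boxed_crossings_def by blast
  let ?Q = "\<lambda>\<phi>. \<forall>a b s t. {(a, s), (b, t)} \<in> D \<longrightarrow> \<phi> a = \<phi> b"
  have "loops G M R = (\<lambda>s. (joined R)\<^sup>* `` {s}) ` strands G M R"
    by (auto simp: loops_def quotient_def)
  then have fin: "finite (loops G M R)"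
    using finite_strands [OF R] by simp
  have "sym ?r"
  proof (rule symI, clarify)
    fix A B a b s t
    assume "A \<in> loops G M R" "B \<in> loops G M R" and ab: "a \<in> A" "b \<in> B" and "{(a, s), (b, t)} \<in> D"
    then have "{(b, t), (a, s)} \<in> D"
      by (simp add: insert_commute)
    then show "\<exists>a\<in>B. \<exists>b\<in>A. \<exists>s t. {(a, s), (b, t)} \<in> D"
      using ab by blast
  qed
  then have "n ^ card (complexes G M R D) = card {\<kappa> \<in> loops G M R \<rightarrow>\<^sub>E {1..n}. \<forall>(A, B)\<in>?r. \<kappa> A = \<kappa> B}"
    unfolding complexes_def by (intro power_card_quotient [OF fin]) auto
  also have "\<dots> = card {\<phi> \<in> strand_colorings R n. ?Q \<phi>}"
  proof (rule card_Collect_bij_betw [OF bij_betw_loops])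
    fix \<kappa>
    have in_s: "a \<in> strands G M R" "b \<in> strands G M R" if "{(a, s), (b, t)} \<in> D" for a b s t
      using form [OF that] by (auto simp: doubleton_eq_iff)
    show "(\<forall>(A, B)\<in>?r. \<kappa> A = \<kappa> B) \<longleftrightarrow> ?Q (?f \<kappa>)"
    proof
      assume *: "\<forall>(A, B)\<in>?r. \<kappa> A = \<kappa> B"
      show "?Q (?f \<kappa>)"
      proof (intro allI impI)
        fix a b s t
        assume st: "{(a, s), (b, t)} \<in> D"
        note ab = in_s [OF st]
        have "a \<in> (joined R)\<^sup>* `` {a}" "b \<in> (joined R)\<^sup>* `` {b}"
          by auto
        then have "((joined R)\<^sup>* `` {a}, (joined R)\<^sup>* `` {b}) \<in> ?r"
          using loop_of_strand ab st by blast
        then have "\<kappa> ((joined R)\<^sup>* `` {a}) = \<kappa> ((joined R)\<^sup>* `` {b})"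
          using * by blast
        then show "?f \<kappa> a = ?f \<kappa> b"
          using ab by simp
      qed
    next
      assume *: "?Q (?f \<kappa>)"
      show "\<forall>(A, B)\<in>?r. \<kappa> A = \<kappa> B"
      proof clarify
        fix A B a b s t
        assume AB: "A \<in> loops G M R" "B \<in> loops G M R" and ab: "a \<in> A" "b \<in> B" and st: "{(a, s), (b, t)} \<in> D"
        have "?f \<kappa> a = ?f \<kappa> b"
          using * st by blast
        then show "\<kappa> A = \<kappa> B"
          using in_s [OF st] loop_containing(1) [OF AB(1) ab(1)] loop_containing(1) [OF AB(2) ab(2)] by simp
      qed
    qed
  qed
  also have "\<dots> = card {c \<in> {c \<in> edge_colorings n. \<forall>m\<in>M. compatible c (R m)}. \<forall>X\<in>D. unicolored c X}"
  proof (rule card_Collect_bij_betw [OF bij_betw_edge_colorings [OF R], symmetric])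
    fix c
    have 1: "a \<in> strands G M R \<and> b \<in> strands G M R" if "{(a, s), (b, t)} \<in> D" for a b s t
      using form [OF that] by (auto simp: doubleton_eq_iff)
    show "(\<forall>X\<in>D. unicolored c X) \<longleftrightarrow> ?Q (\<lambda>s\<in>strands G M R. strand_color c s)"
    proof
      assume *: "\<forall>X\<in>D. unicolored c X"
      show "?Q (\<lambda>s\<in>strands G M R. strand_color c s)"
      proof (intro allI impI)
        fix a b s t
        assume st: "{(a, s), (b, t)} \<in> D"
        then have "unicolored c {(a, s), (b, t)}"
          using * by blast
        then show "(\<lambda>s\<in>strands G M R. strand_color c s) a = (\<lambda>s\<in>strands G M R. strand_color c s) b"
          using 1 [OF st] by (simp add: unicolored_pair)
      qed
    next
      assume *: "?Q (\<lambda>s\<in>strands G M R. strand_color c s)"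
      show "\<forall>X\<in>D. unicolored c X"
      proof
        fix X assume X: "X \<in> D"
        then obtain a s b t where st: "X = {(a, s), (b, t)}" "a \<in> strands G M R" "b \<in> strands G M R"
          using form by blast
        then have "(\<lambda>s\<in>strands G M R. strand_color c s) a = (\<lambda>s\<in>strands G M R. strand_color c s) b"
          using * X by blast
        then have "strand_color c a = strand_color c b"
          using st by simp
        then show "unicolored c X"
          by (simp add: unicolored_pair st(1))
      qed
    qed
  qed
  finally show ?thesis
    by (simp add: conj_assoc)
qed

end

section \<open>Both invariants as sums over edge colorings\<close>

lemma prod_of_bool: "finite A \<Longrightarrow> (\<Prod>x\<in>A. of_bool (P x)) = (of_bool (\<forall>x\<in>A. P x) :: 'a :: comm_semiring_1)"
  by (induction A rule: finite_induct) auto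

lemma card_Collect_eq_sum: "finite A \<Longrightarrow> int (card {x \<in> A. P x}) = (\<Sum>x\<in>A. of_bool (P x))"
  using Collect_conj_eq [of "\<lambda>x. x \<in> A" P] by simp

fun strand_token :: "'e strand \<Rightarrow> 'e \<times> 'e edge_end" where
  "strand_token (Edge e) = (e, (e, Tail))"
| "strand_token (Along m q) = (m, fst q)"

lemma fst_strand_token [simp]: "fst (strand_token s) = support s"
  and color_strand_token: "c (fst (snd (strand_token s))) = strand_color c s"
  by (cases s; simp)+

context matched_immersion
begin

text \<open>Here \<open>a\<close> and \<open>c\<close> are the left ends, \<open>b\<close> and
  \<open>d\<close> the right ones. The inequality at the head is reversed, since counterclockwise
  from the matching edge the left end comes last there.\<close>

lemma replacements_at:
  assumes m: "m \<in> M"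
  obtains a b c d where "free_ends G M (tail G m) = {a, b}" "a \<noteq> b" "free_ends G M (head G m) = {c, d}" "c \<noteq> d"
    "turn \<gamma> (m, Tail) a < turn \<gamma> (m, Tail) b" "turn \<gamma> (m, Head) d < turn \<gamma> (m, Head) c"
    "parallel_replacement G M \<gamma> m = {(a, c), (b, d)}" "crossed_replacement G M \<gamma> m = {(a, d), (b, c)}"
proof -
  have mG: "fst (m, Tail) \<in> arcs G" "fst (m, Head) \<in> arcs G"
    using m M_arcs by auto
  have pair: "\<exists>a b. free_ends G M v = {a, b} \<and> turn \<gamma> h a < turn \<gamma> h b" if v: "v \<in> verts G" and h: "fst h \<in> arcs G" for v h
  proof -
    obtain a b where ab: "free_ends G M v = {a, b}" "a \<noteq> b"
      using card_free_ends [OF v] unfolding card_2_iff by blast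
    then have "a \<in> edge_ends G v" "b \<in> edge_ends G v"
      using free_endsD(3) by blast+
    then have "turn \<gamma> h a \<noteq> turn \<gamma> h b"
      using turn_neq h ab(2) by blast
    then consider "turn \<gamma> h a < turn \<gamma> h b" | "turn \<gamma> h b < turn \<gamma> h a"
      by linarith
    then show ?thesis
    proof cases
      case 1
      then show ?thesis
        using ab(1) by blast
    next
      case 2
      moreover have "free_ends G M v = {b, a}"
        using ab(1) by auto
      ultimately show ?thesis
        by blast
    qed
  qed
  obtain a b where ab: "free_ends G M (tail G m) = {a, b}" "turn \<gamma> (m, Tail) a < turn \<gamma> (m, Tail) b"
    using pair [OF M_nodes(1) [OF m] mG(1)] by blast
  obtain d c where cd: "free_ends G M (head G m) = {d, c}" "turn \<gamma> (m, Head) d < turn \<gamma> (m, Head) c"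
    using pair [OF M_nodes(2) [OF m] mG(2)] by blast
  have ne: "a \<noteq> b" "c \<noteq> d"
    using ab cd by auto
  have left: "tail_left G M \<gamma> m a" "\<not> tail_left G M \<gamma> m b" "head_left G M \<gamma> m c" "\<not> head_left G M \<gamma> m d"
    using ab(2) cd(2) ne unfolding tail_left_def head_left_def ab(1) cd(1) by (simp_all add: insert_Diff_if)
  have rep: "parallel_replacement G M \<gamma> m = {(a, c), (b, d)}" "crossed_replacement G M \<gamma> m = {(a, d), (b, c)}"
    using left unfolding parallel_replacement_def crossed_replacement_def ab(1) cd(1) by auto
  have "free_ends G M (head G m) = {c, d}"
    using cd(1) by auto
  from that [OF ab(1) ne(1) this ne(2) ab(2) cd(2) rep] show ?thesis .
qed

lemma replacements_eq:
  assumes "m \<in> M"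
  shows "replacements G M m = {parallel_replacement G M \<gamma> m, crossed_replacement G M \<gamma> m}"
    and "parallel_replacement G M \<gamma> m \<noteq> crossed_replacement G M \<gamma> m"
proof -
  obtain a b c d where r: "free_ends G M (tail G m) = {a, b}" "a \<noteq> b" "free_ends G M (head G m) = {c, d}" "c \<noteq> d"
    "parallel_replacement G M \<gamma> m = {(a, c), (b, d)}" "crossed_replacement G M \<gamma> m = {(a, d), (b, c)}"
    using replacements_at [OF assms] .
  show "parallel_replacement G M \<gamma> m \<noteq> crossed_replacement G M \<gamma> m"
    using r by (auto simp: doubleton_eq_iff)
  show "replacements G M m = {parallel_replacement G M \<gamma> m, crossed_replacement G M \<gamma> m}"
  proof
    show "{parallel_replacement G M \<gamma> m, crossed_replacement G M \<gamma> m} \<subseteq> replacements G M m"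
    proof -
      have "{(a, c), (b, d)} \<in> replacements G M m" "{(a, d), (b, c)} \<in> replacements G M m"
      proof -
        have "free_ends G M (head G m) = {d, c}" "d \<noteq> c"
          using r(3,4) by auto
        then show "{(a, c), (b, d)} \<in> replacements G M m" "{(a, d), (b, c)} \<in> replacements G M m"
          unfolding replacements_def using r(1-4) by blast+
      qed
      then show ?thesis
        using r by simp
    qed
    show "replacements G M m \<subseteq> {parallel_replacement G M \<gamma> m, crossed_replacement G M \<gamma> m}"
    proof
      fix Q
      assume "Q \<in> replacements G M m"
      then obtain a' b' c' d' where Q: "Q = {(a', c'), (b', d')}" "{a, b} = {a', b'}" "{c, d} = {c', d'}"
        unfolding replacements_def r(1,3) by blast
      then show "Q \<in> {parallel_replacement G M \<gamma> m, crossed_replacement G M \<gamma> m}"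
        unfolding r(5,6) doubleton_eq_iff by (elim disjE conjE) (simp_all add: insert_commute)
    qed
  qed
qed

text \<open>The matching polynomial ranges over abstract replacements, the Penrose evaluation over
  sets of crossed edges, which refer to the drawing. This bijection lets both be summed over the
  same index set.\<close>

lemma bij_betw_resolve: "bij_betw (resolve G M \<gamma>) (Pow M) (\<Pi>\<^sub>E m\<in>M. replacements G M m)"
proof (rule bij_betwI)
  let ?g = "\<lambda>R. {m \<in> M. R m = crossed_replacement G M \<gamma> m}"
  show "resolve G M \<gamma> \<in> Pow M \<rightarrow> (\<Pi>\<^sub>E m\<in>M. replacements G M m)"
    by (auto simp: resolve_def replacements_eq)
  show "?g \<in> (\<Pi>\<^sub>E m\<in>M. replacements G M m) \<rightarrow> Pow M"
    by auto
  show "?g (resolve G M \<gamma> S) = S" if "S \<in> Pow M" for S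
    using that replacements_eq(2) by (auto simp: resolve_def split: if_splits)
  show "resolve G M \<gamma> (?g R) = R" if R: "R \<in> (\<Pi>\<^sub>E m\<in>M. replacements G M m)" for R
  proof
    fix m
    show "resolve G M \<gamma> (?g R) m = R m"
    proof (cases "m \<in> M")
      case True
      then have "R m \<in> {parallel_replacement G M \<gamma> m, crossed_replacement G M \<gamma> m}"
        using R replacements_eq(1) by (auto simp: PiE_iff)
      then show ?thesis
        using True by (auto simp: resolve_def)
    next
      case False
      then show ?thesis
        using R by (auto simp: resolve_def PiE_iff extensional_def)
    qed
  qed
qed

lemma state_resolve: "S \<subseteq> M \<Longrightarrow> state (resolve G M \<gamma> S)"
  unfolding state_def by (rule bij_betw_apply [OF bij_betw_resolve]) simp

abbreviation fits_parallel :: "('e \<Rightarrow> nat) \<Rightarrow> 'e \<Rightarrow> bool" where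
  "fits_parallel c m \<equiv> compatible c (parallel_replacement G M \<gamma> m)"

abbreviation fits_crossed :: "('e \<Rightarrow> nat) \<Rightarrow> 'e \<Rightarrow> bool" where
  "fits_crossed c m \<equiv> compatible c (crossed_replacement G M \<gamma> m)"

lemma compatible_resolve:
  assumes "S \<subseteq> M"
  shows "(\<forall>m\<in>M. compatible c (resolve G M \<gamma> S m)) \<longleftrightarrow> (\<forall>m\<in>S. fits_crossed c m) \<and> (\<forall>m\<in>M - S. fits_parallel c m)"
  using assms by (auto simp: resolve_def)

text \<open>The marker condition is stated at the tail of \<open>m\<close> only, which makes it
  independent of the replacement chosen there.\<close>

definition separated :: "('e \<Rightarrow> nat) \<Rightarrow> 'e \<Rightarrow> bool" where
  "separated c m \<longleftrightarrow> (\<forall>x\<in>free_ends G M (tail G m). \<forall>y\<in>free_ends G M (tail G m). x \<noteq> y \<longrightarrow> c (fst x) \<noteq> c (fst y))"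

lemma separated_iff:
  assumes "state R" "m \<in> M"
  shows "(\<forall>q\<in>R m. \<forall>r\<in>R m. q \<noteq> r \<longrightarrow> c (fst (fst q)) \<noteq> c (fst (fst r))) \<longleftrightarrow> separated c m"
proof -
  have inj: "inj_on fst (R m)" and im: "free_ends G M (tail G m) = fst ` R m"
    using state_bij [OF assms] by (auto simp: bij_betw_def)
  have "fst q = fst r \<longleftrightarrow> q = r" if "q \<in> R m" "r \<in> R m" for q r
    using inj that by (auto dest: inj_onD)
  then show ?thesis
    unfolding separated_def im by auto
qed

lemma finite_edge_colorings: "finite (edge_colorings n)"
  unfolding edge_colorings_def by (intro finite_PiE) auto

lemma matching_polynomial_eq_sum:
  "int (matching_polynomial G M n) = (\<Sum>c\<in>edge_colorings n. \<Sum>S\<in>Pow M.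
     of_bool ((\<forall>m\<in>S. fits_crossed c m) \<and> (\<forall>m\<in>M - S. fits_parallel c m) \<and> (\<forall>m\<in>M. separated c m)))"
proof -
  have "int (matching_polynomial G M n) = (\<Sum>S\<in>Pow M. int (card (loop_colorings G M (resolve G M \<gamma> S) n)))"
    unfolding matching_polynomial_def of_nat_sum by (rule sum.reindex_bij_betw [OF bij_betw_resolve, symmetric])
  also have "\<dots> = (\<Sum>S\<in>Pow M. \<Sum>c\<in>edge_colorings n.
      of_bool ((\<forall>m\<in>S. fits_crossed c m) \<and> (\<forall>m\<in>M - S. fits_parallel c m) \<and> (\<forall>m\<in>M. separated c m)))"
  proof (rule sum.cong [OF refl])
    fix S
    assume "S \<in> Pow M"
    then have S: "S \<subseteq> M"
      by simp
    have "int (card (loop_colorings G M (resolve G M \<gamma> S) n)) = (\<Sum>c\<in>edge_colorings n.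
      of_bool ((\<forall>m\<in>M. compatible c (resolve G M \<gamma> S m)) \<and> (\<forall>m\<in>M. separated c m)))"
      unfolding card_loop_colorings [OF state_resolve [OF S]] card_Collect_eq_sum [OF finite_edge_colorings]
      using separated_iff [OF state_resolve [OF S]] by simp
    then show "int (card (loop_colorings G M (resolve G M \<gamma> S) n)) = (\<Sum>c\<in>edge_colorings n.
      of_bool ((\<forall>m\<in>S. fits_crossed c m) \<and> (\<forall>m\<in>M - S. fits_parallel c m) \<and> (\<forall>m\<in>M. separated c m)))"
      unfolding compatible_resolve [OF S] by (simp only: conj_assoc)
  qed
  also have "\<dots> = (\<Sum>c\<in>edge_colorings n. \<Sum>S\<in>Pow M.
      of_bool ((\<forall>m\<in>S. fits_crossed c m) \<and> (\<forall>m\<in>M - S. fits_parallel c m) \<and> (\<forall>m\<in>M. separated c m)))"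
    by (rule sum.swap)
  finally show ?thesis .
qed

section \<open>Counting bicolored boxed crossings independently of the state\<close>

text \<open>
  The tokens stand for the strands of an arbitrary state: an arc along \<open>m\<close> is named by the edge-end at
  the tail of \<open>m\<close> that it starts from.  This makes the number of bicolored boxed crossings visibly
  independent of the state.
\<close>

definition tokens :: "('e \<times> 'e edge_end) set" where
  "tokens = {(e, (e, Tail)) | e. e \<in> arcs G - M} \<union> {(m, x) | m x. m \<in> M \<and> x \<in> free_ends G M (tail G m)}"

definition bicolored_pairs :: "('e \<Rightarrow> nat) \<Rightarrow> ((('e \<times> 'e edge_end) \<times> real) \<times> (('e \<times> 'e edge_end) \<times> real)) set" where
  "bicolored_pairs c = {((k, s), (l, t)) | k s l t. k \<in> tokens \<and> l \<in> tokens \<and>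
     {(fst k, s), (fst l, t)} \<in> crossings G \<gamma> \<and> c (fst (snd k)) < c (fst (snd l))}"

lemma bij_betw_strand_token:
  assumes R: "state R"
  shows "bij_betw strand_token (strands G M R) tokens"
  unfolding bij_betw_def
proof
  have inj: "q = r" if "m \<in> M" "q \<in> R m" "r \<in> R m" "fst q = fst r" for m q r
    using state_bij [OF R that(1)] that(2-4) by (auto simp: bij_betw_def dest: inj_onD)
  show "inj_on strand_token (strands G M R)"
  proof (rule inj_onI)
    fix s t
    assume "s \<in> strands G M R" "t \<in> strands G M R" "strand_token s = strand_token t"
    then show "s = t"
      using inj by (cases s; cases t) (auto simp: strands_def)
  qed
  have "strand_token ` {Along m q | m q. m \<in> M \<and> q \<in> R m} = {(m, x) | m x. m \<in> M \<and> x \<in> fst ` R m}"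
  proof (intro equalityI subsetI)
    fix z
    assume "z \<in> strand_token ` {Along m q | m q. m \<in> M \<and> q \<in> R m}"
    then obtain m q where "m \<in> M" "q \<in> R m" "z = (m, fst q)"
      by auto
    then show "z \<in> {(m, x) | m x. m \<in> M \<and> x \<in> fst ` R m}"
      by blast
  next
    fix z
    assume "z \<in> {(m, x) | m x. m \<in> M \<and> x \<in> fst ` R m}"
    then obtain m q where "m \<in> M" "q \<in> R m" "z = strand_token (Along m q)"
      by auto
    then show "z \<in> strand_token ` {Along m q | m q. m \<in> M \<and> q \<in> R m}"
      by blast
  qed
  also have "\<dots> = {(m, x) | m x. m \<in> M \<and> x \<in> free_ends G M (tail G m)}"
  proof -
    have "fst ` R m = free_ends G M (tail G m)" if "m \<in> M" for m
      using state_bij [OF R that] by (simp add: bij_betw_def)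
    then show ?thesis
      by blast
  qed
  finally show "strand_token ` strands G M R = tokens"
    unfolding strands_def tokens_def image_Un image_image by auto
qed

text \<open>The two strands at a bicolored crossing are ordered by putting the smaller color first,
  which turns unordered pairs into ordered ones without repetition. Tokens then replace strands, and
  the state disappears from the count.\<close>

lemma card_bicolored_crossings:
  assumes R: "state R"
  shows "card {X \<in> boxed_crossings G M \<gamma> R. \<not> unicolored c X} = card (bicolored_pairs c)"
proof -
  define T where "T = {((a, s), (b, t)) | a s b t. a \<in> strands G M R \<and> b \<in> strands G M R \<and>
     {(support a, s), (support b, t)} \<in> crossings G \<gamma> \<and> strand_color c a < strand_color c b}"
  have bij: "inj_on strand_token (strands G M R)" "strand_token ` strands G M R = tokens"
    using bij_betw_strand_token [OF R] by (auto simp: bij_betw_def)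
  have b1: "bij_betw (\<lambda>(x, y). {x, y}) T {X \<in> boxed_crossings G M \<gamma> R. \<not> unicolored c X}"
    unfolding bij_betw_def
  proof
    show "inj_on (\<lambda>(x, y). {x, y}) T"
      unfolding T_def by (rule inj_onI) (auto simp: doubleton_eq_iff)
    show "(\<lambda>(x, y). {x, y}) ` T = {X \<in> boxed_crossings G M \<gamma> R. \<not> unicolored c X}"
    proof
      show "(\<lambda>(x, y). {x, y}) ` T \<subseteq> {X \<in> boxed_crossings G M \<gamma> R. \<not> unicolored c X}"
      proof clarify
        fix a s b t
        assume "((a, s), (b, t)) \<in> T"
        then show "{(a, s), (b, t)} \<in> boxed_crossings G M \<gamma> R \<and> \<not> unicolored c {(a, s), (b, t)}"
          unfolding T_def boxed_crossings_def unicolored_pair by auto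
      qed
      show "{X \<in> boxed_crossings G M \<gamma> R. \<not> unicolored c X} \<subseteq> (\<lambda>(x, y). {x, y}) ` T"
      proof clarify
        fix X
        assume "X \<in> boxed_crossings G M \<gamma> R" and n: "\<not> unicolored c X"
        then obtain a s b t where X: "X = {(a, s), (b, t)}" "a \<in> strands G M R" "b \<in> strands G M R"
          "{(support a, s), (support b, t)} \<in> crossings G \<gamma>"
          unfolding boxed_crossings_def by blast
        have "strand_color c a \<noteq> strand_color c b"
          using n unfolding X(1) unicolored_pair .
        then consider "strand_color c a < strand_color c b" | "strand_color c b < strand_color c a"
          by linarith
        then show "X \<in> (\<lambda>(x, y). {x, y}) ` T"
        proof cases
          case 1
          then have "((a, s), (b, t)) \<in> T"
            using X unfolding T_def by blast
          then show ?thesis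
            using X(1) by force
        next
          case 2
          moreover have "{(support b, t), (support a, s)} \<in> crossings G \<gamma>"
            using X(4) by (simp add: insert_commute)
          ultimately have "((b, t), (a, s)) \<in> T"
            using X unfolding T_def by blast
          then show ?thesis
            unfolding X(1) by (force simp: insert_commute)
        qed
      qed
    qed
  qed
  have b2: "bij_betw (map_prod (map_prod strand_token id) (map_prod strand_token id)) T (bicolored_pairs c)"
    unfolding bij_betw_def
  proof
    show "inj_on (map_prod (map_prod strand_token id) (map_prod strand_token id)) T"
      by (rule inj_onI) (auto simp: T_def dest: inj_onD [OF bij(1)])
    show "map_prod (map_prod strand_token id) (map_prod strand_token id) ` T = bicolored_pairs c"
    proof
      show "map_prod (map_prod strand_token id) (map_prod strand_token id) ` T \<subseteq> bicolored_pairs c"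
      proof (rule image_subsetI)
        fix z
        assume "z \<in> T"
        then obtain a s b t where z: "z = ((a, s), (b, t))" and ab: "a \<in> strands G M R" "b \<in> strands G M R" "{(support a, s), (support b, t)} \<in> crossings G \<gamma>"
          "strand_color c a < strand_color c b"
          unfolding T_def by blast+
        have "strand_token a \<in> tokens" "strand_token b \<in> tokens"
          using bij(2) ab by blast+
        moreover have "{(fst (strand_token a), s), (fst (strand_token b), t)} \<in> crossings G \<gamma>"
          using ab by simp
        moreover have "c (fst (snd (strand_token a))) < c (fst (snd (strand_token b)))"
          using ab by (simp only: color_strand_token [of c])
        ultimately have "((strand_token a, s), (strand_token b, t)) \<in> bicolored_pairs c"
          unfolding bicolored_pairs_def by blast
        then show "map_prod (map_prod strand_token id) (map_prod strand_token id) z \<in> bicolored_pairs c"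
          by (simp add: z)
      qed
      show "bicolored_pairs c \<subseteq> map_prod (map_prod strand_token id) (map_prod strand_token id) ` T"
      proof
        fix z
        assume "z \<in> bicolored_pairs c"
        then obtain k s l t where z: "z = ((k, s), (l, t))" "k \<in> tokens" "l \<in> tokens"
          "{(fst k, s), (fst l, t)} \<in> crossings G \<gamma>" "c (fst (snd k)) < c (fst (snd l))"
          unfolding bicolored_pairs_def by blast
        then obtain a b where ab: "a \<in> strands G M R" "b \<in> strands G M R" "k = strand_token a" "l = strand_token b"
          using bij(2) by blast
        have "{(support a, s), (support b, t)} \<in> crossings G \<gamma>" "strand_color c a < strand_color c b"
          using z(4,5) unfolding ab(3,4) by (simp_all only: fst_strand_token color_strand_token [of c])
        then have "((a, s), (b, t)) \<in> T"
          using ab unfolding T_def by blast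
        then show "z \<in> map_prod (map_prod strand_token id) (map_prod strand_token id) ` T"
          unfolding z(1) ab(3,4) by (rule image_eqI [rotated]) simp
      qed
    qed
  qed
  show ?thesis
    using bij_betw_same_card [OF b1] bij_betw_same_card [OF b2] by simp
qed

lemma finite_boxed_crossings:
  assumes R: "state R"
  shows "finite (boxed_crossings G M \<gamma> R)"
proof (rule finite_subset)
  let ?W = "strands G M R \<times> snd ` \<Union>(crossings G \<gamma>)"
  show "boxed_crossings G M \<gamma> R \<subseteq> (\<lambda>(x, y). {x, y}) ` (?W \<times> ?W)"
  proof
    fix X
    assume "X \<in> boxed_crossings G M \<gamma> R"
    then obtain a s b t where X: "X = {(a, s), (b, t)}" "a \<in> strands G M R" "b \<in> strands G M R"
      "{(support a, s), (support b, t)} \<in> crossings G \<gamma>"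
      unfolding boxed_crossings_def by blast
    then have "(support a, s) \<in> \<Union>(crossings G \<gamma>)" "(support b, t) \<in> \<Union>(crossings G \<gamma>)"
      by blast+
    then have "((a, s), (b, t)) \<in> ?W \<times> ?W"
      using X(2,3) by force
    then show "X \<in> (\<lambda>(x, y). {x, y}) ` (?W \<times> ?W)"
      unfolding X(1) by (rule image_eqI [rotated]) simp
  qed
  show "finite ((\<lambda>(x, y). {x, y}) ` (?W \<times> ?W))"
    using finite_strands [OF R] finite_crossings finite_crossing by auto
qed

lemma weighted_sum_complexes:
  assumes R: "state R"
  defines "B \<equiv> boxed_crossings G M \<gamma> R"
  shows "(\<Sum>D\<in>Pow B. 2 ^ card D * (-1) ^ card (B - D) * int n ^ card (complexes G M R D)) =
    (\<Sum>c\<in>edge_colorings n. of_bool (\<forall>m\<in>M. compatible c (R m)) * (-1) ^ card (bicolored_pairs c))"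
proof -
  have finB: "finite B"
    unfolding B_def by (rule finite_boxed_crossings [OF R])
  have "(\<Sum>D\<in>Pow B. 2 ^ card D * (-1) ^ card (B - D) * int n ^ card (complexes G M R D)) =
     (\<Sum>D\<in>Pow B. \<Sum>c\<in>edge_colorings n. of_bool (\<forall>m\<in>M. compatible c (R m)) *
        ((\<Prod>X\<in>D. 2 * of_bool (unicolored c X)) * (\<Prod>X\<in>B - D. -1)))"
  proof (rule sum.cong [OF refl])
    fix D
    assume "D \<in> Pow B"
    then have D: "D \<subseteq> boxed_crossings G M \<gamma> R" and finD: "finite D"
      using finB finite_subset by (auto simp: B_def)
    have "int n ^ card (complexes G M R D) = int (n ^ card (complexes G M R D))"
      by simp
    also have "\<dots> = (\<Sum>c\<in>edge_colorings n. of_bool ((\<forall>m\<in>M. compatible c (R m)) \<and> (\<forall>X\<in>D. unicolored c X)))"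
      unfolding power_card_complexes [OF R D] card_Collect_eq_sum [OF finite_edge_colorings] ..
    also have "\<dots> = (\<Sum>c\<in>edge_colorings n. of_bool (\<forall>m\<in>M. compatible c (R m)) * (\<Prod>X\<in>D. of_bool (unicolored c X)))"
      by (simp only: prod_of_bool [OF finD] of_bool_conj)
    finally show "2 ^ card D * (-1) ^ card (B - D) * int n ^ card (complexes G M R D) =
      (\<Sum>c\<in>edge_colorings n. of_bool (\<forall>m\<in>M. compatible c (R m)) *
        ((\<Prod>X\<in>D. 2 * of_bool (unicolored c X)) * (\<Prod>X\<in>B - D. -1)))"
      by (simp add: sum_distrib_left prod.distrib mult_ac)
  qed
  also have "\<dots> = (\<Sum>c\<in>edge_colorings n. \<Sum>D\<in>Pow B. of_bool (\<forall>m\<in>M. compatible c (R m)) *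
        ((\<Prod>X\<in>D. 2 * of_bool (unicolored c X)) * (\<Prod>X\<in>B - D. -1)))"
    by (rule sum.swap)
  \<comment> \<open>Read from right to left, \<open>prod_add\<close> expands a product of binomials
    into a sum over subsets: \<open>D\<close> collects the crossings at which the dotted term is
    chosen.\<close>
  also have "\<dots> = (\<Sum>c\<in>edge_colorings n. of_bool (\<forall>m\<in>M. compatible c (R m)) *
        (\<Prod>X\<in>B. 2 * of_bool (unicolored c X) + -1))"
    by (simp only: prod_add [OF finB] sum_distrib_left)
  also have "\<dots> = (\<Sum>c\<in>edge_colorings n. of_bool (\<forall>m\<in>M. compatible c (R m)) * (-1) ^ card (bicolored_pairs c))"
  proof (intro sum.cong refl arg_cong2 [of _ _ _ _ "(*)"])
    fix c
    have "(\<Prod>X\<in>B. 2 * of_bool (unicolored c X) + -1) = (\<Prod>X\<in>B. if \<not> unicolored c X then -1 else 1 :: int)"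
      by (rule prod.cong) auto
    also have "\<dots> = (\<Prod>X\<in>{X \<in> B. \<not> unicolored c X}. -1)"
      by (rule prod.inter_filter [OF finB, symmetric])
    finally show "(\<Prod>X\<in>B. 2 * of_bool (unicolored c X) + -1) = (-1 :: int) ^ card (bicolored_pairs c)"
      unfolding card_bicolored_crossings [OF R, symmetric] B_def by simp
  qed
  finally show ?thesis .
qed

text \<open>The number of bicolored crossings is the same for all states, so the sign can be pulled
  out of the sum over replacements, which then factors over the matching edges.\<close>

lemma PK_eq_sum:
  "PK G M \<gamma> n = (\<Sum>c\<in>edge_colorings n. (-1) ^ card (bicolored_pairs c) *
     (\<Prod>m\<in>M. - of_bool (fits_crossed c m) + of_bool (fits_parallel c m)))"
proof -
  have "PK G M \<gamma> n = (\<Sum>S\<in>Pow M. \<Sum>c\<in>edge_colorings n. (-1) ^ card (bicolored_pairs c) *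
     ((\<Prod>m\<in>S. - of_bool (fits_crossed c m)) * (\<Prod>m\<in>M - S. of_bool (fits_parallel c m))))"
    unfolding PK_def
  proof (rule sum.cong [OF refl])
    fix S
    assume "S \<in> Pow M"
    then have S: "S \<subseteq> M" and fin: "finite S" "finite (M - S)"
      using finite_M finite_subset by auto
    have *: "(-1) ^ card S * of_bool (\<forall>m\<in>M. compatible c (resolve G M \<gamma> S m)) =
      (\<Prod>m\<in>S. - of_bool (fits_crossed c m)) * (\<Prod>m\<in>M - S. of_bool (fits_parallel c m) :: int)" for c
    proof -
      have "(\<Prod>m\<in>S. - of_bool (fits_crossed c m)) = (-1 :: int) ^ card S * (\<Prod>m\<in>S. of_bool (fits_crossed c m))"
        by (rule prod_uminus)
      then show ?thesis
        unfolding compatible_resolve [OF S] by (simp only: prod_of_bool [OF fin(1)] prod_of_bool [OF fin(2)] of_bool_conj mult.assoc)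
    qed
    show "(- 1) ^ card S * (\<Sum>D\<in>Pow (boxed_crossings G M \<gamma> (resolve G M \<gamma> S)). 2 ^ card D *
        (- 1) ^ card (boxed_crossings G M \<gamma> (resolve G M \<gamma> S) - D) * int n ^ card (complexes G M (resolve G M \<gamma> S) D)) =
      (\<Sum>c\<in>edge_colorings n. (-1) ^ card (bicolored_pairs c) *
        ((\<Prod>m\<in>S. - of_bool (fits_crossed c m)) * (\<Prod>m\<in>M - S. of_bool (fits_parallel c m))))"
      unfolding weighted_sum_complexes [OF state_resolve [OF S]] sum_distrib_left
    proof (rule sum.cong [OF refl])
      fix c
      have "x * (y * z) = z * (x * y)" for x y z :: int
        by simp
      then show "(- 1) ^ card S * (of_bool (\<forall>m\<in>M. compatible c (resolve G M \<gamma> S m)) * (- 1) ^ card (bicolored_pairs c)) =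
        (-1) ^ card (bicolored_pairs c) * ((\<Prod>m\<in>S. - of_bool (fits_crossed c m)) * (\<Prod>m\<in>M - S. of_bool (fits_parallel c m)) :: int)"
        unfolding * [symmetric] .
    qed
  qed
  also have "\<dots> = (\<Sum>c\<in>edge_colorings n. \<Sum>S\<in>Pow M. (-1) ^ card (bicolored_pairs c) *
     ((\<Prod>m\<in>S. - of_bool (fits_crossed c m)) * (\<Prod>m\<in>M - S. of_bool (fits_parallel c m))))"
    by (rule sum.swap)
  also have "\<dots> = (\<Sum>c\<in>edge_colorings n. (-1) ^ card (bicolored_pairs c) *
     (\<Prod>m\<in>M. - of_bool (fits_crossed c m) + of_bool (fits_parallel c m)))"
    by (simp only: prod_add [OF finite_M] sum_distrib_left)
  finally show ?thesis .
qed

end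

section \<open>Color classes and their crossings\<close>

lemma card_eq_sum_fibres:
  assumes "finite A" "finite T" "g ` A \<subseteq> T"
  shows "card A = (\<Sum>y\<in>T. card {x \<in> A. g x = y})"
  using sum.group [OF assms, of "\<lambda>_. 1 :: nat"] by simp

context immersed_digraph
begin

lemma crossing_iff:
  "{(e, s), (f, t)} \<in> crossings G \<gamma> \<longleftrightarrow> e \<in> arcs G \<and> f \<in> arcs G \<and> s \<in> {0<..<1} \<and> t \<in> {0<..<1} \<and>
    (e, s) \<noteq> (f, t) \<and> \<gamma> e s = \<gamma> f t" (is "?L \<longleftrightarrow> ?R")
proof
  assume ?L
  then obtain x y where xy: "{(e, s), (f, t)} = {x, y}" "x \<in> arcs G \<times> {0<..<1}" "y \<in> arcs G \<times> {0<..<1}" "x \<noteq> y"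
    "\<gamma> (fst x) (snd x) = \<gamma> (fst y) (snd y)"
    unfolding crossings_def by blast
  from xy(1) consider "x = (e, s)" "y = (f, t)" | "x = (f, t)" "y = (e, s)"
    unfolding doubleton_eq_iff by blast
  then show ?R
    using xy(2-5) by cases auto
next
  assume ?R
  then have "(e, s) \<in> arcs G \<times> {0<..<1}" "(f, t) \<in> arcs G \<times> {0<..<1}" "(e, s) \<noteq> (f, t)"
    "\<gamma> (fst (e, s)) (snd (e, s)) = \<gamma> (fst (f, t)) (snd (f, t))"
    by simp_all
  then show ?L
    unfolding crossings_def by blast
qed

text \<open>A crossing of \<open>e\<close> and \<open>f\<close> is determined by its parameter on
  \<open>f\<close>, because a second point of \<open>e\<close> there would make a triple
  point.\<close>

lemma card_edge_pair_crossings: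
  assumes ef: "e \<in> arcs G" "f \<in> arcs G" "e \<noteq> f"
  shows "card {((e, s), (f, t)) | s t. {(e, s), (f, t)} \<in> crossings G \<gamma>} = card (hits e f)"
proof (rule bij_betw_same_card [of "\<lambda>z. snd (snd z)"], unfold bij_betw_def, intro conjI)
  let ?T = "{((e, s), (f, t)) | s t. {(e, s), (f, t)} \<in> crossings G \<gamma>}"
  show "inj_on (\<lambda>z. snd (snd z)) ?T"
  proof (rule inj_onI)
    fix z z'
    assume "z \<in> ?T" "z' \<in> ?T" and eq: "snd (snd z) = snd (snd z')"
    then obtain s t s' t' where z: "z = ((e, s), (f, t))" "{(e, s), (f, t)} \<in> crossings G \<gamma>"
      "z' = ((e, s'), (f, t'))" "{(e, s'), (f, t')} \<in> crossings G \<gamma>"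
      by blast
    then have "t = t'"
      using eq by simp
    then have "{(e, s), (f, t)} = {(e, s'), (f, t')}"
      using no_triple_points [OF z(2) z(4), of "(f, t)"] by simp
    then show "z = z'"
      using z ef(3) by (simp add: doubleton_eq_iff)
  qed
  show "(\<lambda>z. snd (snd z)) ` ?T = hits e f"
  proof
    show "(\<lambda>z. snd (snd z)) ` ?T \<subseteq> hits e f"
    proof clarsimp
      fix s t
      assume "{(e, s), (f, t)} \<in> crossings G \<gamma>"
      then have "s \<in> {0<..<1}" "t \<in> {0<..<1}" "\<gamma> e s = \<gamma> f t"
        unfolding crossing_iff by blast+
      then show "t \<in> hits e f"
        unfolding hits_def path_image_def by (auto intro!: image_eqI [of "\<gamma> f t" "\<gamma> e" s])
    qed
    show "hits e f \<subseteq> (\<lambda>z. snd (snd z)) ` ?T"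
    proof
      fix t
      assume "t \<in> hits e f"
      then obtain s where "{(e, s), (f, t)} \<in> crossings G \<gamma>"
        using hits_crossing [OF ef] by blast
      then have "((e, s), (f, t)) \<in> ?T"
        by blast
      then show "t \<in> (\<lambda>z. snd (snd z)) ` ?T"
        by force
    qed
  qed
qed

definition edge_crossings :: "'e set \<Rightarrow> 'e set \<Rightarrow> (('e \<times> real) \<times> ('e \<times> real)) set" where
  "edge_crossings C D = {((e, s), (f, t)) | e s f t. e \<in> C \<and> f \<in> D \<and> {(e, s), (f, t)} \<in> crossings G \<gamma>}"

lemma finite_edge_crossings: "finite (edge_crossings C D)"
proof (rule finite_subset)
  show "edge_crossings C D \<subseteq> \<Union>(crossings G \<gamma>) \<times> \<Union>(crossings G \<gamma>)"
    unfolding edge_crossings_def by blast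
qed (use finite_crossings finite_crossing in auto)

text \<open>An edge that lies in both \<open>C\<close> and \<open>D\<close> may cross itself. Such a
  crossing is listed in both orders of its two parameters, so these pairs are even in number
  (\<open>A\<close> and its swap \<open>B\<close>) and only crossings of distinct edges affect the
  sign.\<close>

lemma sign_edge_crossings:
  assumes C: "C \<subseteq> arcs G" and D: "D \<subseteq> arcs G"
  shows "(-1) ^ card (edge_crossings C D) = (\<Prod>e\<in>C. \<Prod>f\<in>D - {e}. (-1) ^ card (hits e f) :: 'a :: comm_ring_1)"
proof -
  let ?E = "edge_crossings C D"
  define N where "N = {z \<in> ?E. fst (fst z) \<noteq> fst (snd z)}"
  define A where "A = {z \<in> ?E. fst (fst z) = fst (snd z) \<and> snd (fst z) < snd (snd z)}"
  define B where "B = {z \<in> ?E. fst (fst z) = fst (snd z) \<and> snd (snd z) < snd (fst z)}"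
  have fin: "finite N" "finite A" "finite B"
    unfolding N_def A_def B_def using finite_edge_crossings by auto
  have ne: "x \<noteq> y" if "(x, y) \<in> ?E" for x y
    using that unfolding edge_crossings_def by (auto simp: crossing_iff)
  have E: "?E = N \<union> (A \<union> B)"
  proof
    show "?E \<subseteq> N \<union> (A \<union> B)"
    proof
      fix z
      assume z: "z \<in> ?E"
      then have "fst z \<noteq> snd z"
        using ne [of "fst z" "snd z"] by simp
      then have "fst (fst z) \<noteq> fst (snd z) \<or> snd (fst z) < snd (snd z) \<or> snd (snd z) < snd (fst z)"
        by (auto simp: prod_eq_iff)
      then show "z \<in> N \<union> (A \<union> B)"
        using z unfolding N_def A_def B_def by blast
    qed
  qed (auto simp: N_def A_def B_def)
  have swap: "prod.swap ` A = B"
  proof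
    have sw: "prod.swap z \<in> ?E" if zE: "z \<in> ?E" and eq: "fst (fst z) = fst (snd z)" for z
    proof -
      obtain e s f t where z: "z = ((e, s), (f, t))" "e \<in> C" "f \<in> D" "{(e, s), (f, t)} \<in> crossings G \<gamma>"
        using zE unfolding edge_crossings_def by blast
      moreover have "{(f, t), (e, s)} \<in> crossings G \<gamma>"
        using z(4) by (simp add: insert_commute)
      moreover have "e = f"
        using z(1) eq by simp
      ultimately show ?thesis
        unfolding edge_crossings_def by auto
    qed
    show "prod.swap ` A \<subseteq> B"
      using sw unfolding A_def B_def by auto
    show "B \<subseteq> prod.swap ` A"
    proof
      fix z
      assume "z \<in> B"
      then have "prod.swap z \<in> A"
        using sw [of z] unfolding A_def B_def by auto
      then show "z \<in> prod.swap ` A"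
        by (metis image_eqI swap_swap)
    qed
  qed
  have "inj_on prod.swap A"
    by (rule inj_onI) (metis swap_swap)
  then have "card B = card A"
    unfolding swap [symmetric] by (rule card_image)
  moreover have "A \<inter> B = {}" "N \<inter> (A \<union> B) = {}"
    by (auto simp: N_def A_def B_def)
  ultimately have "card ?E = card N + 2 * card A"
    unfolding E using fin by (simp add: card_Un_disjoint)
  then have "(-1 :: 'a) ^ card ?E = (-1) ^ card N"
    by (simp add: power_add power_mult)
  also have "card N = (\<Sum>y\<in>Sigma C (\<lambda>e. D - {e}). card {z \<in> N. (fst (fst z), fst (snd z)) = y})"
    by (rule card_eq_sum_fibres [OF fin(1)])
      (use C D finite_edge_set in \<open>auto simp: N_def edge_crossings_def intro!: finite_SigmaI\<close>)
  also have "\<dots> = (\<Sum>(e, f)\<in>Sigma C (\<lambda>e. D - {e}). card (hits e f))"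
  proof (rule sum.cong [OF refl])
    fix y
    assume "y \<in> Sigma C (\<lambda>e. D - {e})"
    then obtain e f where y: "y = (e, f)" and ef: "e \<in> C" "f \<in> D" "f \<noteq> e"
      by blast
    have eq: "{z \<in> N. (fst (fst z), fst (snd z)) = (e, f)} = {((e, s), (f, t)) | s t. {(e, s), (f, t)} \<in> crossings G \<gamma>}"
      using ef by (auto simp: N_def edge_crossings_def)
    have "card {((e, s), (f, t)) | s t. {(e, s), (f, t)} \<in> crossings G \<gamma>} = card (hits e f)"
      by (rule card_edge_pair_crossings) (use ef C D in blast)+
    then show "card {z \<in> N. (fst (fst z), fst (snd z)) = y} = (case y of (e, f) \<Rightarrow> card (hits e f))"
      unfolding y eq by simp
  qed
  also have "(-1 :: 'a) ^ \<dots> = (\<Prod>(e, f)\<in>Sigma C (\<lambda>e. D - {e}). (-1) ^ card (hits e f))"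
    by (simp add: power_sum case_prod_unfold)
  also have "\<dots> = (\<Prod>e\<in>C. \<Prod>f\<in>D - {e}. (-1) ^ card (hits e f))"
    by (rule prod.Sigma [symmetric]) (use C D finite_edge_set in auto)
  finally show ?thesis .
qed

end

section \<open>Color classes of admissible colorings\<close>

context matched_immersion
begin

text \<open>A matching edge belongs to the class of every color present at its tail. For an
  admissible coloring the same two different colors occur at its head, so it lies in exactly two
  classes.\<close>

definition color_class :: "('e \<Rightarrow> nat) \<Rightarrow> nat \<Rightarrow> 'e set" where
  "color_class c i = {e \<in> arcs G - M. c e = i} \<union> {m \<in> M. \<exists>x\<in>free_ends G M (tail G m). c (fst x) = i}"

definition colored_end :: "('e \<Rightarrow> nat) \<Rightarrow> nat \<Rightarrow> 'v \<Rightarrow> 'e edge_end" where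
  "colored_end c i v = (SOME x. x \<in> free_ends G M v \<and> c (fst x) = i)"

text \<open>These are the colorings with a nonzero term on both sides of the identity. If no
  replacement fits at \<open>m\<close>, a factor is 0; if both fit, the signs cancel on one side and
  the marker at \<open>m\<close> is violated on the other.\<close>

definition admissible :: "('e \<Rightarrow> nat) \<Rightarrow> bool" where
  "admissible c \<longleftrightarrow> (\<forall>m\<in>M. fits_parallel c m \<noteq> fits_crossed c m)"

lemma color_class_arcs: "color_class c i \<subseteq> arcs G"
  using M_arcs by (auto simp: color_class_def)

lemma color_class_Int: "i \<noteq> j \<Longrightarrow> color_class c i \<inter> color_class c j \<subseteq> M"
  by (auto simp: color_class_def)

text \<open>The ends are labelled by color instead of position. In this labelling the crossed case
  appears as agreement of two cyclic orders, which is the form produced by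
  \<open>crossing_parity\<close>.\<close>

lemma admissible_matching_edge:
  assumes "admissible c" and m: "m \<in> M"
  obtains a b a' b' where "free_ends G M (tail G m) = {a, b}" "a \<noteq> b" "free_ends G M (head G m) = {a', b'}" "a' \<noteq> b'"
    "c (fst a) \<noteq> c (fst b)" "c (fst a') = c (fst a)" "c (fst b') = c (fst b)"
    "fits_crossed c m \<longleftrightarrow> (turn \<gamma> (m, Tail) b < turn \<gamma> (m, Tail) a \<longleftrightarrow> turn \<gamma> (m, Head) b' < turn \<gamma> (m, Head) a')"
proof -
  obtain a b a' b' where r: "free_ends G M (tail G m) = {a, b}" "a \<noteq> b" "free_ends G M (head G m) = {a', b'}" "a' \<noteq> b'"
    "turn \<gamma> (m, Tail) a < turn \<gamma> (m, Tail) b" "turn \<gamma> (m, Head) b' < turn \<gamma> (m, Head) a'"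
    "parallel_replacement G M \<gamma> m = {(a, a'), (b, b')}" "crossed_replacement G M \<gamma> m = {(a, b'), (b, a')}"
    using replacements_at [OF m] .
  have P: "fits_parallel c m \<longleftrightarrow> c (fst a) = c (fst a') \<and> c (fst b) = c (fst b')"
    and X: "fits_crossed c m \<longleftrightarrow> c (fst a) = c (fst b') \<and> c (fst b) = c (fst a')"
    unfolding r(7,8) compatible_def by simp_all
  have PX: "fits_parallel c m \<noteq> fits_crossed c m"
    using assms by (simp add: admissible_def)
  then have ne: "c (fst a) \<noteq> c (fst b)"
    unfolding P X by metis
  show ?thesis
  proof (cases "fits_crossed c m")
    case False
    then have "c (fst a') = c (fst a)" "c (fst b') = c (fst b)"
      using PX P by simp_all
    then show ?thesis
      using that [OF r(1,2,3,4) ne] r(5,6) False by simp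
  next
    case True
    then have "c (fst b') = c (fst a)" "c (fst a') = c (fst b)"
      using X by simp_all
    moreover have "free_ends G M (head G m) = {b', a'}" "b' \<noteq> a'"
      using r(3,4) by auto
    ultimately show ?thesis
      using that [OF r(1,2) _ _ ne, of b' a'] r(5,6) True by simp
  qed
qed

lemma admissible_node:
  assumes c: "admissible c" and h: "fst h \<in> M"
  obtains x y where "edge_ends G (end_node G h) = {h, x, y}" "free_ends G M (end_node G h) = {x, y}"
    "h \<noteq> x" "h \<noteq> y" "x \<noteq> y" "c (fst x) \<noteq> c (fst y)"
    "\<forall>i. fst h \<in> color_class c i \<longleftrightarrow> i = c (fst x) \<or> i = c (fst y)"
    "\<forall>i. fst x \<in> color_class c i \<longleftrightarrow> i = c (fst x)" "\<forall>i. fst y \<in> color_class c i \<longleftrightarrow> i = c (fst y)"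
proof -
  obtain a b a' b' where r: "free_ends G M (tail G (fst h)) = {a, b}" "a \<noteq> b" "free_ends G M (head G (fst h)) = {a', b'}" "a' \<noteq> b'"
    "c (fst a) \<noteq> c (fst b)" "c (fst a') = c (fst a)" "c (fst b') = c (fst b)"
    by (rule admissible_matching_edge [OF c h]) (rule that)
  have cls: "fst h \<in> color_class c i \<longleftrightarrow> i = c (fst a) \<or> i = c (fst b)" for i
    using h r(1) by (auto simp: color_class_def)
  have "\<exists>x y. free_ends G M (end_node G h) = {x, y} \<and> x \<noteq> y \<and> c (fst x) = c (fst a) \<and> c (fst y) = c (fst b)"
  proof (cases h rule: opposite.cases)
    case 1
    then have eq: "end_node G h = tail G (fst h)"
      by simp
    show ?thesis
      unfolding eq r(1) using r(2) by (intro exI [of _ a] exI [of _ b]) simp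
  next
    case 2
    then have eq: "end_node G h = head G (fst h)"
      by simp
    show ?thesis
      unfolding eq r(3) using r(4,6,7) by (intro exI [of _ a'] exI [of _ b']) simp
  qed
  then obtain x y where xy: "free_ends G M (end_node G h) = {x, y}" "x \<noteq> y" "c (fst x) = c (fst a)" "c (fst y) = c (fst b)"
    by blast
  have "x \<in> free_ends G M (end_node G h)" "y \<in> free_ends G M (end_node G h)"
    using xy(1) by simp_all
  then have free: "fst x \<in> arcs G - M" "fst y \<in> arcs G - M"
    using free_endsD(1) by blast+
  have free_class: "fst z \<in> color_class c i \<longleftrightarrow> i = c (fst z)" if "fst z \<in> arcs G - M" for z :: "'e edge_end" and i
    using that by (auto simp: color_class_def)
  show ?thesis
  proof (rule that [of x y])
    show "edge_ends G (end_node G h) = {h, x, y}"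
      unfolding edge_ends_matching_end [OF h] xy(1) ..
    show "h \<noteq> x" "h \<noteq> y"
      using h free by auto
    show "c (fst x) \<noteq> c (fst y)"
      using r(5) xy by simp
    show "\<forall>i. fst h \<in> color_class c i \<longleftrightarrow> i = c (fst x) \<or> i = c (fst y)"
      unfolding cls xy(3,4) by blast
    show "\<forall>i. fst x \<in> color_class c i \<longleftrightarrow> i = c (fst x)" "\<forall>i. fst y \<in> color_class c i \<longleftrightarrow> i = c (fst y)"
      using free_class free by blast+
  qed (use xy in auto)
qed

lemma colored_end_eqI:
  assumes "free_ends G M v = {x, y}" "c (fst x) \<noteq> c (fst y)" "c (fst x) = i"
  shows "colored_end c i v = x"
  unfolding colored_end_def by (rule some_equality) (use assms in auto)

text \<open>Besides two-regularity, this identifies the second end of each class at a node, which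
  provides the functions \<alpha> and \<beta> for \<open>crossing_parity\<close>.\<close>

lemma ends_at_color_class:
  assumes c: "admissible c" and h: "fst h \<in> M"
  shows "ends_at (color_class c i) (end_node G h) =
    (if fst h \<in> color_class c i then {h, colored_end c i (end_node G h)} else {})"
    and "fst h \<in> color_class c i \<Longrightarrow> colored_end c i (end_node G h) \<noteq> h"
    and "fst h \<in> color_class c i \<Longrightarrow> colored_end c i (end_node G h) \<in> free_ends G M (end_node G h) \<and>
      c (fst (colored_end c i (end_node G h))) = i"
proof -
  let ?v = "end_node G h"
  obtain x y where xy: "edge_ends G ?v = {h, x, y}" "free_ends G M ?v = {x, y}"
    "h \<noteq> x" "h \<noteq> y" "x \<noteq> y" "c (fst x) \<noteq> c (fst y)"
    "\<forall>i. fst h \<in> color_class c i \<longleftrightarrow> i = c (fst x) \<or> i = c (fst y)"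
    "\<forall>i. fst x \<in> color_class c i \<longleftrightarrow> i = c (fst x)" "\<forall>i. fst y \<in> color_class c i \<longleftrightarrow> i = c (fst y)"
    using admissible_node [OF c h] .
  have yx: "free_ends G M ?v = {y, x}" "c (fst y) \<noteq> c (fst x)"
    using xy by auto
  have x: "colored_end c i ?v = x" if "i = c (fst x)"
    using colored_end_eqI [where c = c, OF xy(2,6)] that by simp
  have y: "colored_end c i ?v = y" if "i = c (fst y)"
    using colored_end_eqI [where c = c, OF yx] that by simp
  have E: "ends_at (color_class c i) ?v = {k \<in> {h, x, y}. fst k \<in> color_class c i}"
    unfolding ends_at_def xy(1) ..
  consider "i = c (fst x)" "i \<noteq> c (fst y)" | "i = c (fst y)" "i \<noteq> c (fst x)" | "i \<noteq> c (fst x)" "i \<noteq> c (fst y)"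
    using xy(6) by (cases "i = c (fst x)"; cases "i = c (fst y)") simp_all
  then show "ends_at (color_class c i) ?v = (if fst h \<in> color_class c i then {h, colored_end c i ?v} else {})"
  proof cases
    case 1
    then have "fst h \<in> color_class c i" "fst x \<in> color_class c i" "fst y \<notin> color_class c i"
      using xy(7-9) by simp_all
    then show ?thesis
      unfolding E x [OF 1(1)] by auto
  next
    case 2
    then have "fst h \<in> color_class c i" "fst x \<notin> color_class c i" "fst y \<in> color_class c i"
      using xy(7-9) by simp_all
    then show ?thesis
      unfolding E y [OF 2(1)] by auto
  next
    case 3
    then have "fst h \<notin> color_class c i" "fst x \<notin> color_class c i" "fst y \<notin> color_class c i"
      using xy(7-9) by simp_all
    then show ?thesis
      unfolding E by auto
  qed
  assume "fst h \<in> color_class c i"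
  then have or: "i = c (fst x) \<or> i = c (fst y)"
    by (simp only: xy(7))
  then show "colored_end c i ?v \<noteq> h"
    using x y xy(3,4) by auto
  show "colored_end c i ?v \<in> free_ends G M ?v \<and> c (fst (colored_end c i ?v)) = i"
    using or x y xy(2) by auto
qed

text \<open>A non-matching loop would be both free ends of its node and give them the same color,
  which admissibility excludes.\<close>

lemma loopless_color_class:
  assumes c: "admissible c" and k: "fst k \<in> color_class c i"
  shows "loopless_end k"
proof (cases "fst k \<in> M")
  case True
  then show ?thesis
    using M_loopless M_arcs by (cases k rule: opposite.cases) (auto simp: loopless_end_def)
next
  case False
  have kG: "fst k \<in> arcs G"
    using k color_class_arcs by blast
  let ?v = "end_node G k"
  have "?v \<noteq> end_node G (opposite k)"
  proof
    assume eq: "?v = end_node G (opposite k)"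
    obtain h where h: "fst h \<in> M" "end_node G h = ?v"
      using matching_end [OF node_in_verts [OF kG]] .
    obtain x y where xy: "free_ends G M (end_node G h) = {x, y}" "x \<noteq> y" "c (fst x) \<noteq> c (fst y)"
      by (rule admissible_node [OF c h(1)]) (rule that)
    have "k \<in> {x, y}" "opposite k \<in> {x, y}"
      unfolding xy(1) [symmetric] h(2) using kG False eq by (auto simp: free_ends_def edge_ends_def)
    then show False
      using xy(2,3) opposite_neq [of k] fst_opposite [of k] by (metis insertE singletonD)
  qed
  then show ?thesis
    using kG by (simp add: loopless_end_def)
qed

lemma two_regular_color_class:
  assumes c: "admissible c"
  shows "two_regular (color_class c i)"
  unfolding two_regular_def
proof (intro conjI ballI)
  fix v
  assume "v \<in> verts G"
  then obtain h where h: "fst h \<in> M" "end_node G h = v"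
    using matching_end by blast
  show "ends_at (color_class c i) v = {} \<or> card (ends_at (color_class c i) v) = 2"
    using ends_at_color_class(1,2) [OF c h(1), of i] unfolding h(2) by (cases "fst h \<in> color_class c i") auto
qed (rule color_class_arcs)

text \<open>Different classes share only matching edges, and every node lies on a matching edge
  which carries all colors present there; so two classes that meet at a node share its matching
  edge, as \<open>crossing_parity\<close> requires.\<close>

lemma color_class_crossing_parity:
  assumes c: "admissible c" and ij: "i \<noteq> j"
  shows "(-1 :: int) ^ card (edge_crossings (color_class c i) (color_class c j)) =
    (\<Prod>m\<in>color_class c i \<inter> color_class c j. if fits_crossed c m then -1 else 1)"
proof -
  let ?C = "color_class c i" and ?D = "color_class c j"
  let ?\<alpha> = "\<lambda>h. colored_end c i (end_node G h)" and ?\<beta> = "\<lambda>h. colored_end c j (end_node G h)"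
  let ?\<tau> = "\<lambda>h. if turn \<gamma> h (?\<beta> h) < turn \<gamma> h (?\<alpha> h) then -1 else 1 :: complex"
  have "(\<Prod>e\<in>?C. \<Prod>f\<in>?D - {e}. (-1) ^ card (hits e f)) = (\<Prod>m\<in>?C \<inter> ?D. - (?\<tau> (m, Tail) * ?\<tau> (m, Head)))"
  proof (rule crossing_parity [OF two_regular_color_class [OF c] two_regular_color_class [OF c] loopless_color_class [OF c]])
    fix h :: "'e edge_end"
    assume h: "fst h \<in> ?C \<inter> ?D"
    then have hM: "fst h \<in> M"
      using color_class_Int [OF ij] by blast
    have hC: "fst h \<in> ?C" and hD: "fst h \<in> ?D"
      using h by auto
    note C = ends_at_color_class [OF c hM, of i] and D = ends_at_color_class [OF c hM, of j]
    have "?\<alpha> h \<noteq> ?\<beta> h"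
      using conjunct2 [OF C(3) [OF hC]] conjunct2 [OF D(3) [OF hD]] ij by metis
    then show "ends_at ?C (end_node G h) = {h, ?\<alpha> h} \<and> ends_at ?D (end_node G h) = {h, ?\<beta> h} \<and>
      h \<noteq> ?\<alpha> h \<and> h \<noteq> ?\<beta> h \<and> ?\<alpha> h \<noteq> ?\<beta> h"
      using C(1,2) D(1,2) hC hD by simp
  next
    fix v
    assume "v \<in> verts G" and ne: "ends_at ?C v \<noteq> {}" "ends_at ?D v \<noteq> {}"
    then obtain h where h: "fst h \<in> M" "end_node G h = v"
      using matching_end by blast
    then have "fst h \<in> ?C \<inter> ?D"
      using ne ends_at_color_class(1) [OF c h(1), of i] ends_at_color_class(1) [OF c h(1), of j]
      by (auto split: if_splits)
    then show "\<exists>h. fst h \<in> ?C \<inter> ?D \<and> end_node G h = v"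
      using h(2) by blast
  qed
  also have "\<dots> = (\<Prod>m\<in>?C \<inter> ?D. if fits_crossed c m then -1 else 1)"
  proof (rule prod.cong [OF refl])
    fix m
    assume m: "m \<in> ?C \<inter> ?D"
    then have mM: "m \<in> M"
      using color_class_Int [OF ij] by blast
    obtain a b a' b' where r: "free_ends G M (tail G m) = {a, b}" "a \<noteq> b" "free_ends G M (head G m) = {a', b'}" "a' \<noteq> b'"
      "c (fst a) \<noteq> c (fst b)" "c (fst a') = c (fst a)" "c (fst b') = c (fst b)"
      and X: "fits_crossed c m \<longleftrightarrow> (turn \<gamma> (m, Tail) b < turn \<gamma> (m, Tail) a \<longleftrightarrow> turn \<gamma> (m, Head) b' < turn \<gamma> (m, Head) a')"
      using admissible_matching_edge [OF c mM] .
    have "m \<in> color_class c k \<longleftrightarrow> k = c (fst a) \<or> k = c (fst b)" for k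
      using mM r(1) by (auto simp: color_class_def)
    then have ij': "i = c (fst a) \<and> j = c (fst b) \<or> i = c (fst b) \<and> j = c (fst a)"
      using m ij by auto
    have rs: "free_ends G M (tail G m) = {b, a}" "free_ends G M (head G m) = {b', a'}"
      using r(1,3) by auto
    have ends: "colored_end c (c (fst a)) (tail G m) = a" "colored_end c (c (fst b)) (tail G m) = b"
      "colored_end c (c (fst a)) (head G m) = a'" "colored_end c (c (fst b)) (head G m) = b'"
      using r(5-7) by (simp_all add: colored_end_eqI [OF r(1)] colored_end_eqI [OF rs(1)]
          colored_end_eqI [OF r(3)] colored_end_eqI [OF rs(2)])
    have mG: "m \<in> arcs G"
      using mM M_arcs by blast
    have "a \<in> edge_ends G (tail G m)" "b \<in> edge_ends G (tail G m)" "a' \<in> edge_ends G (head G m)" "b' \<in> edge_ends G (head G m)"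
      using r(1,3) free_endsD(3) by blast+
    then have "turn \<gamma> (m, Tail) a \<noteq> turn \<gamma> (m, Tail) b" "turn \<gamma> (m, Head) a' \<noteq> turn \<gamma> (m, Head) b'"
      using turn_neq [of "(m, Tail)"] turn_neq [of "(m, Head)"] mG r(2,4) by auto
    then show "- (?\<tau> (m, Tail) * ?\<tau> (m, Head)) = (if fits_crossed c m then -1 else 1)"
      using ij' unfolding X by (elim disjE conjE) (auto simp: ends)
  qed
  finally have "(\<Prod>e\<in>?C. \<Prod>f\<in>?D - {e}. (-1) ^ card (hits e f)) = (\<Prod>m\<in>?C \<inter> ?D. if fits_crossed c m then -1 else 1 :: complex)" .
  then have "complex_of_int ((-1) ^ card (edge_crossings ?C ?D)) = of_int (\<Prod>m\<in>?C \<inter> ?D. if fits_crossed c m then -1 else 1)"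
    unfolding sign_edge_crossings [OF color_class_arcs color_class_arcs]
    by (simp add: of_int_prod if_distrib [of of_int] cong: if_cong)
  then show ?thesis
    by (simp only: of_int_eq_iff)
qed

end

section \<open>The sign of an admissible coloring and the comparison of the two sums\<close>

context matched_immersion
begin

lemma finite_tokens: "finite tokens"
proof (rule finite_subset)
  show "tokens \<subseteq> arcs G \<times> (arcs G \<times> UNIV)"
    using M_arcs free_endsD(1) unfolding tokens_def by fastforce
qed simp

lemma finite_bicolored_pairs: "finite (bicolored_pairs c)"
proof (rule finite_subset)
  let ?W = "tokens \<times> snd ` \<Union>(crossings G \<gamma>)"
  show "bicolored_pairs c \<subseteq> ?W \<times> ?W"
  proof
    fix z
    assume "z \<in> bicolored_pairs c"
    then obtain k s l t where z: "z = ((k, s), (l, t))" "k \<in> tokens" "l \<in> tokens"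
      "{(fst k, s), (fst l, t)} \<in> crossings G \<gamma>"
      unfolding bicolored_pairs_def by blast
    then have "(fst k, s) \<in> \<Union>(crossings G \<gamma>)" "(fst l, t) \<in> \<Union>(crossings G \<gamma>)"
      by blast+
    then have "s \<in> snd ` \<Union>(crossings G \<gamma>)" "t \<in> snd ` \<Union>(crossings G \<gamma>)"
      by force+
    then show "z \<in> ?W \<times> ?W"
      using z by simp
  qed
  show "finite (?W \<times> ?W)"
    using finite_tokens finite_crossings finite_crossing by auto
qed

lemma token_color:
  assumes "c \<in> edge_colorings n" "k \<in> tokens"
  shows "c (fst (snd k)) \<in> {1..n}"
proof -
  have "fst (snd k) \<in> arcs G - M"
    using assms(2) free_endsD(1) unfolding tokens_def by fastforce
  then show ?thesis
    using assms(1) unfolding edge_colorings_def by (rule PiE_mem [rotated])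
qed

text \<open>A matching edge carries two arcs, but in an admissible coloring they have different
  colors; within one color a token is therefore determined by its edge.\<close>

lemma bij_betw_tokens_color_class:
  assumes c: "admissible c"
  shows "bij_betw fst {k \<in> tokens. c (fst (snd k)) = i} (color_class c i)"
  unfolding bij_betw_def
proof
  show "inj_on fst {k \<in> tokens. c (fst (snd k)) = i}"
  proof (rule inj_onI)
    fix k l
    assume "k \<in> {k \<in> tokens. c (fst (snd k)) = i}" "l \<in> {k \<in> tokens. c (fst (snd k)) = i}" and eq: "fst k = fst l"
    then have kl: "k \<in> tokens" "l \<in> tokens" "c (fst (snd k)) = i" "c (fst (snd l)) = i"
      by simp_all
    show "k = l"
    proof (cases "fst k \<in> M")
      case True
      obtain a b a' b' where r: "free_ends G M (tail G (fst k)) = {a, b}" "c (fst a) \<noteq> c (fst b)"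
        by (rule admissible_matching_edge [OF c True]) (rule that)
      have "snd k \<in> {a, b}" "snd l \<in> {a, b}"
        using kl(1,2) True eq unfolding r(1) [symmetric] tokens_def by auto
      then have "snd k = snd l"
        using kl(3,4) r(2) by auto
      then show ?thesis
        using eq by (simp add: prod_eq_iff)
    next
      case False
      then show ?thesis
        using kl(1,2) eq unfolding tokens_def by auto
    qed
  qed
  show "fst ` {k \<in> tokens. c (fst (snd k)) = i} = color_class c i"
  proof
    show "fst ` {k \<in> tokens. c (fst (snd k)) = i} \<subseteq> color_class c i"
      unfolding tokens_def color_class_def by auto
    show "color_class c i \<subseteq> fst ` {k \<in> tokens. c (fst (snd k)) = i}"
    proof
      fix e
      assume "e \<in> color_class c i"
      then consider "e \<in> arcs G - M" "c e = i" | x where "e \<in> M" "x \<in> free_ends G M (tail G e)" "c (fst x) = i"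
        unfolding color_class_def by blast
      then show "e \<in> fst ` {k \<in> tokens. c (fst (snd k)) = i}"
      proof cases
        case 1
        then have "(e, (e, Tail)) \<in> {k \<in> tokens. c (fst (snd k)) = i}"
          unfolding tokens_def by simp
        then show ?thesis
          by (rule image_eqI [rotated]) simp
      next
        case 2
        then have "(e, x) \<in> tokens"
          unfolding tokens_def by blast
        then have "(e, x) \<in> {k \<in> tokens. c (fst (snd k)) = i}"
          using 2 by simp
        then show ?thesis
          by (rule image_eqI [rotated]) simp
      qed
    qed
  qed
qed

lemma card_bicolored_pairs_colors:
  assumes c: "admissible c" and ij: "i < j"
  shows "card {z \<in> bicolored_pairs c. (c (fst (snd (fst (fst z)))), c (fst (snd (fst (snd z))))) = (i, j)} =
    card (edge_crossings (color_class c i) (color_class c j))" (is "card ?B = _")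
proof (rule bij_betw_same_card [of "map_prod (map_prod fst id) (map_prod fst id)"], unfold bij_betw_def, intro conjI)
  let ?f = "map_prod (map_prod fst id) (map_prod fst id) :: (('e \<times> 'e edge_end) \<times> real) \<times> (('e \<times> 'e edge_end) \<times> real) \<Rightarrow> ('e \<times> real) \<times> ('e \<times> real)"
  have bij: "inj_on fst {k \<in> tokens. c (fst (snd k)) = i}" "fst ` {k \<in> tokens. c (fst (snd k)) = i} = color_class c i" for i
    using bij_betw_tokens_color_class [OF c, of i] unfolding bij_betw_def by blast+
  have B: "z \<in> ?B \<longleftrightarrow> (\<exists>k s l t. z = ((k, s), (l, t)) \<and> k \<in> tokens \<and> c (fst (snd k)) = i \<and> l \<in> tokens \<and> c (fst (snd l)) = j \<and>
      {(fst k, s), (fst l, t)} \<in> crossings G \<gamma>)" for z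
    using ij unfolding bicolored_pairs_def by auto
  show "inj_on ?f ?B"
  proof (rule inj_onI)
    fix z z'
    assume "z \<in> ?B" "z' \<in> ?B" and eq: "?f z = ?f z'"
    then obtain k s l t k' s' l' t' where z: "z = ((k, s), (l, t))" "z' = ((k', s'), (l', t'))"
      and k: "k \<in> {k \<in> tokens. c (fst (snd k)) = i}" "k' \<in> {k \<in> tokens. c (fst (snd k)) = i}"
      and l: "l \<in> {k \<in> tokens. c (fst (snd k)) = j}" "l' \<in> {k \<in> tokens. c (fst (snd k)) = j}"
      unfolding B by blast
    have "fst k = fst k'" "s = s'" "fst l = fst l'" "t = t'"
      using eq unfolding z by simp_all
    then show "z = z'"
      using inj_onD [OF bij(1) _ k] inj_onD [OF bij(1) _ l] unfolding z by simp
  qed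
  show "?f ` ?B = edge_crossings (color_class c i) (color_class c j)"
  proof
    show "?f ` ?B \<subseteq> edge_crossings (color_class c i) (color_class c j)"
    proof (rule image_subsetI)
      fix z
      assume "z \<in> ?B"
      then obtain k s l t where z: "z = ((k, s), (l, t))" "{(fst k, s), (fst l, t)} \<in> crossings G \<gamma>"
        and "k \<in> {k \<in> tokens. c (fst (snd k)) = i}" "l \<in> {k \<in> tokens. c (fst (snd k)) = j}"
        unfolding B by blast
      then have "fst k \<in> color_class c i" "fst l \<in> color_class c j"
        using bij(2) by blast+
      then have "((fst k, s), (fst l, t)) \<in> edge_crossings (color_class c i) (color_class c j)"
        using z(2) unfolding edge_crossings_def by blast
      then show "?f z \<in> edge_crossings (color_class c i) (color_class c j)"
        unfolding z by simp
    qed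
    show "edge_crossings (color_class c i) (color_class c j) \<subseteq> ?f ` ?B"
    proof
      fix z
      assume "z \<in> edge_crossings (color_class c i) (color_class c j)"
      then obtain e s f t where z: "z = ((e, s), (f, t))" "e \<in> color_class c i" "f \<in> color_class c j"
        "{(e, s), (f, t)} \<in> crossings G \<gamma>"
        unfolding edge_crossings_def by blast
      obtain k where k: "k \<in> tokens" "c (fst (snd k)) = i" "e = fst k"
        using z(2) unfolding bij(2) [symmetric] by blast
      obtain l where l: "l \<in> tokens" "c (fst (snd l)) = j" "f = fst l"
        using z(3) unfolding bij(2) [symmetric] by blast
      have "((k, s), (l, t)) \<in> ?B"
        using k l z(4) unfolding B by blast
      then show "z \<in> ?f ` ?B"
        by (rule image_eqI [rotated]) (simp add: z k l)
    qed
  qed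
qed

text \<open>Bicolored crossings are sorted by their pair of colors. Each matching edge lies in the
  intersection of the classes for exactly one ordered pair of colors, the two colors at its tail,
  and so contributes its sign once.\<close>

lemma sign_bicolored_pairs:
  assumes c: "admissible c" and n: "c \<in> edge_colorings n"
  shows "(-1 :: int) ^ card (bicolored_pairs c) = (\<Prod>m\<in>M. if fits_crossed c m then -1 else 1)"
proof -
  define I where "I = {(i, j). i \<in> {1..n} \<and> j \<in> {1..n} \<and> i < j}"
  let ?col = "\<lambda>z :: (('e \<times> 'e edge_end) \<times> real) \<times> (('e \<times> 'e edge_end) \<times> real). (c (fst (snd (fst (fst z)))), c (fst (snd (fst (snd z)))))"
  let ?Int = "\<lambda>q. color_class c (fst q) \<inter> color_class c (snd q)"
  let ?g = "\<lambda>m. if fits_crossed c m then -1 else 1 :: int"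
  have finI: "finite I"
    by (rule finite_subset [of _ "{1..n} \<times> {1..n}"]) (auto simp: I_def)
  have "?col ` bicolored_pairs c \<subseteq> I"
  proof (rule image_subsetI)
    fix z
    assume "z \<in> bicolored_pairs c"
    then obtain k s l t where z: "z = ((k, s), (l, t))" "k \<in> tokens" "l \<in> tokens" "c (fst (snd k)) < c (fst (snd l))"
      unfolding bicolored_pairs_def by blast
    then show "?col z \<in> I"
      using token_color [OF n z(2)] token_color [OF n z(3)] unfolding I_def by simp
  qed
  then have "card (bicolored_pairs c) = (\<Sum>q\<in>I. card {z \<in> bicolored_pairs c. ?col z = q})"
    by (rule card_eq_sum_fibres [OF finite_bicolored_pairs finI])
  then have "(-1 :: int) ^ card (bicolored_pairs c) = (\<Prod>q\<in>I. (-1) ^ card {z \<in> bicolored_pairs c. ?col z = q})"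
    by (simp only: power_sum)
  also have "\<dots> = (\<Prod>q\<in>I. \<Prod>m\<in>?Int q. ?g m)"
  proof (rule prod.cong [OF refl])
    fix q
    assume "q \<in> I"
    then obtain i j where q: "q = (i, j)" "i < j"
      unfolding I_def by blast
    then show "(-1 :: int) ^ card {z \<in> bicolored_pairs c. ?col z = q} = (\<Prod>m\<in>?Int q. ?g m)"
      using card_bicolored_pairs_colors [OF c q(2)] color_class_crossing_parity [OF c, of i j] by simp
  qed
  also have "\<dots> = (\<Prod>q\<in>I. \<Prod>m\<in>{m \<in> M. m \<in> ?Int q}. ?g m)"
  proof (rule prod.cong [OF refl])
    fix q
    assume "q \<in> I"
    then have "fst q \<noteq> snd q"
      unfolding I_def by auto
    then have "?Int q = {m \<in> M. m \<in> ?Int q}"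
      using color_class_Int by blast
    then show "(\<Prod>m\<in>?Int q. ?g m) = (\<Prod>m\<in>{m \<in> M. m \<in> ?Int q}. ?g m)"
      by (rule arg_cong)
  qed
  also have "\<dots> = (\<Prod>m\<in>M. \<Prod>q\<in>{q \<in> I. m \<in> ?Int q}. ?g m)"
    by (rule prod.swap_restrict [OF finI finite_M])
  also have "\<dots> = (\<Prod>m\<in>M. ?g m)"
  proof (rule prod.cong [OF refl])
    fix m
    assume m: "m \<in> M"
    obtain a b a' b' where r: "free_ends G M (tail G m) = {a, b}" "c (fst a) \<noteq> c (fst b)"
      by (rule admissible_matching_edge [OF c m]) (rule that)
    have cls: "m \<in> color_class c k \<longleftrightarrow> k = c (fst a) \<or> k = c (fst b)" for k
      using m r(1) by (auto simp: color_class_def)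
    have "fst a \<in> arcs G - M" "fst b \<in> arcs G - M"
      using r(1) free_endsD(1) by blast+
    then have col: "c (fst a) \<in> {1..n}" "c (fst b) \<in> {1..n}"
      using n unfolding edge_colorings_def by (auto simp: PiE_iff)
    have "{q \<in> I. m \<in> ?Int q} = {(min (c (fst a)) (c (fst b)), max (c (fst a)) (c (fst b)))}"
      using col r(2) unfolding I_def Int_iff cls by (auto simp: min_def max_def)
    then show "(\<Prod>q\<in>{q \<in> I. m \<in> ?Int q}. ?g m) = ?g m"
      by simp
  qed
  finally show ?thesis .
qed

theorem PK_eq_matching_polynomial: "PK G M \<gamma> n = int (matching_polynomial G M n)"
  unfolding PK_eq_sum matching_polynomial_eq_sum
proof (rule sum.cong [OF refl])
  fix c
  assume n: "c \<in> edge_colorings n"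
  let ?P = "fits_parallel c" and ?X = "fits_crossed c"
  have "(\<Sum>S\<in>Pow M. of_bool ((\<forall>m\<in>S. ?X m) \<and> (\<forall>m\<in>M - S. ?P m) \<and> (\<forall>m\<in>M. separated c m))) =
    (\<Sum>S\<in>Pow M. (\<Prod>m\<in>S. of_bool (?X m)) * (\<Prod>m\<in>M - S. of_bool (?P m)) * of_bool (\<forall>m\<in>M. separated c m) :: int)"
  proof (rule sum.cong [OF refl])
    fix S
    assume "S \<in> Pow M"
    then have fin: "finite S" "finite (M - S)"
      using finite_M finite_subset by auto
    show "of_bool ((\<forall>m\<in>S. ?X m) \<and> (\<forall>m\<in>M - S. ?P m) \<and> (\<forall>m\<in>M. separated c m)) =
      (\<Prod>m\<in>S. of_bool (?X m)) * (\<Prod>m\<in>M - S. of_bool (?P m)) * (of_bool (\<forall>m\<in>M. separated c m) :: int)"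
      by (simp only: prod_of_bool [OF fin(1)] prod_of_bool [OF fin(2)] of_bool_conj mult.assoc)
  qed
  also have "\<dots> = (\<Prod>m\<in>M. of_bool (?X m) + of_bool (?P m)) * of_bool (\<forall>m\<in>M. separated c m)"
    unfolding prod_add [OF finite_M] sum_distrib_right ..
  also have "\<dots> = (-1) ^ card (bicolored_pairs c) * (\<Prod>m\<in>M. - of_bool (?X m) + of_bool (?P m))"
  proof (cases "admissible c")
    case True
    have sep: "separated c m" if m: "m \<in> M" for m
    proof -
      obtain a b a' b' where r: "free_ends G M (tail G m) = {a, b}" "c (fst a) \<noteq> c (fst b)"
        by (rule admissible_matching_edge [OF True m]) (rule that)
      then show ?thesis
        unfolding separated_def r(1) by auto
    qed
    have ne: "?P m \<longleftrightarrow> \<not> ?X m" if "m \<in> M" for m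
      using True that unfolding admissible_def by blast
    have 1: "(\<Prod>m\<in>M. of_bool (?X m) + of_bool (?P m)) = (1 :: int)"
      by (rule prod.neutral) (simp add: ne)
    have 2: "(\<Prod>m\<in>M. - of_bool (?X m) + of_bool (?P m)) = (\<Prod>m\<in>M. if ?X m then -1 else 1 :: int)"
      by (rule prod.cong) (simp_all add: ne)
    \<comment> \<open>The sign of the coloring equals the product of the replacement signs, so
      together they form a square.\<close>
    have 3: "(\<Prod>m\<in>M. if ?X m then -1 else 1 :: int) * (\<Prod>m\<in>M. if ?X m then -1 else 1) = 1"
      unfolding prod.distrib [symmetric] by (rule prod.neutral) simp
    have "(of_bool (\<forall>m\<in>M. separated c m) :: int) = 1"
      using sep by simp
    then show ?thesis
      unfolding sign_bicolored_pairs [OF True n] 1 2 3 by simp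
  next
    case False
    then obtain m where m: "m \<in> M" "?P m = ?X m"
      unfolding admissible_def by blast
    then have "(\<Prod>m\<in>M. - of_bool (?X m) + of_bool (?P m)) = (0 :: int)"
      using finite_M by (intro prod_zero) (auto intro!: bexI [of _ m])
    moreover have "(\<Prod>m\<in>M. of_bool (?X m) + of_bool (?P m)) * of_bool (\<forall>m\<in>M. separated c m) = (0 :: int)"
    \<comment> \<open>In the first case both replacements fit: the two tail ends share the color of
      one head end, so the marker at \<open>m\<close> fails. In the second case neither fits, and
      the factor of \<open>m\<close> is 0.\<close>
    proof (cases "?X m")
      case True
      obtain a b a' b' where r: "free_ends G M (tail G m) = {a, b}" "a \<noteq> b"
        "parallel_replacement G M \<gamma> m = {(a, a'), (b, b')}" "crossed_replacement G M \<gamma> m = {(a, b'), (b, a')}"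
        by (rule replacements_at [OF m(1)]) (rule that)
      have "compatible c {(a, a'), (b, b')}" "compatible c {(a, b'), (b, a')}"
        using True m(2) unfolding r(3,4) by simp_all
      moreover have "compatible c {(x, y), (z, w)} \<longleftrightarrow> c (fst x) = c (fst y) \<and> c (fst z) = c (fst w)" for x y z w
        by (simp add: compatible_def)
      ultimately have "c (fst a) = c (fst a')" "c (fst b) = c (fst a')"
        by blast+
      then have "c (fst a) = c (fst b)"
        by (simp only:)
      then have "\<not> separated c m"
        using r(1,2) unfolding separated_def by blast
      then have "\<not> (\<forall>m\<in>M. separated c m)"
        using m(1) by blast
      then show ?thesis
        by simp
    next
      case False
      then have "(\<Prod>m\<in>M. of_bool (?X m) + of_bool (?P m)) = (0 :: int)"
        using m finite_M by (intro prod_zero) (auto intro!: bexI [of _ m])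
      then show ?thesis
        by simp
    qed
    ultimately show ?thesis
      by simp
  qed
  finally show "(-1 :: int) ^ card (bicolored_pairs c) * (\<Prod>m\<in>M. - of_bool (?X m) + of_bool (?P m)) =
    (\<Sum>S\<in>Pow M. of_bool ((\<forall>m\<in>S. ?X m) \<and> (\<forall>m\<in>M - S. ?P m) \<and> (\<forall>m\<in>M. separated c m)))" ..
qed

end

theorem mainTheorem1:
  fixes G :: "('v, 'e) pre_digraph" and M :: "'e set"
    and p :: "'v \<Rightarrow> complex" and \<gamma> :: "'e \<Rightarrow> real \<Rightarrow> complex" and n :: nat
  assumes "fin_digraph G"
    and "trivalent G"
    and "perfect_matching G M"
    and "plane_immersion G p \<gamma>"
    and "n > 0"
  shows "PK G M \<gamma> n = int (matching_polynomial G M n)"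
proof -
  interpret fin_digraph G
    by fact
  interpret matched_immersion G p \<gamma> M
    by unfold_locales fact+
  show ?thesis
    by (rule PK_eq_matching_polynomial)
qed

end
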